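(* Let $\lambda>0$ and let $B^{\lambda,br}$ be a Brownian bridge of length $1$ from $0$ to $\lambda$. Then its Vervaat transform $(V(B^{\lambda,br})_t; 0 \leq t \leq 1)$ is not a Markov process with respect to its induced filtration.
   Context: For a continuous $f:[0,1]\to\mathbb{R}$ with $f(0)=0$, let $\tau(f)$ be the first time at which the minimum of $f$ on $[0,1]$ is attained. The Vervaat transform of $f$ is $V(f)(t):=f(\tau(f)+t \bmod 1)+f(1)1_{\{t+\tau(f) \geq 1\}}-f(\tau(f))$, $t\in[0,1]$. Markov processes are not assumed to be time-homogeneous. *)

theory Defs
  imports "HOL-Probability.Probability"
begin

definition first_argmin :: "(real \<Rightarrow> real) \<Rightarrow> real" where
  "first_argmin f = (LEAST t. t \<in> {0..1} \<and> (\<forall>s\<in>{0..1}. f t \<le> f s))"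

text \<open>The value \<open>frac x\<close> is \<open>x\<close> modulo 1, taken in \<open>[0,1)\<close>.\<close>

definition vervaat :: "(real \<Rightarrow> real) \<Rightarrow> real \<Rightarrow> real" where
  "vervaat f t =
     f (frac (first_argmin f + t))
     + f 1 * indicator {1..} (t + first_argmin f)
     - f (first_argmin f)"

text \<open>Degenerate (almost surely constant) variables count as Gaussian; a bridge needs this at its
  two endpoints.\<close>

definition gaussian_variable :: "'a measure \<Rightarrow> ('a \<Rightarrow> real) \<Rightarrow> bool" where
  "gaussian_variable M Y \<longleftrightarrow>
     (\<exists>\<mu> \<sigma>. \<sigma> > 0 \<and> distributed M lborel Y (normal_density \<mu> \<sigma>))
     \<or> (Y \<in> borel_measurable M \<and> (\<exists>\<mu>. AE \<omega> in M. Y \<omega> = \<mu>))"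

definition gaussian_process :: "'a measure \<Rightarrow> real set \<Rightarrow> (real \<Rightarrow> 'a \<Rightarrow> real) \<Rightarrow> bool" where
  "gaussian_process M I X \<longleftrightarrow>
     (\<forall>J c. finite J \<and> J \<subseteq> I \<longrightarrow> gaussian_variable M (\<lambda>\<omega>. \<Sum>t\<in>J. c t * X t \<omega>))"

text \<open>Brownian bridge of length 1 from 0 to \<open>b\<close>: the continuous Gaussian process on \<open>[0,1]\<close> with
  mean \<open>b t\<close> and covariance \<open>s (1 - t)\<close> for \<open>s \<le> t\<close>. It has variance 0 at time 1, so it equals
  \<open>b\<close> there almost surely. Paths are required to be continuous for every outcome, so that the
  bridge is a random element of \<open>C[0,1]\<close>.\<close>

definition brownian_bridge :: "'a measure \<Rightarrow> real \<Rightarrow> (real \<Rightarrow> 'a \<Rightarrow> real) \<Rightarrow> bool" where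
  "brownian_bridge M b B \<longleftrightarrow>
     gaussian_process M {0..1} B
     \<and> (\<forall>t\<in>{0..1}. (\<integral>\<omega>. B t \<omega> \<partial>M) = b * t)
     \<and> (\<forall>s\<in>{0..1}. \<forall>t\<in>{0..1}. s \<le> t \<longrightarrow>
          (\<integral>\<omega>. (B s \<omega> - b * s) * (B t \<omega> - b * t) \<partial>M) = s * (1 - t))
     \<and> (\<forall>\<omega>\<in>space M. B 0 \<omega> = 0 \<and> continuous_on {0..1} (\<lambda>t. B t \<omega>))"

definition induced_filtration ::
  "'a measure \<Rightarrow> real set \<Rightarrow> (real \<Rightarrow> 'a \<Rightarrow> real) \<Rightarrow> real \<Rightarrow> 'a measure" where
  "induced_filtration M I X s =
     sigma (space M) (\<Union>u\<in>{u\<in>I. u \<le> s}. sets (vimage_algebra (space M) (X u) borel))"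

text \<open>\<open>P(X\<^sub>t \<in> A | F\<^sub>s) = P(X\<^sub>t \<in> A | X\<^sub>s)\<close> almost surely, without time-homogeneity. Measurability of
  \<open>X\<close> is deliberately not a conjunct, so a process cannot fail to be Markov merely for lack of
  it.\<close>

definition markov_process ::
  "'a measure \<Rightarrow> real set \<Rightarrow> (real \<Rightarrow> 'a measure) \<Rightarrow> (real \<Rightarrow> 'a \<Rightarrow> real) \<Rightarrow> bool" where
  "markov_process M I F X \<longleftrightarrow>
     (\<forall>s\<in>I. \<forall>t\<in>I. s \<le> t \<longrightarrow> (\<forall>A\<in>sets borel.
        AE \<omega> in M.
          real_cond_exp M (F s) (\<lambda>\<omega>. indicator A (X t \<omega>)) \<omega>
          = real_cond_exp M (vimage_algebra (space M) (X s) borel) (\<lambda>\<omega>. indicator A (X t \<omega>)) \<omega>))"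

end

theory Submission
  imports Defs
begin

text \<open>Write \<open>\<tau>\<close> for the first minimiser of the bridge, \<open>V\<close> for its Vervaat transform and \<open>G\<close> for the last
  time at which \<open>V \<le> b\<close> before time 1. The bridge is recovered from \<open>V\<close> by cutting \<open>V\<close> at time \<open>1 - \<tau>\<close>, and
  every point between \<open>G\<close> and 1 is an admissible cut. The law of the bridge is invariant under cyclic shifts of
  the increments, so all these cuts are equally likely. Hence the law of \<open>V\<close> is a Markovian (sigma-finite) law
  weighted by \<open>1 - G\<close>. This weight destroys the Markov property: at a time \<open>s\<close> with \<open>V\<^sub>s > b\<close>, the odds of
  never coming back to \<open>b\<close> before time 1 against going below \<open>b\<close> once more are proportional to \<open>1 - g\<close>, where \<open>g\<close> is
  the last time before \<open>s\<close> with \<open>V \<le> b\<close>; and \<open>g\<close> is not a function of \<open>V\<^sub>s\<close>.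

  The proof makes this quantitative without computing a single density. Take \<open>s = 13/16\<close>, two past events
  (\<open>P\<close>: \<open>V > b\<close> on \<open>[1/4, s]\<close>; \<open>P'\<close>: \<open>V < b\<close> at time \<open>3/4\<close>) and two future events (\<open>F\<close>: \<open>V > b\<close> on
  \<open>[s, 1)\<close>; \<open>F'\<close>: \<open>V < b\<close> at time \<open>7/8\<close>). On the event \<open>\<tau> < 1/16\<close> the four combinations are mapped
  onto one another, without changing \<open>V\<^sub>s\<close>, by changing the sign of a hat-function component of the bridge
  around the times \<open>\<tau> + 3/4\<close> and \<open>\<tau> + 7/8\<close>. Such a flip preserves the law of the bridge (lemma
  \<open>distr_delayed_flip\<close>), so all four combinations have the same probability \<open>a\<close> given \<open>V\<^sub>s\<close>, if the
  events are trimmed so that the flips neither destroy the minimum nor leave the events. Removing the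
  restriction \<open>\<tau> < 1/16\<close> with cyclic shifts multiplies these probabilities by the number of possible windows
  of length \<open>1/16\<close> for \<open>\<tau>\<close> (lemma \<open>cross_bounds\<close>): at least 12 for \<open>P \<inter> F\<close>, at most 4 for \<open>P' \<inter> F\<close>, at most 2
  for \<open>P \<inter> F'\<close>, at least 1 for \<open>P' \<inter> F'\<close>. If \<open>V\<close> were Markov, past and future would be independent
  given \<open>V\<^sub>s\<close>, and the product of the first and last would equal the product of the other two, so
  \<open>12 a\<^sup>2 \<le> 8 a\<^sup>2\<close> and \<open>a = 0\<close> almost surely (lemma \<open>markov_cross_ratio\<close>). But \<open>P \<inter> F\<close> has positive
  probability, because every tube around a path has (lemma \<open>tube_not_null\<close>).\<close>

section \<open>Laws on spaces of continuous paths\<close>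

text \<open>Only the coordinates in \<open>[0,1]\<close> generate the sigma-algebra. Continuity is not a measurable condition on them,
  so it is built into the set \<open>\<Omega>\<close> of admissible paths.\<close>

definition path_space :: "(real \<Rightarrow> real) set \<Rightarrow> (real \<Rightarrow> real) measure" where
  "path_space \<Omega> = sigma \<Omega> {{f \<in> \<Omega>. \<forall>t\<in>K. f t \<in> A t} |K A.
     finite K \<and> K \<subseteq> {0..1} \<and> (\<forall>t\<in>K. A t \<in> sets borel)}"

text \<open>A list may repeat a time point, so transforming or concatenating linear combinations needs no merging of
  coefficients.\<close>

definition lin_comb :: "(real \<times> real) list \<Rightarrow> (real \<Rightarrow> real) \<Rightarrow> real" where
  "lin_comb xs f = (\<Sum>(t, c)\<leftarrow>xs. c * f t)"

lemma lin_comb_Nil [simp]: "lin_comb [] f = 0"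
  and lin_comb_Cons [simp]: "lin_comb ((t, c) # xs) f = c * f t + lin_comb xs f"
  by (simp_all add: lin_comb_def)

lemma space_path_space [simp]: "space (path_space \<Omega>) = \<Omega>"
  by (simp add: path_space_def space_measure_of_conv)

lemma sets_path_space: "sets (path_space \<Omega>) = sigma_sets \<Omega> {{f \<in> \<Omega>. \<forall>t\<in>K. f t \<in> A t} |K A.
     finite K \<and> K \<subseteq> {0..1} \<and> (\<forall>t\<in>K. A t \<in> sets borel)}"
  unfolding path_space_def by (rule sets_measure_of) auto

lemma measurable_eval_path_space:
  assumes "t \<in> {0..1}"
  shows "(\<lambda>f. f t) \<in> borel_measurable (path_space \<Omega>)"
proof (rule measurableI)
  fix S :: "real set" assume S: "S \<in> sets borel"
  have "{f \<in> \<Omega>. \<forall>u\<in>{t}. f u \<in> S} \<in> sets (path_space \<Omega>)"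
    unfolding sets_path_space
    by (rule sigma_sets.Basic) (use assms S in \<open>auto intro!: exI[of _ "{t}"] exI[of _ "\<lambda>_. S"]\<close>)
  moreover have "(\<lambda>f. f t) -` S \<inter> space (path_space \<Omega>) = {f \<in> \<Omega>. \<forall>u\<in>{t}. f u \<in> S}"
    by auto
  ultimately show "(\<lambda>f. f t) -` S \<inter> space (path_space \<Omega>) \<in> sets (path_space \<Omega>)" by simp
qed simp

lemma measurable_path_spaceI:
  assumes "\<And>\<omega>. \<omega> \<in> space N \<Longrightarrow> X \<omega> \<in> \<Omega>"
    and [measurable]: "\<And>t. t \<in> {0..1} \<Longrightarrow> (\<lambda>\<omega>. X \<omega> t) \<in> borel_measurable N"
  shows "X \<in> measurable N (path_space \<Omega>)"
  unfolding path_space_def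
proof (rule measurable_measure_of)
  show "X \<in> space N \<rightarrow> \<Omega>" using assms(1) by auto
next
  fix C assume "C \<in> {{f \<in> \<Omega>. \<forall>t\<in>K. f t \<in> A t} |K A.
     finite K \<and> K \<subseteq> {0..1} \<and> (\<forall>t\<in>K. A t \<in> sets borel)}"
  then obtain K A where K: "finite K" "K \<subseteq> {0..1}" and A: "\<And>t. t \<in> K \<Longrightarrow> A t \<in> sets borel"
    and C: "C = {f \<in> \<Omega>. \<forall>t\<in>K. f t \<in> A t}" by blast
  have "X -` C \<inter> space N = {\<omega> \<in> space N. \<forall>t\<in>K. X \<omega> t \<in> A t}"
    using assms(1) by (auto simp: C)
  also have "\<dots> \<in> sets N"
  proof (rule sets.sets_Collect_finite_All[OF _ K(1)])
    fix t assume t: "t \<in> K"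
    have "(\<lambda>\<omega>. X \<omega> t) -` A t \<inter> space N \<in> sets N"
      using K(2) t A by (intro measurable_sets[OF assms(2)]) auto
    then show "{\<omega> \<in> space N. X \<omega> t \<in> A t} \<in> sets N"
      by (simp add: vimage_def Int_def conj_commute)
  qed
  finally show "X -` C \<inter> space N \<in> sets N" .
qed auto

lemma measurable_lin_comb:
  assumes "fst ` set xs \<subseteq> {0..1}"
  shows "lin_comb xs \<in> borel_measurable (path_space \<Omega>)"
  using assms
proof (induction xs)
  case Nil
  then show ?case by (simp add: lin_comb_def[abs_def])
next
  case (Cons x xs)
  obtain t c where x: "x = (t, c)" by (cases x)
  have t: "t \<in> {0..1}" and [measurable]: "lin_comb xs \<in> borel_measurable (path_space \<Omega>)"
    using Cons x by auto
  note [measurable] = measurable_eval_path_space[OF t]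
  show ?case unfolding x lin_comb_Cons[abs_def] by measurable
qed

text \<open>Cosines with arbitrary phase determine the whole characteristic function, since the sine is a shifted cosine.\<close>

lemma char_distr_density:
  fixes X :: "'a \<Rightarrow> real"
  assumes P: "prob_space P" and [measurable]: "X \<in> borel_measurable P" "h \<in> borel_measurable P"
    and h: "\<And>x. 0 \<le> h x \<and> h x \<le> (1::real)" and m: "m = (\<integral>x. h x \<partial>P)" "0 < m"
  shows "real_distribution (distr (density P (\<lambda>x. ennreal (h x / m))) borel X)"
    and "char (distr (density P (\<lambda>x. ennreal (h x / m))) borel X) v
      = of_real ((\<integral>x. h x * cos (v * X x + 0) \<partial>P) / m)
        + \<i> * of_real ((\<integral>x. h x * cos (v * X x + (-pi/2)) \<partial>P) / m)"
proof -
  interpret P: prob_space P by (rule P)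
  define P' where "P' = density P (\<lambda>x. ennreal (h x / m))"
  have ih: "integrable P (\<lambda>x. h x * g x)" if [measurable]: "g \<in> borel_measurable P" and "\<And>x. \<bar>g x\<bar> \<le> 1" for g
    by (rule P.integrable_const_bound[where B=1])
      (use h that in \<open>auto simp: abs_mult intro!: mult_le_one\<close>)
  have ih1: "integrable P h" using ih[of "\<lambda>_. 1"] by auto
  have iP: "(\<integral>x. g x \<partial>P') = (\<integral>x. (h x / m) *\<^sub>R g x \<partial>P)" if "g \<in> borel_measurable P" for g :: "'a \<Rightarrow> complex"
    unfolding P'_def by (rule integral_density) (use h m that in auto)
  have "prob_space P'"
  proof
    have "emeasure P' (space P') = (\<integral>\<^sup>+x. ennreal (h x / m) \<partial>P)"
      by (simp add: P'_def emeasure_density cong: nn_integral_cong)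
    also have "\<dots> = ennreal (\<integral>x. h x / m \<partial>P)"
      using h m(2) ih1 by (intro nn_integral_eq_integral) auto
    also have "\<dots> = 1" using m by simp
    finally show "emeasure P' (space P') = 1" .
  qed
  then interpret P': prob_space P' .
  have XP: "X \<in> borel_measurable P'" by (simp add: P'_def)
  show "real_distribution (distr (density P (\<lambda>x. ennreal (h x / m))) borel X)"
    using P'.real_distribution_distr[OF XP] by (simp add: P'_def)
  have cis: "iexp x = of_real (cos x) + \<i> * of_real (sin x)" for x :: real
    by (simp add: exp_Euler cos_of_real sin_of_real)
  have "char (distr P' borel X) v = (\<integral>x. iexp (v * X x) \<partial>P')"
    using XP unfolding char_def by (subst integral_distr) auto
  also have "\<dots> = (\<integral>x. (h x / m) *\<^sub>R iexp (v * X x) \<partial>P)" by (rule iP) measurable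
  also have "\<dots> = (\<integral>x. of_real (h x * cos (v * X x) / m) + \<i> * of_real (h x * sin (v * X x) / m) \<partial>P)"
    by (intro Bochner_Integration.integral_cong refl)
      (simp only: cis, simp add: scaleR_conv_of_real algebra_simps add_divide_distrib)
  also have "\<dots> = (\<integral>x. of_real (h x * cos (v * X x) / m) \<partial>P) + (\<integral>x. \<i> * of_real (h x * sin (v * X x) / m) \<partial>P)"
    by (intro Bochner_Integration.integral_add integrable_mult_right integrable_of_real
        integrable_divide ih) auto
  also have "\<dots> = of_real ((\<integral>x. h x * cos (v * X x) \<partial>P) / m) + \<i> * of_real ((\<integral>x. h x * sin (v * X x) \<partial>P) / m)"
    by (simp only: integral_complex_of_real integral_mult_right_zero integral_divide_zero)
  finally have "char (distr P' borel X) v = of_real ((\<integral>x. h x * cos (v * X x) \<partial>P) / m)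
      + \<i> * of_real ((\<integral>x. h x * sin (v * X x) \<partial>P) / m)" .
  moreover have "sin u = cos (u + (- pi/2))" for u :: real by (simp add: cos_diff)
  ultimately show "char (distr (density P (\<lambda>x. ennreal (h x / m))) borel X) v
      = of_real ((\<integral>x. h x * cos (v * X x + 0) \<partial>P) / m)
        + \<i> * of_real ((\<integral>x. h x * cos (v * X x + (-pi/2)) \<partial>P) / m)"
    by (simp add: P'_def)
qed

lemma Int_stable_cylinders:
  "Int_stable {{\<omega> \<in> \<Omega>. \<forall>t\<in>J. X t \<omega> \<in> C t} |J C. finite J \<and> J \<subseteq> T \<and> (\<forall>t\<in>J. C t \<in> sets (borel :: real measure))}"
proof (rule Int_stableI)
  let ?E = "{{\<omega> \<in> \<Omega>. \<forall>t\<in>J. X t \<omega> \<in> C t} |J C. finite J \<and> J \<subseteq> T \<and> (\<forall>t\<in>J. C t \<in> sets (borel :: real measure))}"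
  fix a b assume "a \<in> ?E" "b \<in> ?E"
  then obtain K A K' A' where K: "finite K" "K \<subseteq> T" "\<forall>t\<in>K. A t \<in> sets (borel :: real measure)"
    "finite K'" "K' \<subseteq> T" "\<forall>t\<in>K'. A' t \<in> sets (borel :: real measure)"
    and a: "a = {\<omega> \<in> \<Omega>. \<forall>t\<in>K. X t \<omega> \<in> A t}" and b: "b = {\<omega> \<in> \<Omega>. \<forall>t\<in>K'. X t \<omega> \<in> A' t}" by blast
  let ?A = "\<lambda>t. (if t \<in> K then A t else UNIV) \<inter> (if t \<in> K' then A' t else UNIV)"
  have "a \<inter> b = {\<omega> \<in> \<Omega>. \<forall>t\<in>K \<union> K'. X t \<omega> \<in> ?A t}" unfolding a b by auto
  moreover have "\<forall>t\<in>K \<union> K'. ?A t \<in> sets borel" using K by auto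
  ultimately show "a \<inter> b \<in> ?E" using K by (intro CollectI exI[of _ "K \<union> K'"] exI[of _ ?A]) auto
qed

text \<open>The weights are absorbed into the measures by normalisation, which leaves Levy's uniqueness theorem. They are what
  allows the one-dimensional theorem to be applied to one coordinate after another.\<close>

lemma weighted_Levy_uniqueness:
  fixes X :: "'a \<Rightarrow> real" and Y :: "'b \<Rightarrow> real"
  assumes P: "prob_space P" and Q: "prob_space Q"
    and mP [measurable]: "X \<in> borel_measurable P" "h \<in> borel_measurable P"
    and mQ [measurable]: "Y \<in> borel_measurable Q" "k \<in> borel_measurable Q"
    and h: "\<And>x. 0 \<le> h x \<and> h x \<le> (1::real)" and k: "\<And>x. 0 \<le> k x \<and> k x \<le> (1::real)"
    and eq: "\<And>v d. (\<integral>x. h x * cos (v * X x + d) \<partial>P) = (\<integral>x. k x * cos (v * Y x + d) \<partial>Q)"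
    and A [measurable]: "A \<in> sets borel"
  shows "(\<integral>x. h x * indicator A (X x) \<partial>P) = (\<integral>x. k x * indicator A (Y x) \<partial>Q)"
proof -
  define m where "m = (\<integral>x. h x \<partial>P)"
  have mk: "m = (\<integral>x. k x \<partial>Q)" using eq[of 0 0] by (simp add: m_def)
  show ?thesis
  proof (cases "m = 0")
    case True
    have zero: "(\<integral>x. g x * indicator A (Z x) \<partial>R) = 0"
      if "prob_space R" and [measurable]: "g \<in> borel_measurable R"
        and g: "\<And>x. 0 \<le> g x \<and> g x \<le> (1::real)" "(\<integral>x. g x \<partial>R) = 0" for R and g and Z :: "'c \<Rightarrow> real"
    proof -
      interpret R: prob_space R by fact
      have "integrable R g" by (rule R.integrable_const_bound[where B=1]) (use g in auto)
      then have "AE x in R. g x = 0" using integral_nonneg_eq_0_iff_AE[of R g] g by auto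
      then have "AE x in R. g x * indicator A (Z x) = 0" by eventually_elim simp
      then show ?thesis by (rule integral_eq_zero_AE)
    qed
    show ?thesis using zero[OF P mP(2) h] zero[OF Q mQ(2) k] True mk m_def by simp
  next
    case False
    moreover have "0 \<le> m" unfolding m_def using h by auto
    ultimately have m: "m > 0" by simp
    define P' where "P' = density P (\<lambda>x. ennreal (h x / m))"
    define Q' where "Q' = density Q (\<lambda>x. ennreal (k x / m))"
    have XP: "X \<in> borel_measurable P'" and YQ: "Y \<in> borel_measurable Q'" by (simp_all add: P'_def Q'_def)
    note cP = char_distr_density[OF P mP h m_def m, folded P'_def]
    note cQ = char_distr_density[OF Q mQ k mk m, folded Q'_def]
    have "distr P' borel X = distr Q' borel Y"
      by (rule Levy_uniqueness[OF cP(1) cQ(1)]) (simp only: fun_eq_iff cP(2) cQ(2) eq, simp)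
    then have "(\<integral>x. indicator A x \<partial>distr P' borel X) = (\<integral>x. indicator A x \<partial>distr Q' borel Y :: real)" by simp
    then have "(\<integral>x. indicator A (X x) \<partial>P') = (\<integral>x. indicator A (Y x) \<partial>Q' :: real)"
      using XP YQ by (subst (asm) (1 2) integral_distr) auto
    then have "(\<integral>x. (h x / m) *\<^sub>R indicator A (X x) \<partial>P) = (\<integral>x. (k x / m) *\<^sub>R (indicator A (Y x) :: real) \<partial>Q)"
      unfolding P'_def Q'_def using h k m
      by (subst (asm) (1 2) integral_density) auto
    then show ?thesis using m by simp
  qed
qed

text \<open>One coordinate after another is moved from the trigonometric factor into the indicator factor. A cosine is not
  nonnegative, so it cannot serve as a weight, but \<open>(1 + cos) / 2\<close> can, and a product of two cosines of linear combinations
  is again a sum of such cosines.\<close>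

lemma path_law_eqI:
  assumes P: "prob_space P" and Q: "prob_space Q"
    and sP [measurable_cong]: "sets P = sets (path_space \<Omega>)"
    and sQ [measurable_cong]: "sets Q = sets (path_space \<Omega>)"
    and char: "\<And>xs. fst ` set xs \<subseteq> {0..1} \<Longrightarrow>
      (\<integral>f. iexp (lin_comb xs f) \<partial>P) = (\<integral>f. iexp (lin_comb xs f) \<partial>Q)"
  shows "P = Q"
proof -
  interpret P: prob_space P by (rule P)
  interpret Q: prob_space Q by (rule Q)
  have [simp]: "space P = \<Omega>" "space Q = \<Omega>" using sets_eq_imp_space_eq[OF sP] sets_eq_imp_space_eq[OF sQ] by auto
  define w :: "real set \<Rightarrow> (real \<Rightarrow> real set) \<Rightarrow> (real \<Rightarrow> real) \<Rightarrow> real"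
    where "w K A f = (\<Prod>t\<in>K. indicator (A t) (f t))" for K A f
  have w01: "0 \<le> w K A f \<and> w K A f \<le> 1" for K A f
    unfolding w_def by (auto intro!: prod_nonneg prod_le_1 simp: indicator_def)
  have wmeas: "w K A \<in> borel_measurable (path_space \<Omega>)"
    if "finite K" "K \<subseteq> {0..1}" "\<And>t. t \<in> K \<Longrightarrow> A t \<in> sets borel" for K A
    unfolding w_def[abs_def]
  proof (rule borel_measurable_prod)
    fix t assume "t \<in> K"
    then have t: "t \<in> {0..1}" and [measurable]: "A t \<in> sets borel" using that by auto
    note [measurable] = measurable_eval_path_space[OF t]
    show "(\<lambda>f. indicator (A t) (f t) :: real) \<in> borel_measurable (path_space \<Omega>)" by measurable
  qed
  have main: "(\<integral>f. w K A f * cos (lin_comb xs f + d) \<partial>P) = (\<integral>f. w K A f * cos (lin_comb xs f + d) \<partial>Q)"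
    if "finite K" "K \<subseteq> {0..1}" "\<And>t. t \<in> K \<Longrightarrow> A t \<in> sets borel" "fst ` set xs \<subseteq> {0..1}" for K A xs d
    using that
  proof (induction K arbitrary: xs d rule: finite_induct)
    case empty
    have [measurable]: "lin_comb xs \<in> borel_measurable (path_space \<Omega>)"
      using empty by (intro measurable_lin_comb) simp
    have e: "cos (lin_comb xs f + d) = Re (iexp d * iexp (lin_comb xs f))" for f
      by (simp add: Re_exp flip: exp_add)
        (simp add: add.commute)
    have "(\<integral>f. cos (lin_comb xs f + d) \<partial>R) = Re (iexp d * (\<integral>f. iexp (lin_comb xs f) \<partial>R))"
      if "prob_space R" "sets R = sets (path_space \<Omega>)" for R
    proof -
      interpret R: prob_space R by fact
      note that(2)[measurable_cong]
      have i: "integrable R (\<lambda>f. iexp d * iexp (lin_comb xs f))"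
        by (intro integrable_mult_right R.integrable_const_bound[where B=1]) auto
      have "(\<integral>f. Re (iexp d * iexp (lin_comb xs f)) \<partial>R) = Re (\<integral>f. iexp d * iexp (lin_comb xs f) \<partial>R)"
        using i by (rule integral_Re)
      also have "(\<integral>f. iexp d * iexp (lin_comb xs f) \<partial>R) = iexp d * (\<integral>f. iexp (lin_comb xs f) \<partial>R)"
        by (rule integral_mult_right_zero)
      finally show ?thesis by (simp only: e)
    qed
    from this[OF P sP] this[OF Q sQ] char[of xs] empty show ?case by (simp add: w_def)
  next
    case (insert t0 K)
    have K: "finite K" "K \<subseteq> {0..1}" "\<And>t. t \<in> K \<Longrightarrow> A t \<in> sets borel" and t0: "t0 \<in> {0..1}"
      and xs: "fst ` set xs \<subseteq> {0..1}" and A0[measurable]: "A t0 \<in> sets borel"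
      using insert by auto
    note wm = wmeas[OF K] 
    note [measurable] = wm measurable_lin_comb[OF xs] measurable_eval_path_space[OF t0]
    have wI: "w (insert t0 K) A f = w K A f * indicator (A t0) (f t0)" for f
      using insert by (simp add: w_def)
    have IH: "(\<integral>f. w K A f * cos (lin_comb ys f + e) \<partial>P) = (\<integral>f. w K A f * cos (lin_comb ys f + e) \<partial>Q)"
      if "fst ` set ys \<subseteq> {0..1}" for ys e
      using insert.IH[OF K(2,3) that] by blast
    have step: "(\<integral>f. (w K A f * (1 + cos (lin_comb ys f + e)) / 2) * indicator (A t0) (f t0) \<partial>P)
       = (\<integral>f. (w K A f * (1 + cos (lin_comb ys f + e)) / 2) * indicator (A t0) (f t0) \<partial>Q)"
      if ys: "fst ` set ys \<subseteq> {0..1}" for ys e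
    proof (rule weighted_Levy_uniqueness[OF P Q])
      note [measurable] = measurable_lin_comb[OF ys]
      show "(\<lambda>f. f t0) \<in> borel_measurable P" "(\<lambda>f. f t0) \<in> borel_measurable Q"
        "(\<lambda>f. w K A f * (1 + cos (lin_comb ys f + e)) / 2) \<in> borel_measurable P"
        "(\<lambda>f. w K A f * (1 + cos (lin_comb ys f + e)) / 2) \<in> borel_measurable Q"
        by measurable
      have b: "0 \<le> 1 + cos (lin_comb ys f + e)" "1 + cos (lin_comb ys f + e) \<le> 2" for f
        using cos_ge_minus_one[of "lin_comb ys f + e"] cos_le_one[of "lin_comb ys f + e"] by linarith+
      show "0 \<le> w K A f * (1 + cos (lin_comb ys f + e)) / 2 \<and> w K A f * (1 + cos (lin_comb ys f + e)) / 2 \<le> 1" for f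
        using w01[of K A f] b[of f] mult_mono[of "w K A f" 1 "1 + cos (lin_comb ys f + e)" 2] by simp
      then show "0 \<le> w K A f * (1 + cos (lin_comb ys f + e)) / 2 \<and> w K A f * (1 + cos (lin_comb ys f + e)) / 2 \<le> 1" for f .
      show "A t0 \<in> sets borel" by fact
      fix v d
      \<comment> \<open>product-to-sum formulas lead back to cosines of linear combinations with fewer indicators\<close>
      have ex: "w K A f * (1 + cos (lin_comb ys f + e)) / 2 * cos (v * f t0 + d)
        = (1/2) * (w K A f * cos (lin_comb [(t0, v)] f + d))
          + ((1/4) * (w K A f * cos (lin_comb ((t0, v) # ys) f + (e + d)))
          + (1/4) * (w K A f * cos (lin_comb ((t0, -v) # ys) f + (e - d))))" for f
      proof -
        have c: "cos (lin_comb ys f + e) * cos (v * f t0 + d) =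
          (cos ((lin_comb ys f + e) - (v * f t0 + d)) + cos ((lin_comb ys f + e) + (v * f t0 + d))) / 2"
          by (rule cos_times_cos)
        have "w K A f * (1 + cos (lin_comb ys f + e)) / 2 * cos (v * f t0 + d)
          = w K A f / 2 * (cos (v * f t0 + d) + cos (lin_comb ys f + e) * cos (v * f t0 + d))"
          by (simp add: field_simps)
        then show ?thesis unfolding c by (simp add: field_simps)
      qed
      have int: "integrable R (\<lambda>f. c * (w K A f * cos (lin_comb zs f + u)))"
        if "prob_space R" "sets R = sets (path_space \<Omega>)" "fst ` set zs \<subseteq> {0..1}" for R c zs u
      proof -
        interpret R: prob_space R by fact
        note that(2)[measurable_cong] measurable_lin_comb[OF that(3), measurable]
        show ?thesis
          by (intro integrable_mult_right R.integrable_const_bound[where B=1])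
            (use w01 in \<open>auto simp: abs_mult intro!: mult_le_one\<close>)
      qed
      have zs: "fst ` set [(t0, v)] \<subseteq> {0..1}" "fst ` set ((t0, v) # ys) \<subseteq> {0..1}"
        "fst ` set ((t0, -v) # ys) \<subseteq> {0..1}" using t0 ys by auto
      have split: "(\<integral>f. w K A f * (1 + cos (lin_comb ys f + e)) / 2 * cos (v * f t0 + d) \<partial>R)
        = (1/2) * (\<integral>f. w K A f * cos (lin_comb [(t0, v)] f + d) \<partial>R)
          + ((1/4) * (\<integral>f. w K A f * cos (lin_comb ((t0, v) # ys) f + (e + d)) \<partial>R)
          + (1/4) * (\<integral>f. w K A f * cos (lin_comb ((t0, -v) # ys) f + (e - d)) \<partial>R))"
        if R: "prob_space R" "sets R = sets (path_space \<Omega>)" for R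
        unfolding ex
        by (simp only: Bochner_Integration.integral_add[OF int[OF R zs(1)]
              Bochner_Integration.integrable_add[OF int[OF R zs(2)] int[OF R zs(3)]]]
            Bochner_Integration.integral_add[OF int[OF R zs(2)] int[OF R zs(3)]]
            integral_mult_right_zero)
      show "(\<integral>f. w K A f * (1 + cos (lin_comb ys f + e)) / 2 * cos (v * f t0 + d) \<partial>P)
        = (\<integral>f. w K A f * (1 + cos (lin_comb ys f + e)) / 2 * cos (v * f t0 + d) \<partial>Q)"
        unfolding split[OF P sP] split[OF Q sQ] IH[OF zs(1)] IH[OF zs(2)] IH[OF zs(3)] ..
    qed
    have one: "(\<integral>f. w K A f * indicator (A t0) (f t0) \<partial>P) = (\<integral>f. w K A f * indicator (A t0) (f t0) \<partial>Q)"
      using step[of "[]" 0] by simp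
    have two: "w (insert t0 K) A f * cos (lin_comb xs f + d)
       = 2 * ((w K A f * (1 + cos (lin_comb xs f + d)) / 2) * indicator (A t0) (f t0))
         - w K A f * indicator (A t0) (f t0)" for f
      by (simp add: wI field_simps)
    have int: "integrable R (\<lambda>f. 2 * ((w K A f * (1 + cos (lin_comb xs f + d)) / 2) * indicator (A t0) (f t0)))"
        "integrable R (\<lambda>f. w K A f * indicator (A t0) (f t0))"
        if "prob_space R" "sets R = sets (path_space \<Omega>)" for R
    proof -
      interpret R: prob_space R by fact
      note that(2)[measurable_cong]
      have b: "\<bar>1 + cos (lin_comb xs f + d)\<bar> \<le> 2" for f
        using cos_ge_minus_one[of "lin_comb xs f + d"] cos_le_one[of "lin_comb xs f + d"] by linarith
      have bb: "\<bar>w K A f\<bar> * \<bar>1 + cos (lin_comb xs f + d)\<bar> \<le> 2" for f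
        using w01[of K A f] mult_mono[of "\<bar>w K A f\<bar>" 1 "\<bar>1 + cos (lin_comb xs f + d)\<bar>" 2] b[of f] by simp
      show "integrable R (\<lambda>f. 2 * ((w K A f * (1 + cos (lin_comb xs f + d)) / 2) * indicator (A t0) (f t0)))"
        by (rule R.integrable_const_bound[where B=2])
          (use bb in \<open>auto simp: abs_mult indicator_def\<close>)
      show "integrable R (\<lambda>f. w K A f * indicator (A t0) (f t0))"
        by (rule R.integrable_const_bound[where B=1])
          (use w01 in \<open>auto simp: abs_mult indicator_def\<close>)
    qed
    show ?case
      unfolding two
      unfolding Bochner_Integration.integral_diff[OF int[OF P sP]] Bochner_Integration.integral_diff[OF int[OF Q sQ]]
        integral_mult_right_zero step[OF xs] one ..
  qed
  let ?E = "{{f \<in> \<Omega>. \<forall>t\<in>K. f t \<in> A t} |K A. finite K \<and> K \<subseteq> {0..1} \<and> (\<forall>t\<in>K. A t \<in> sets (borel :: real measure))}"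
  show ?thesis
  proof (rule measure_eqI_generator_eq[where E = ?E and \<Omega> = \<Omega> and A = "\<lambda>_. \<Omega>"])
    show "Int_stable ?E" by (rule Int_stable_cylinders[where X = "\<lambda>t f. f t"])
    show "?E \<subseteq> Pow \<Omega>" by auto
    show "sets P = sigma_sets \<Omega> ?E" "sets Q = sigma_sets \<Omega> ?E" using sP sQ sets_path_space by auto
    have "\<Omega> \<in> ?E" by (intro CollectI exI[of _ "{}"]) auto
    then show "range (\<lambda>_. \<Omega>) \<subseteq> ?E" by auto
    show "(\<Union>i::nat. \<Omega>) = \<Omega>" by auto
    show "emeasure P \<Omega> \<noteq> \<infinity>" by simp
    fix X assume "X \<in> ?E"
    then obtain K A where K: "finite K" "K \<subseteq> {0..1}" "\<And>t. t \<in> K \<Longrightarrow> A t \<in> sets (borel :: real measure)"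
      and X: "X = {f \<in> \<Omega>. \<forall>t\<in>K. f t \<in> A t}" by blast
    have wi: "w K A f = indicator X f" if "f \<in> \<Omega>" for f
      using K(1) that by (auto simp: w_def X indicator_def)
    have XS: "X \<in> sets (path_space \<Omega>)"
      unfolding sets_path_space X by (rule sigma_sets.Basic) (use K in auto)
    have "measure P X = (\<integral>f. w K A f \<partial>P)"
      using XS sP wi by (subst Bochner_Integration.integral_cong[OF refl, of _ _ "indicator X"]) (auto simp: X intro!: arg_cong[of _ _ "measure P"])
    also have "\<dots> = (\<integral>f. w K A f \<partial>Q)" using main[of K A "[]" 0] K by simp
    also have "\<dots> = measure Q X"
      using XS sQ wi by (subst Bochner_Integration.integral_cong[OF refl, of _ _ "indicator X"]) (auto simp: X intro!: arg_cong[of _ _ "measure Q"])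
    finally show "emeasure P X = emeasure Q X" by (simp add: P.emeasure_eq_measure Q.emeasure_eq_measure)
  qed
qed

section \<open>The Vervaat transform, cyclic shifts and flips of a path\<close>

text \<open>The variable right end point is needed to locate the minimum from an initial segment of the path.\<close>

definition argmin_upto :: "real \<Rightarrow> (real \<Rightarrow> real) \<Rightarrow> real" where
  "argmin_upto d f = (LEAST t. t \<in> {0..d} \<and> (\<forall>s\<in>{0..d}. f t \<le> f s))"

lemma first_argmin_eq_argmin_upto: "first_argmin f = argmin_upto 1 f"
  by (simp add: first_argmin_def argmin_upto_def)

lemma argmin_upto_eqI:
  assumes "t \<in> {0..d}" "\<And>s. s \<in> {0..d} \<Longrightarrow> f t \<le> f s" "\<And>s. s \<in> {0..<t} \<Longrightarrow> f t < f s"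
  shows "argmin_upto d f = t"
  unfolding argmin_upto_def
proof (rule Least_equality)
  show "t \<in> {0..d} \<and> (\<forall>s\<in>{0..d}. f t \<le> f s)" using assms by auto
  fix y assume y: "y \<in> {0..d} \<and> (\<forall>s\<in>{0..d}. f y \<le> f s)"
  show "t \<le> y"
  proof (rule ccontr)
    assume "\<not> t \<le> y"
    then have "f t < f y" using y assms(3)[of y] by auto
    then show False using y assms(1) by force
  qed
qed

lemma argmin_upto_props:
  assumes cont: "continuous_on {0..d} f" and d: "0 \<le> d"
  shows "argmin_upto d f \<in> {0..d}"
    and "s \<in> {0..d} \<Longrightarrow> f (argmin_upto d f) \<le> f s"
    and "s \<in> {0..<argmin_upto d f} \<Longrightarrow> f (argmin_upto d f) < f s"
proof -
  obtain x where x: "x \<in> {0..d}" "\<And>s. s \<in> {0..d} \<Longrightarrow> f x \<le> f s"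
    using continuous_attains_inf[OF compact_Icc _ cont] d by auto
  define S where "S = {0..d} \<inter> f -` {..f x}"
  have "closed S" unfolding S_def
    by (intro continuous_closed_preimage cont closed_atLeastAtMost closed_atMost)
  moreover have "S \<noteq> {}" "bdd_below S" using x by (auto simp: S_def intro!: bdd_belowI[of _ 0])
  ultimately have I: "Inf S \<in> S" using closed_contains_Inf by blast
  define t where "t = Inf S"
  have t: "t \<in> {0..d}" "f t \<le> f x" using I by (auto simp: S_def t_def)
  have t2: "f t \<le> f s" if "s \<in> {0..d}" for s using t x(2)[OF that] by linarith
  have t3: "f t < f s" if "s \<in> {0..<t}" for s
  proof (rule ccontr)
    assume "\<not> f t < f s"
    then have "s \<in> S" using that t by (auto simp: S_def)
    then have "t \<le> s" using \<open>bdd_below S\<close> by (auto simp: t_def intro: cInf_lower)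
    then show False using that by auto
  qed
  have e: "argmin_upto d f = t" by (rule argmin_upto_eqI) (use t t2 t3 in auto)
  show "argmin_upto d f \<in> {0..d}" using e t by simp
  show "s \<in> {0..d} \<Longrightarrow> f (argmin_upto d f) \<le> f s" using e t2 by simp
  show "s \<in> {0..<argmin_upto d f} \<Longrightarrow> f (argmin_upto d f) < f s" using e t3 by simp
qed

lemma rational_near:
  fixes f :: "real \<Rightarrow> real"
  assumes cont: "continuous_on {p..q} f" and "p < q" "x \<in> {p..q}" "0 < e"
  obtains r where "r \<in> \<rat>" "r \<in> {p..q}" "\<bar>f r - f x\<bar> < e"
proof -
  obtain \<delta> where \<delta>: "\<delta> > 0" "\<And>y. y \<in> {p..q} \<Longrightarrow> dist y x < \<delta> \<Longrightarrow> dist (f y) (f x) < e"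
    using cont assms(3,4) unfolding continuous_on_iff by blast
  have "max p (x - \<delta>) < min q (x + \<delta>)" using assms \<delta> by auto
  then obtain r where r: "r \<in> \<rat>" "max p (x - \<delta>) < r" "r < min q (x + \<delta>)"
    using Rats_dense_in_real by blast
  have "\<bar>f r - f x\<bar> < e" using \<delta>(2)[of r] r by (auto simp: dist_real_def)
  then show ?thesis using that[of r] r by auto
qed

text \<open>The minimiser is at most \<open>r\<close> iff the infimum over \<open>[0,r]\<close> is no larger than that over \<open>[0,d]\<close>; for a
  continuous path, rational times suffice for both infima.\<close>

lemma borel_measurable_argmin_upto:
  fixes X :: "'a \<Rightarrow> real \<Rightarrow> real"
  assumes meas: "\<And>t. t \<in> {0..d} \<Longrightarrow> (\<lambda>\<omega>. X \<omega> t) \<in> borel_measurable N"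
    and cont: "\<And>\<omega>. \<omega> \<in> space N \<Longrightarrow> continuous_on {0..d} (X \<omega>)" and d: "0 < d"
  shows "(\<lambda>\<omega>. argmin_upto d (X \<omega>)) \<in> borel_measurable N"
  unfolding borel_measurable_iff_le
proof
  fix r :: real
  show "{\<omega> \<in> space N. argmin_upto d (X \<omega>) \<le> r} \<in> sets N"
  proof (cases "r < 0 \<or> r \<ge> d")
    case True
    then have "{\<omega> \<in> space N. argmin_upto d (X \<omega>) \<le> r} = {} \<or> {\<omega> \<in> space N. argmin_upto d (X \<omega>) \<le> r} = space N"
      using argmin_upto_props(1)[OF cont] d by fastforce
    then show ?thesis by (metis sets.empty_sets sets.top)
  next
    case False
    then have r: "0 \<le> r" "r < d" by auto
    define D where "D = insert 0 (\<rat> \<inter> {0..r})"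
    have eq: "argmin_upto d f \<le> r \<longleftrightarrow> (\<forall>q\<in>\<rat> \<inter> {0..d}. \<forall>n::nat. \<exists>p\<in>D. f p < f q + 1 / Suc n)"
      if f: "continuous_on {0..d} f" for f
    proof
      define a where "a = argmin_upto d f"
      note a = argmin_upto_props[OF f less_imp_le[OF d], folded a_def]
      {
        assume "argmin_upto d f \<le> r"
        then have ar: "a \<le> r" by (simp add: a_def)
        show "\<forall>q\<in>\<rat> \<inter> {0..d}. \<forall>n::nat. \<exists>p\<in>D. f p < f q + 1 / Suc n"
        proof (intro ballI allI)
          fix q n assume q: "q \<in> \<rat> \<inter> {0..d}"
          show "\<exists>p\<in>D. f p < f q + 1 / Suc n"
          proof (cases "r = 0")
            case True
            then have "a = 0" using ar a by auto
            have "f 0 \<le> f q" using a(2)[of q] q \<open>a = 0\<close> by auto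
            moreover have "(0::real) < 1 / Suc n" by simp
            ultimately show ?thesis unfolding D_def by (intro bexI[of _ 0]) (linarith, simp)
          next
            case False
            have "continuous_on {0..r} f" using r by (intro continuous_on_subset[OF f]) auto
            then obtain p where p: "p \<in> \<rat>" "p \<in> {0..r}" "\<bar>f p - f a\<bar> < 1 / Suc n"
              using rational_near[of 0 r f a "1 / Suc n"] r False ar a(1) by auto
            then show ?thesis using a(2)[of q] q unfolding D_def by (intro bexI[of _ p]) auto
          qed
        qed
      }
      {
        assume R: "\<forall>q\<in>\<rat> \<inter> {0..d}. \<forall>n::nat. \<exists>p\<in>D. f p < f q + 1 / Suc n"
        show "argmin_upto d f \<le> r"
        proof (rule ccontr)
          assume "\<not> argmin_upto d f \<le> r"
          then have ar: "r < a" by (simp add: a_def)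
          have "continuous_on {0..r} f" using r by (intro continuous_on_subset[OF f]) auto
          then obtain x where x: "x \<in> {0..r}" "\<And>s. s \<in> {0..r} \<Longrightarrow> f x \<le> f s"
            using continuous_attains_inf[OF compact_Icc, of 0 r f] r by auto
          define e where "e = (f x - f a) / 2"
          have e: "e > 0" using a(3)[of x] x ar by (auto simp: e_def)
          obtain q where q: "q \<in> \<rat>" "q \<in> {0..d}" "\<bar>f q - f a\<bar> < e"
            using rational_near[OF f d a(1) e] by blast
          obtain n where n: "1 / Suc n < e" using nat_approx_posE[OF e] by blast
          obtain p where p: "p \<in> D" "f p < f q + 1 / Suc n" using R q by blast
          have "f x \<le> f p" using p(1) x(2)[of p] r by (auto simp: D_def)
          moreover have "f x = f a + 2 * e" unfolding e_def by (simp add: field_simps)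
          moreover have "f q - f a < e" using q(3) by simp
          moreover have False if "y \<le> y'" "y' < u + z" "z < e" "y = v + 2 * e" "u - v < e" for y y' u v z :: real
            using that by linarith
          ultimately show False using p(2) n by blast
        qed
      }
    qed
    have Dc: "countable D" and Dr: "D \<subseteq> {0..d}" using countable_rat r by (auto simp: D_def)
    have "{\<omega> \<in> space N. argmin_upto d (X \<omega>) \<le> r}
       = {\<omega> \<in> space N. \<forall>q\<in>\<rat> \<inter> {0..d}. \<forall>n::nat. \<exists>p\<in>D. X \<omega> p < X \<omega> q + 1 / Suc n}"
      using eq[OF cont] by auto
    also have "\<dots> \<in> sets N"
    proof (intro sets.sets_Collect_countable_All' sets.sets_Collect_countable_All
        sets.sets_Collect_countable_Ex')
      fix q n p assume q: "q \<in> \<rat> \<inter> {0..d}" and p: "p \<in> D"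
      have [measurable]: "(\<lambda>\<omega>. X \<omega> p) \<in> borel_measurable N" "(\<lambda>\<omega>. X \<omega> q) \<in> borel_measurable N"
        using p q Dr by (auto intro!: meas)
      show "{\<omega> \<in> space N. X \<omega> p < X \<omega> q + 1 / real (Suc n)} \<in> sets N" by measurable
    qed (use Dc countable_rat in auto)
    finally show ?thesis .
  qed
qed

lemma floor_grid:
  fixes x :: real
  shows "of_int \<lfloor>real (Suc n) * x\<rfloor> / real (Suc n) \<le> x"
    and "x - 1 / real (Suc n) \<le> of_int \<lfloor>real (Suc n) * x\<rfloor> / real (Suc n)"
proof -
  have "real_of_int \<lfloor>real (Suc n) * x\<rfloor> \<le> real (Suc n) * x" "real (Suc n) * x - 1 \<le> of_int \<lfloor>real (Suc n) * x\<rfloor>"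
    by linarith+
  moreover have "x - 1 / Suc n = (real (Suc n) * x - 1) / real (Suc n)"
    by (simp add: diff_divide_distrib del: of_nat_Suc)
  ultimately show "of_int \<lfloor>real (Suc n) * x\<rfloor> / real (Suc n) \<le> x"
    "x - 1 / real (Suc n) \<le> of_int \<lfloor>real (Suc n) * x\<rfloor> / real (Suc n)"
    by (simp_all add: divide_right_mono pos_divide_le_eq mult.commute del: of_nat_Suc)
qed

lemma floor_grid_tendsto: "(\<lambda>n. of_int \<lfloor>real (Suc n) * x\<rfloor> / real (Suc n)) \<longlonglongrightarrow> (x :: real)"
proof (rule tendsto_sandwich[where f = "\<lambda>n. x - 1 / Suc n" and h = "\<lambda>n. x"])
  have "(\<lambda>n. x - 1 / Suc n) \<longlonglongrightarrow> x - 0"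
    by (intro tendsto_diff tendsto_const LIMSEQ_Suc lim_1_over_n)
  then show "(\<lambda>n. x - 1 / Suc n) \<longlonglongrightarrow> x" by simp
qed (intro always_eventually allI floor_grid tendsto_const)+

text \<open>Rounding the random time to a grid gives a measurable evaluation, and continuity of the paths lets the grid
  become finer.\<close>

lemma borel_measurable_eval_at:
  fixes X :: "'a \<Rightarrow> real \<Rightarrow> real"
  assumes meas: "\<And>t. t \<in> {0..1} \<Longrightarrow> (\<lambda>\<omega>. X \<omega> t) \<in> borel_measurable N"
    and cont: "\<And>\<omega>. \<omega> \<in> space N \<Longrightarrow> continuous_on {0..1} (X \<omega>)"
    and g [measurable]: "g \<in> borel_measurable N" and g01: "\<And>\<omega>. \<omega> \<in> space N \<Longrightarrow> g \<omega> \<in> {0..1}"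
  shows "(\<lambda>\<omega>. X \<omega> (g \<omega>)) \<in> borel_measurable N"
proof -
  define c :: "real \<Rightarrow> real" where "c x = max 0 (min 1 x)" for x
  define a where "a n \<omega> = c (of_int \<lfloor>real (Suc n) * g \<omega>\<rfloor> / real (Suc n))" for n \<omega>
  have c01: "c x \<in> {0..1}" for x by (auto simp: c_def)
  have "(\<lambda>\<omega>. X \<omega> (a n \<omega>)) \<in> borel_measurable N" for n
  proof -
    have "(\<lambda>\<omega>. (\<lambda>i \<omega>. X \<omega> (c (of_int i / real (Suc n)))) (\<lfloor>real (Suc n) * g \<omega>\<rfloor>) \<omega>) \<in> borel_measurable N"
    proof (rule measurable_compose_countable[where f = "\<lambda>i \<omega>. X \<omega> (c (of_int i / real (Suc n)))"])
      show "(\<lambda>\<omega>. X \<omega> (c (of_int i / real (Suc n)))) \<in> borel_measurable N" for i :: int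
        by (rule meas) (rule c01)
      show "(\<lambda>\<omega>. \<lfloor>real (Suc n) * g \<omega>\<rfloor>) \<in> measurable N (count_space UNIV)" by measurable
    qed
    then show ?thesis by (simp add: a_def)
  qed
  moreover have "(\<lambda>n. X \<omega> (a n \<omega>)) \<longlonglongrightarrow> X \<omega> (g \<omega>)" if "\<omega> \<in> space N" for \<omega>
  proof -
    have "(\<lambda>n. a n \<omega>) \<longlonglongrightarrow> g \<omega>"
    proof -
      have "(\<lambda>n. a n \<omega>) \<longlonglongrightarrow> c (g \<omega>)"
        unfolding a_def c_def by (intro tendsto_max tendsto_min tendsto_const floor_grid_tendsto)
      then show ?thesis using g01[OF that] by (simp add: c_def)
    qed
    then show ?thesis
      by (rule continuous_on_tendsto_compose[OF cont[OF that]]) (use g01[OF that] c01 in \<open>auto simp: a_def\<close>)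
  qed
  ultimately show ?thesis by (rule borel_measurable_LIMSEQ_real[rotated])
qed

lemma borel_measurable_vervaat:
  assumes meas: "\<And>t. t \<in> {0..1} \<Longrightarrow> (\<lambda>\<omega>. X \<omega> t) \<in> borel_measurable N"
    and cont: "\<And>\<omega>. \<omega> \<in> space N \<Longrightarrow> continuous_on {0..1} (X \<omega>)"
  shows "(\<lambda>\<omega>. vervaat (X \<omega>) t) \<in> borel_measurable N"
proof -
  have [measurable]: "(\<lambda>\<omega>. first_argmin (X \<omega>)) \<in> borel_measurable N"
    unfolding first_argmin_eq_argmin_upto by (rule borel_measurable_argmin_upto[OF meas cont]) auto
  have a01: "first_argmin (X \<omega>) \<in> {0..1}" if "\<omega> \<in> space N" for \<omega>
    unfolding first_argmin_eq_argmin_upto using argmin_upto_props(1)[OF cont[OF that]] by simp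
  have [measurable]: "(\<lambda>x::real. frac x) \<in> borel_measurable borel" unfolding frac_def by measurable
  have [measurable]: "(\<lambda>\<omega>. X \<omega> (frac (first_argmin (X \<omega>) + t))) \<in> borel_measurable N"
    by (rule borel_measurable_eval_at[OF meas cont]) (auto simp: frac_lt_1 less_imp_le)
  have [measurable]: "(\<lambda>\<omega>. X \<omega> (first_argmin (X \<omega>))) \<in> borel_measurable N"
    by (rule borel_measurable_eval_at[OF meas cont]) (use a01 in auto)
  have [measurable]: "(\<lambda>\<omega>. X \<omega> 1) \<in> borel_measurable N" by (rule meas) simp
  show ?thesis unfolding vervaat_def by measurable
qed

text \<open>The process that is tested need not have continuous paths for every outcome, so only rational times enter and
  the event stays in the sigma-algebra generated by the process. The positive gap makes the inequality strict on the
  whole interval when \<open>g\<close> is continuous.\<close>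

definition above :: "real \<Rightarrow> real \<Rightarrow> real \<Rightarrow> (real \<Rightarrow> real) \<Rightarrow> bool" where
  "above p q c g \<longleftrightarrow> (\<exists>k::nat. \<forall>r\<in>\<rat> \<inter> {p..q}. c + 1 / Suc k \<le> g r)"

definition nonneg_on :: "real \<Rightarrow> real \<Rightarrow> (real \<Rightarrow> real) \<Rightarrow> bool" where
  "nonneg_on p q g \<longleftrightarrow> (\<forall>r\<in>\<rat> \<inter> {p..q}. 0 \<le> g r)"

lemma nonneg_on_iff:
  assumes "continuous_on {p..q} g" "p < q"
  shows "nonneg_on p q g \<longleftrightarrow> (\<forall>r\<in>{p..q}. 0 \<le> g r)"
proof
  assume R: "nonneg_on p q g"
  show "\<forall>r\<in>{p..q}. 0 \<le> g r"
  proof (rule ballI, rule ccontr)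
    fix r assume r: "r \<in> {p..q}" "\<not> 0 \<le> g r"
    obtain s where s: "s \<in> \<rat>" "s \<in> {p..q}" "\<bar>g s - g r\<bar> < - g r"
      using rational_near[OF assms r(1), of "- g r"] r(2) by auto
    then have "0 \<le> g s" using R by (auto simp: nonneg_on_def)
    then show False using s(3) r(2) by linarith
  qed
qed (auto simp: nonneg_on_def)

lemma above_iff:
  assumes "continuous_on {p..q} g" "p < q"
  shows "above p q c g \<longleftrightarrow> (\<forall>r\<in>{p..q}. c < g r)"
proof
  assume "above p q c g"
  then obtain k :: nat where "\<forall>r\<in>\<rat> \<inter> {p..q}. c + 1 / Suc k \<le> g r"
    unfolding above_def by blast
  then have k: "\<And>r. r \<in> \<rat> \<Longrightarrow> r \<in> {p..q} \<Longrightarrow> c + 1 / Suc k \<le> g r" by blast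
  have "nonneg_on p q (\<lambda>r. g r - (c + 1 / Suc k))" using k by (simp add: nonneg_on_def)
  then have "\<forall>r\<in>{p..q}. 0 \<le> g r - (c + 1 / Suc k)"
    by (subst (asm) nonneg_on_iff) (use assms in \<open>auto intro!: continuous_intros\<close>)
  moreover have "0 < 1 / real (Suc k)" by simp
  ultimately show "\<forall>r\<in>{p..q}. c < g r" by (smt (verit))
next
  assume R: "\<forall>r\<in>{p..q}. c < g r"
  obtain x where x: "x \<in> {p..q}" "\<And>r. r \<in> {p..q} \<Longrightarrow> g x \<le> g r"
    using continuous_attains_inf[OF compact_Icc _ assms(1)] assms(2) by auto
  then have "0 < g x - c" using R by auto
  then obtain k where "1 / Suc k < g x - c" using nat_approx_posE by blast
  then show "above p q c g" unfolding above_def using x(2) by (intro exI[of _ k]) fastforce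
qed

lemma measurable_above:
  assumes "\<And>r. r \<in> {p..q} \<Longrightarrow> (\<lambda>\<omega>. X \<omega> r) \<in> borel_measurable N"
  shows "{\<omega> \<in> space N. above p q c (X \<omega>)} \<in> sets N"
  unfolding above_def
proof (intro sets.sets_Collect_countable_Ex sets.sets_Collect_countable_All')
  fix k r assume r: "r \<in> \<rat> \<inter> {p..q}"
  have [measurable]: "(\<lambda>\<omega>. X \<omega> r) \<in> borel_measurable N" using r assms by auto
  show "{\<omega> \<in> space N. c + 1 / real (Suc k) \<le> X \<omega> r} \<in> sets N" by measurable
qed (use countable_rat in auto)

lemma measurable_nonneg_on:
  assumes "\<And>r. r \<in> {p..q} \<Longrightarrow> (\<lambda>\<omega>. X \<omega> r) \<in> borel_measurable N"
  shows "{\<omega> \<in> space N. nonneg_on p q (X \<omega>)} \<in> sets N"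
  unfolding nonneg_on_def
proof (intro sets.sets_Collect_countable_All')
  fix r assume r: "r \<in> \<rat> \<inter> {p..q}"
  have [measurable]: "(\<lambda>\<omega>. X \<omega> r) \<in> borel_measurable N" using r assms by auto
  show "{\<omega> \<in> space N. 0 \<le> X \<omega> r} \<in> sets N" by measurable
qed (use countable_rat in auto)

definition bridge_paths :: "real \<Rightarrow> (real \<Rightarrow> real) set" where
  "bridge_paths b = {f. continuous_on {0..1} f \<and> f 0 = 0 \<and> f 1 = b}"

text \<open>The path is continued by \<open>f (t + 1) = f t + b\<close> and restarted from level 0 at time \<open>a\<close>.\<close>

definition cyclic_shift :: "real \<Rightarrow> real \<Rightarrow> (real \<Rightarrow> real) \<Rightarrow> real \<Rightarrow> real" where
  "cyclic_shift b a f r = (if a + r \<le> 1 then f (a + r) - f a else f (a + r - 1) + b - f a)"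

lemma cyclic_shift_in_bridge_paths:
  assumes f: "f \<in> bridge_paths b" and a: "0 \<le> a" "a \<le> 1"
  shows "cyclic_shift b a f \<in> bridge_paths b"
proof -
  have c: "continuous_on {0..1} f" and f01: "f 0 = 0" "f 1 = b" using f by (auto simp: bridge_paths_def)
  have "continuous_on ({0..1-a} \<union> {1-a..1}) (\<lambda>r. if a + r \<le> 1 then f (a + r) - f a else f (a + r - 1) + b - f a)"
  proof (rule continuous_on_If)
    show "continuous_on {0..1-a} (\<lambda>r. f (a + r) - f a)"
      by (intro continuous_intros continuous_on_compose2[OF c]) (use a in auto)
    show "continuous_on {1-a..1} (\<lambda>r. f (a + r - 1) + b - f a)"
      by (intro continuous_intros continuous_on_compose2[OF c]) (use a in auto)
    show "f (a + r) - f a = f (a + r - 1) + b - f a" if "r \<in> {0..1 - a}" "\<not> a + r \<le> 1" for r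
      using that by auto
    show "f (a + r) - f a = f (a + r - 1) + b - f a" if "r \<in> {1-a..1}" "a + r \<le> 1" for r
    proof -
      have "a + r = 1" using that by auto
      then show ?thesis using f01 by simp
    qed
  qed auto
  moreover have "{0..1-a} \<union> {1-a..1} = {0..1}" using a by auto
  moreover have "cyclic_shift b a f = (\<lambda>r. if a + r \<le> 1 then f (a + r) - f a else f (a + r - 1) + b - f a)"
    by (auto simp: cyclic_shift_def fun_eq_iff)
  ultimately show ?thesis using a f01 by (auto simp: bridge_paths_def)
qed

lemma cyclic_shift_add:
  assumes "0 \<le> a" "0 \<le> c" "a + c < 1" "r \<in> {0..1}"
  shows "cyclic_shift b c (cyclic_shift b a f) r = cyclic_shift b (a + c) f r"
  using assms by (auto simp: cyclic_shift_def algebra_simps)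

lemma cyclic_shift_inverse:
  assumes "f \<in> bridge_paths b" "0 < a" "a < 1" "r \<in> {0..1}"
  shows "cyclic_shift b a (cyclic_shift b (1 - a) f) r = f r"
  using assms by (auto simp: cyclic_shift_def bridge_paths_def algebra_simps)

lemma first_argmin_props:
  assumes f: "f \<in> bridge_paths b" and b: "0 < b"
  shows "0 \<le> first_argmin f" "first_argmin f < 1"
    and "s \<in> {0..1} \<Longrightarrow> f (first_argmin f) \<le> f s"
    and "s \<in> {0..<first_argmin f} \<Longrightarrow> f (first_argmin f) < f s"
proof -
  have c: "continuous_on {0..1} f" and f01: "f 0 = 0" "f 1 = b" using f by (auto simp: bridge_paths_def)
  note p = argmin_upto_props[OF c, folded first_argmin_eq_argmin_upto]
  show "0 \<le> first_argmin f" using p(1) by simp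
  show "s \<in> {0..1} \<Longrightarrow> f (first_argmin f) \<le> f s" "s \<in> {0..<first_argmin f} \<Longrightarrow> f (first_argmin f) < f s"
    using p by auto
  have "first_argmin f \<noteq> 1" using p(2)[of 0] f01 b by auto
  then show "first_argmin f < 1" using p(1) by simp
qed

lemma vervaat_eq_cyclic_shift:
  assumes f: "f \<in> bridge_paths b" and b: "0 < b" and r: "r \<in> {0..1}"
  shows "vervaat f r = cyclic_shift b (first_argmin f) f r"
proof -
  note p = first_argmin_props[OF f b]
  have f01: "f 0 = 0" "f 1 = b" using f by (auto simp: bridge_paths_def)
  define a where "a = first_argmin f"
  have a: "0 \<le> a" "a < 1" using p by (auto simp: a_def)
  consider "a + r < 1" | "a + r = 1" | "1 < a + r" by linarith
  then show ?thesis
  proof cases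
    case 1
    then have "frac (a + r) = a + r" using a r by (auto simp: frac_eq)
    then show ?thesis using 1 by (simp add: vervaat_def cyclic_shift_def flip: a_def)
  next
    case 2
    then show ?thesis using f01 by (simp add: vervaat_def cyclic_shift_def add.commute flip: a_def)
  next
    case 3
    have "a + r < 2" using a r by auto
    then have "frac (a + r) = a + r - 1" using 3 by (simp add: frac_unique_iff)
    then show ?thesis using 3 f01 by (simp add: vervaat_def cyclic_shift_def add.commute flip: a_def)
  qed
qed

lemma continuous_on_vervaat:
  assumes f: "f \<in> bridge_paths b" and b: "0 < b"
  shows "continuous_on {0..1} (vervaat f)"
proof -
  have "continuous_on {0..1} (cyclic_shift b (first_argmin f) f)"
    using cyclic_shift_in_bridge_paths[OF f, of "first_argmin f"] first_argmin_props[OF f b]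
    by (auto simp: bridge_paths_def)
  then show ?thesis
    by (rule continuous_on_eq) (use vervaat_eq_cyclic_shift[OF f b] in auto)
qed

lemma vervaat_above_after_cut:
  assumes f: "f \<in> bridge_paths b" and b: "0 < b" and r: "r \<in> {0..1}" "1 \<le> first_argmin f + r"
  shows "b \<le> vervaat f r"
proof -
  have f01: "f 0 = 0" "f 1 = b" using f by (auto simp: bridge_paths_def)
  show ?thesis
  proof (cases "first_argmin f + r \<le> 1")
    case True
    then have "first_argmin f + r = 1" using r by simp
    moreover have "f (first_argmin f) \<le> 0" using first_argmin_props(3)[OF f b, of 0] f01 by simp
    ultimately show ?thesis using f01 by (simp add: vervaat_eq_cyclic_shift[OF f b r(1)] cyclic_shift_def)
  next
    case False
    then show ?thesis using first_argmin_props(3)[OF f b, of "first_argmin f + r - 1"] r first_argmin_props(1,2)[OF f b]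
      by (simp add: vervaat_eq_cyclic_shift[OF f b r(1)] cyclic_shift_def)
  qed
qed

text \<open>The continued path gains \<open>b\<close> in every period, so its values after \<open>\<tau>\<close> never fall below the minimum. Any start
  between 0 and \<open>\<tau>\<close> therefore finds the same minimum, and hence the same Vervaat transform.\<close>

lemma shift_back_argmin:
  assumes f: "f \<in> bridge_paths b" and b: "0 < b" and a: "0 \<le> a" "a \<le> first_argmin f"
  shows "first_argmin (cyclic_shift b a f) = first_argmin f - a"
    and "r \<in> {0..1} \<Longrightarrow> vervaat (cyclic_shift b a f) r = vervaat f r"
proof -
  note p = first_argmin_props[OF f b]
  let ?t = "first_argmin f"
  show e: "first_argmin (cyclic_shift b a f) = ?t - a"
    unfolding first_argmin_eq_argmin_upto
  proof (rule argmin_upto_eqI)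
    show "argmin_upto 1 f - a \<in> {0..1}" using a p by (auto simp flip: first_argmin_eq_argmin_upto)
    show "cyclic_shift b a f (argmin_upto 1 f - a) \<le> cyclic_shift b a f s" if "s \<in> {0..1}" for s
      using that a p(1,2) p(3)[of "a + s"] p(3)[of "a + s - 1"] b
      by (auto simp: cyclic_shift_def simp flip: first_argmin_eq_argmin_upto)
    show "cyclic_shift b a f (argmin_upto 1 f - a) < cyclic_shift b a f s"
      if "s \<in> {0..<argmin_upto 1 f - a}" for s
      using that a p(1,2) p(4)[of "a + s"]
      by (auto simp: cyclic_shift_def simp flip: first_argmin_eq_argmin_upto)
  qed
  assume r: "r \<in> {0..1}"
  have "cyclic_shift b a f \<in> bridge_paths b" using cyclic_shift_in_bridge_paths[OF f] a p by auto
  then show "vervaat (cyclic_shift b a f) r = vervaat f r"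
    using cyclic_shift_add[of a "?t - a" r b f] a p r
    by (simp add: vervaat_eq_cyclic_shift[OF _ b] e f)
qed

text \<open>Starting earlier by \<open>a\<close> puts in front the piece of path that the Vervaat transform traverses last. In this
  position it lies above the minimum precisely because the transform exceeds \<open>b\<close> there.\<close>

lemma shift_forward_argmin:
  assumes f: "f \<in> bridge_paths b" and b: "0 < b" and a: "0 < a" "a + first_argmin f < 1"
    and abv: "\<And>r. r \<in> {1 - a - first_argmin f..<1} \<Longrightarrow> b < vervaat f r"
  shows "first_argmin (cyclic_shift b (1 - a) f) = first_argmin f + a"
    and "r \<in> {0..1} \<Longrightarrow> vervaat (cyclic_shift b (1 - a) f) r = vervaat f r"
proof -
  note p = first_argmin_props[OF f b]
  let ?t = "first_argmin f" and ?g = "cyclic_shift b (1 - a) f"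
  have f01: "f 0 = 0" "f 1 = b" using f by (auto simp: bridge_paths_def)
  have a1: "a < 1" using a p by auto
  \<comment> \<open>at \<open>s = a\<close> both branches of the shift agree, because the path starts at 0 and ends at \<open>b\<close>\<close>
  have late: "?g s = f (s - a) + b - f (1 - a)" if "s \<in> {a..1}" for s
  proof (cases "s = a")
    case True
    then show ?thesis using f01 by (simp add: cyclic_shift_def)
  next
    case False
    then show ?thesis using that by (simp add: cyclic_shift_def)
  qed
  have early: "?g s > f ?t + b - f (1 - a)" if "s \<in> {0..<a}" for s
  proof -
    have r: "1 - a + s - ?t \<in> {1 - a - ?t..<1}" "1 - a + s - ?t \<in> {0..1}" using that p a by auto
    have "b < f (1 - a + s) - f ?t"
      using abv[OF r(1)] that unfolding vervaat_eq_cyclic_shift[OF f b r(2)] by (simp add: cyclic_shift_def algebra_simps)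
    then show ?thesis using that by (simp add: cyclic_shift_def)
  qed
  have gt: "?g (?t + a) = f ?t + b - f (1 - a)" using late[of "?t + a"] p a by simp
  show e: "first_argmin ?g = ?t + a"
    unfolding first_argmin_eq_argmin_upto
  proof (rule argmin_upto_eqI)
    show "argmin_upto 1 f + a \<in> {0..1}" using a p by (auto simp flip: first_argmin_eq_argmin_upto)
    show "?g (argmin_upto 1 f + a) \<le> ?g s" if "s \<in> {0..1}" for s
    proof (cases "s < a")
      case True
      then show ?thesis using early[of s] that gt by (auto simp flip: first_argmin_eq_argmin_upto)
    next
      case False
      then show ?thesis using late[of s] p(3)[of "s - a"] a that gt by (auto simp flip: first_argmin_eq_argmin_upto)
    qed
    show "?g (argmin_upto 1 f + a) < ?g s" if "s \<in> {0..<argmin_upto 1 f + a}" for s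
    proof (cases "s < a")
      case True
      then show ?thesis using early[of s] that gt by (auto simp flip: first_argmin_eq_argmin_upto)
    next
      case False
      then show ?thesis using late[of s] p(4)[of "s - a"] a that gt p(2) by (auto simp flip: first_argmin_eq_argmin_upto)
    qed
  qed
  assume r: "r \<in> {0..1}"
  have g: "?g \<in> bridge_paths b" using cyclic_shift_in_bridge_paths[OF f] a a1 by auto
  have "vervaat ?g r = cyclic_shift b (a + ?t) ?g r" using vervaat_eq_cyclic_shift[OF g b r] e by (simp add: add.commute)
  also have "\<dots> = cyclic_shift b ?t (cyclic_shift b a ?g) r"
    using cyclic_shift_add[of a ?t r b ?g] a p r by simp
  also have "\<dots> = cyclic_shift b ?t f r"
    using cyclic_shift_inverse[OF f a(1) a1] p r f01 by (simp add: cyclic_shift_def[of b ?t])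
  finally show "vervaat ?g r = vervaat f r" using vervaat_eq_cyclic_shift[OF f b r] by simp
qed

text \<open>Hat function of height 1 on \<open>[m - w, m + w]\<close>.\<close>

definition tent :: "real \<Rightarrow> real \<Rightarrow> real \<Rightarrow> real" where
  "tent m w x = max 0 (1 - \<bar>x - m\<bar> / w)"

text \<open>The coefficient of the hat function at \<open>m\<close> when a path is decomposed into its linear interpolation at the
  two end points and deviations from it, as in Levy's construction of Brownian motion.\<close>

definition bump :: "real \<Rightarrow> real \<Rightarrow> (real \<Rightarrow> real) \<Rightarrow> real" where
  "bump m w f = f m - (f (m - w) + f (m + w)) / 2"

definition flip :: "real \<Rightarrow> real \<Rightarrow> (real \<Rightarrow> real) \<Rightarrow> real \<Rightarrow> real" where
  "flip m w f x = f x - 2 * bump m w f * tent m w x"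

lemma tent_eq_0: "0 < w \<Longrightarrow> x \<notin> {m - w<..<m + w} \<Longrightarrow> tent m w x = 0"
  by (auto simp: tent_def max_def field_simps abs_if)

lemma tent_center [simp]: "tent m w m = 1" by (simp add: tent_def)

lemma tent_bounds: "0 < w \<Longrightarrow> 0 \<le> tent m w x" "0 < w \<Longrightarrow> tent m w x \<le> 1"
  by (auto simp: tent_def)

lemma bump_flip: "0 < w \<Longrightarrow> bump m w (flip m w f) = - bump m w f"
  by (simp add: bump_def flip_def tent_eq_0 field_simps)

lemma flip_flip: "0 < w \<Longrightarrow> flip m w (flip m w f) x = f x"
  using bump_flip[of w m f] by (subst flip_def) (simp add: flip_def[of m w f x])

lemma continuous_on_tent [continuous_intros]: "continuous_on S (tent m w)"
  unfolding tent_def[abs_def] by (cases "w = 0") (auto intro!: continuous_intros)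

lemma continuous_on_flip: "continuous_on S f \<Longrightarrow> continuous_on S (flip m w f)"
  unfolding flip_def[abs_def] by (intro continuous_intros) auto

lemma flip_in_bridge_paths:
  assumes "f \<in> bridge_paths b" "0 < w" "0 \<le> m - w" "m + w \<le> 1"
  shows "flip m w f \<in> bridge_paths b"
proof -
  have "tent m w 0 = 0" "tent m w 1 = 0" using assms by (auto intro!: tent_eq_0)
  then show ?thesis using assms by (auto simp: bridge_paths_def continuous_on_flip) (auto simp: flip_def)
qed

text \<open>If the global minimum is attained before time \<open>1/16\<close>, the flip is centred at \<open>\<tau> + c\<close>, which is the deterministic time \<open>c\<close>
  of the Vervaat transform. Since the centre is read off from the path on \<open>[0, 1/16]\<close>, which the flip does not touch,
  this random flip still preserves the law.\<close>

definition delayed_flip :: "real \<Rightarrow> (real \<Rightarrow> real) \<Rightarrow> real \<Rightarrow> real" where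
  "delayed_flip c f = flip (argmin_upto (1/16) f + c) (1/16) f"

text \<open>Nonnegativity of the flipped transform says that the flipped path does not fall below the old minimum, so the
  minimiser stays where it was and the flip commutes with the Vervaat transform.\<close>

lemma delayed_flip_vervaat:
  assumes f: "f \<in> bridge_paths b" and b: "0 < b" and c: "3/4 \<le> c" "c \<le> 7/8"
    and early: "first_argmin f < 1/16"
    and nn: "\<And>r. r \<in> {c - 1/16..c + 1/16} \<Longrightarrow> 0 \<le> flip c (1/16) (vervaat f) r"
  shows "first_argmin (delayed_flip c f) = first_argmin f"
    and "r \<in> {0..1} \<Longrightarrow> vervaat (delayed_flip c f) r = flip c (1/16) (vervaat f) r"
proof -
  note p = first_argmin_props[OF f b]
  define t where "t = first_argmin f"
  have t: "0 \<le> t" "t < 1/16" using early p by (auto simp: t_def)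
  have at: "argmin_upto (1/16) f = t"
    by (rule argmin_upto_eqI) (use p t in \<open>auto simp: t_def\<close>)
  let ?g = "delayed_flip c f"
  have g: "?g = flip (t + c) (1/16) f" by (simp add: delayed_flip_def at)
  have gb: "?g \<in> bridge_paths b" unfolding g by (rule flip_in_bridge_paths[OF f]) (use t c in auto)
  have V: "vervaat f r = f (t + r) - f t" if "r \<in> {0..15/16}" for r
    using vervaat_eq_cyclic_shift[OF f b, of r] that t by (auto simp: cyclic_shift_def simp flip: t_def)
  have bump: "bump (t + c) (1/16) f = bump c (1/16) (vervaat f)"
    using V[of c] V[of "c - 1/16"] V[of "c + 1/16"] c
    by (simp add: bump_def field_simps)
  have tent: "tent (t + c) (1/16) (t + r) = tent c (1/16) r" for r by (simp add: tent_def)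
  have out: "?g x = f x" if "x \<le> 11/16" for x
    unfolding g flip_def using tent_eq_0[of "1/16" x "t + c"] that t c by auto
  have gt: "?g t = f t" using out[of t] t by simp
  have win: "?g (t + r) - f t = flip c (1/16) (vervaat f) r" if "r \<in> {0..15/16}" for r
    unfolding g flip_def bump tent using V[OF that] by simp
  have ge: "?g s \<ge> f t" if "s \<in> {0..1}" for s
  proof (cases "s \<in> {t + c - 1/16..t + c + 1/16}")
    case True
    then show ?thesis using win[of "s - t"] nn[of "s - t"] c t by auto
  next
    case False
    then have "tent (t + c) (1/16) s = 0" by (intro tent_eq_0) auto
    then show ?thesis unfolding g flip_def using p(3)[OF that] by (simp add: t_def)
  qed
  show e: "first_argmin ?g = first_argmin f"
    unfolding first_argmin_eq_argmin_upto[of ?g] t_def[symmetric]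
    by (rule argmin_upto_eqI) (use t ge gt out p(4) in \<open>auto simp: t_def\<close>)
  assume r: "r \<in> {0..1}"
  have Vg: "vervaat ?g r = cyclic_shift b t ?g r" using vervaat_eq_cyclic_shift[OF gb b r] e by (simp add: t_def)
  show "vervaat ?g r = flip c (1/16) (vervaat f) r"
  proof (cases "r \<le> 15/16")
    case True
    then show ?thesis using win[of r] r t gt by (simp add: Vg cyclic_shift_def)
  next
    case False
    then have z: "tent c (1/16) r = 0" using c by (intro tent_eq_0) auto
    have "vervaat f r = cyclic_shift b t f r" using vervaat_eq_cyclic_shift[OF f b r] by (simp add: t_def)
    moreover have "t + r \<le> 1 \<Longrightarrow> tent (t + c) (1/16) (t + r) = 0" using z tent by simp
    then have "t + r \<le> 1 \<Longrightarrow> ?g (t + r) = f (t + r)" unfolding g flip_def by simp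
    moreover have "?g (t + r - 1) = f (t + r - 1)" by (rule out) (use t r in auto)
    ultimately show ?thesis using gt by (simp add: Vg cyclic_shift_def flip_def z)
  qed
qed

section \<open>The bridge law and its invariance under shifts and flips\<close>

lemma lin_comb_cong:
  assumes "\<And>t. t \<in> fst ` set xs \<Longrightarrow> f t = g t"
  shows "lin_comb xs f = lin_comb xs g"
  using assms by (induction xs) auto

lemma lin_comb_append: "lin_comb (xs @ ys) f = lin_comb xs f + lin_comb ys f"
  by (induction xs) auto

lemma lin_comb_add: "lin_comb xs (\<lambda>t. f t + g t) = lin_comb xs f + lin_comb xs g"
  by (induction xs) (auto simp: algebra_simps)

lemma lin_comb_diff: "lin_comb xs (\<lambda>t. f t - g t) = lin_comb xs f - lin_comb xs g"
  by (induction xs) (auto simp: algebra_simps)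

lemma lin_comb_cmult: "lin_comb xs (\<lambda>t. k * f t) = k * lin_comb xs f"
  by (induction xs) (auto simp: algebra_simps)

lemma lin_comb_bump: "lin_comb xs (\<lambda>t. bump m w (K t)) = bump m w (\<lambda>s. lin_comb xs (\<lambda>t. K t s))"
  by (induction xs) (auto simp: bump_def field_simps)

lemma lin_comb_as_sum:
  "\<exists>c. \<forall>f. lin_comb xs f = (\<Sum>t\<in>fst ` set xs. c t * f t)"
proof (induction xs)
  case Nil
  then show ?case by auto
next
  case (Cons x xs)
  obtain s e where x: "x = (s, e)" by (cases x)
  obtain c where c: "\<And>f. lin_comb xs f = (\<Sum>t\<in>fst ` set xs. c t * f t)" using Cons by blast
  let ?S = "fst ` set xs"
  let ?c = "\<lambda>t. (if t \<in> ?S then c t else 0) + (if t = s then e else 0)"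
  have "lin_comb (x # xs) f = (\<Sum>t\<in>insert s ?S. ?c t * f t)" for f
  proof -
    have "(\<Sum>t\<in>insert s ?S. ?c t * f t) = (\<Sum>t\<in>insert s ?S. (if t \<in> ?S then c t * f t else 0))
        + (\<Sum>t\<in>insert s ?S. (if t = s then e * f t else 0))"
      unfolding sum.distrib[symmetric] by (intro sum.cong) (auto simp: algebra_simps)
    also have "(\<Sum>t\<in>insert s ?S. (if t \<in> ?S then c t * f t else 0)) = (\<Sum>t\<in>?S. c t * f t)"
      by (intro sum.mono_neutral_cong_right) auto
    also have "(\<Sum>t\<in>insert s ?S. (if t = s then e * f t else 0)) = e * f s"
      by (subst sum.delta) auto
    finally show ?thesis by (simp add: x c)
  qed
  then show ?case by (auto simp: x)
qed

definition bridge_cov :: "real \<Rightarrow> real \<Rightarrow> real" where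
  "bridge_cov s t = min s t - s * t"

lemma bridge_cov_commute: "bridge_cov s t = bridge_cov t s"
  by (simp add: bridge_cov_def min.commute)

definition bridge_var :: "(real \<times> real) list \<Rightarrow> real" where
  "bridge_var xs = lin_comb xs (\<lambda>t. lin_comb xs (bridge_cov t))"

text \<open>Gaussian laws are identified by their characteristic functionals, so invariance of the bridge law under a linear map
  of paths amounts to identities for \<open>lin_comb\<close> and \<open>bridge_var\<close>.\<close>

definition bridge_law :: "real \<Rightarrow> (real \<Rightarrow> real) measure \<Rightarrow> bool" where
  "bridge_law b L \<longleftrightarrow> prob_space L \<and> sets L = sets (path_space (bridge_paths b)) \<and>
     (\<forall>xs. fst ` set xs \<subseteq> {0..1} \<longrightarrow> (\<integral>f. iexp (lin_comb xs f) \<partial>L)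
        = iexp (b * lin_comb xs (\<lambda>t. t)) * of_real (exp (- bridge_var xs / 2)))"

lemma bridge_law_space: "bridge_law b L \<Longrightarrow> space L = bridge_paths b"
  unfolding bridge_law_def by (metis sets_eq_imp_space_eq space_path_space)

lemma measurable_bridge_lawI:
  assumes L: "bridge_law b L" and "X \<in> measurable N (path_space (bridge_paths b))"
  shows "X \<in> measurable N L"
  using assms unfolding bridge_law_def by (metis measurable_cong_sets)

lemma measurable_bridge_law_eval:
  assumes L: "bridge_law b L" and "t \<in> {0..1}"
  shows "(\<lambda>f. f t) \<in> borel_measurable L"
  using measurable_eval_path_space[OF assms(2)] L unfolding bridge_law_def
  by (metis measurable_cong_sets)

lemma measurable_bridge_law_lin_comb:
  assumes L: "bridge_law b L" and "fst ` set xs \<subseteq> {0..1}"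
  shows "lin_comb xs \<in> borel_measurable L"
  using measurable_lin_comb[OF assms(2)] L unfolding bridge_law_def
  by (metis measurable_cong_sets)

lemma bridge_law_distr_eqI:
  assumes L: "bridge_law b L" and P: "prob_space P" and X: "X \<in> measurable P L"
    and char: "\<And>xs. fst ` set xs \<subseteq> {0..1} \<Longrightarrow> (\<integral>\<omega>. iexp (lin_comb xs (X \<omega>)) \<partial>P)
        = iexp (b * lin_comb xs (\<lambda>t. t)) * of_real (exp (- bridge_var xs / 2))"
  shows "distr P L X = L"
proof (rule path_law_eqI)
  interpret P: prob_space P by (rule P)
  show "prob_space (distr P L X)" by (rule P.prob_space_distr[OF X])
  show "prob_space L" "sets L = sets (path_space (bridge_paths b))"
    "sets (distr P L X) = sets (path_space (bridge_paths b))"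
    using L by (auto simp: bridge_law_def)
  fix xs :: "(real \<times> real) list" assume xs: "fst ` set xs \<subseteq> {0..1}"
  note [measurable] = X measurable_bridge_law_lin_comb[OF L xs]
  have "(\<integral>f. iexp (lin_comb xs f) \<partial>distr P L X) = (\<integral>\<omega>. iexp (lin_comb xs (X \<omega>)) \<partial>P)"
    by (subst integral_distr) auto
  then show "(\<integral>f. iexp (lin_comb xs f) \<partial>distr P L X) = (\<integral>f. iexp (lin_comb xs f) \<partial>L)"
    using char[OF xs] L xs by (simp add: bridge_law_def)
qed

lemma bridge_law_transport:
  assumes L: "bridge_law b L" and T: "distr L L T = L" "T \<in> measurable L L" and S: "S \<in> sets L"
  shows "measure L (T -` S \<inter> space L) = measure L S"
  using measure_distr[OF T(2) S] T(1) by simp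

text \<open>The term \<open>s * t\<close> of the covariance is linear and does not contribute to a second difference; that of \<open>min s t\<close> is a hat
  function. Hence the hat coefficient of a bridge is uncorrelated with what remains after removing its hat component,
  and has variance \<open>w / 2\<close>.\<close>

lemma bump_bridge_cov:
  assumes "0 < w" "0 \<le> m - w" "m + w \<le> 1" "t \<in> {0..1}"
  shows "bump m w (bridge_cov t) = (w / 2) * tent m w t"
proof -
  consider "t \<le> m - w" | "m - w \<le> t" "t \<le> m" | "m \<le> t" "t \<le> m + w" | "m + w \<le> t" by linarith
  then show ?thesis
  proof cases
    case 1
    then have "tent m w t = 0" using assms by (intro tent_eq_0) auto
    then show ?thesis using 1 assms by (simp add: bump_def bridge_cov_def min_def field_simps)
  next
    case 2
    then have "tent m w t = 1 - (m - t) / w" using assms by (simp add: tent_def field_simps)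
    then show ?thesis using 2 assms by (auto simp add: bump_def bridge_cov_def min_def field_simps)
  next
    case 3
    then have "tent m w t = 1 - (t - m) / w" using assms by (simp add: tent_def field_simps)
    then show ?thesis using 3 assms by (auto simp add: bump_def bridge_cov_def min_def field_simps)
  next
    case 4
    then have "tent m w t = 0" using assms by (intro tent_eq_0) auto
    then show ?thesis using 4 assms by (auto simp add: bump_def bridge_cov_def min_def field_simps)
  qed
qed

lemma bump_id [simp]: "bump m w (\<lambda>t. t) = 0"
  by (simp add: bump_def)

lemma bump_cmult: "bump m w (\<lambda>t. k * f t) = k * bump m w f"
  by (simp add: bump_def field_simps)

lemma bump_tent: "0 < w \<Longrightarrow> bump m w (tent m w) = 1"
  by (simp add: bump_def tent_eq_0)

lemma bump_cong:
  "f m = g m \<Longrightarrow> f (m - w) = g (m - w) \<Longrightarrow> f (m + w) = g (m + w) \<Longrightarrow> bump m w f = bump m w g"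
  by (simp add: bump_def)

text \<open>\<open>k\<close> times the functional \<open>bump m w\<close>, as a linear combination of evaluations.\<close>

definition bump_comb :: "real \<Rightarrow> real \<Rightarrow> real \<Rightarrow> (real \<times> real) list" where
  "bump_comb m w k = [(m, k), (m - w, - k / 2), (m + w, - k / 2)]"

lemma lin_comb_bump_comb [simp]: "lin_comb (bump_comb m w k) f = k * bump m w f"
  by (simp add: bump_comb_def bump_def field_simps)

lemma bridge_var_bump_comb:
  assumes w: "0 < w" "0 \<le> m - w" "m + w \<le> 1" and xs: "fst ` set xs \<subseteq> {0..1}"
  shows "bridge_var (xs @ bump_comb m w k) = bridge_var xs + k * w * lin_comb xs (tent m w) + k\<^sup>2 * w / 2"
proof -
  let ?q = "lin_comb xs (tent m w)"
  have A: "lin_comb xs (\<lambda>t. bump m w (bridge_cov t)) = (w / 2) * ?q"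
    unfolding lin_comb_cmult[symmetric]
    by (intro lin_comb_cong bump_bridge_cov[OF w]) (use xs in auto)
  have "bump m w (\<lambda>t. lin_comb xs (bridge_cov t)) = bump m w (\<lambda>t. lin_comb xs (\<lambda>s. bridge_cov s t))"
    by (intro arg_cong[where f = "bump m w"] ext arg_cong[where f = "lin_comb xs"] bridge_cov_commute)
  also have "\<dots> = (w / 2) * ?q" unfolding A[symmetric] by (rule lin_comb_bump[symmetric])
  finally have B: "bump m w (\<lambda>t. lin_comb xs (bridge_cov t)) = (w / 2) * ?q" .
  have "bump m w (\<lambda>t. bump m w (bridge_cov t)) = bump m w (\<lambda>t. (w / 2) * tent m w t)"
    by (intro bump_cong bump_bridge_cov[OF w]) (use w in auto)
  also have "\<dots> = w / 2" using w by (simp only: bump_cmult bump_tent)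
  finally have C: "bump m w (\<lambda>t. bump m w (bridge_cov t)) = w / 2" .
  have D: "bump m w (\<lambda>t. f t + k * g t) = bump m w f + k * bump m w g" for f g
    by (simp add: bump_def field_simps)
  show ?thesis
    unfolding bridge_var_def lin_comb_append lin_comb_bump_comb lin_comb_add lin_comb_cmult D
    using A B C by (simp add: power2_eq_square field_simps)
qed

lemma measurable_bump:
  assumes L: "bridge_law b L" and "0 < w" "0 \<le> m - w" "m + w \<le> 1"
  shows "bump m w \<in> borel_measurable L"
proof -
  have [measurable]: "(\<lambda>f. f m) \<in> borel_measurable L" "(\<lambda>f. f (m - w)) \<in> borel_measurable L" "(\<lambda>f. f (m + w)) \<in> borel_measurable L"
    using assms by (auto intro!: measurable_bridge_law_eval[OF L])
  show ?thesis unfolding bump_def[abs_def] by measurable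
qed

lemma measurable_flip:
  assumes L: "bridge_law b L" and w: "0 < w" "0 \<le> m - w" "m + w \<le> 1"
  shows "flip m w \<in> measurable L L"
proof (rule measurable_bridge_lawI[OF L measurable_path_spaceI])
  show "flip m w f \<in> bridge_paths b" if "f \<in> space L" for f
    using that flip_in_bridge_paths w by (simp add: bridge_law_space[OF L])
  fix t :: real assume t: "t \<in> {0..1}"
  note [measurable] = measurable_bump[OF L w] measurable_bridge_law_eval[OF L t]
  show "(\<lambda>f. flip m w f t) \<in> borel_measurable L" unfolding flip_def[abs_def] by measurable
qed

text \<open>The hat coefficient is a centred Gaussian independent of the rest of the bridge, so its sign may be changed.\<close>

lemma distr_flip:
  assumes L: "bridge_law b L" and w: "0 < w" "0 \<le> m - w" "m + w \<le> 1"
  shows "distr L L (flip m w) = L"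
proof (rule bridge_law_distr_eqI[OF L _ measurable_flip[OF assms]])
  show "prob_space L" using L by (simp add: bridge_law_def)
  fix xs :: "(real \<times> real) list" assume xs: "fst ` set xs \<subseteq> {0..1}"
  define k where "k = - 2 * lin_comb xs (tent m w)"
  let ?ys = "xs @ bump_comb m w k"
  have "lin_comb xs (flip m w f) = lin_comb ?ys f" for f
    unfolding flip_def[abs_def] lin_comb_diff lin_comb_append
    by (simp add: lin_comb_cmult k_def mult.assoc)
  moreover have "fst ` set ?ys \<subseteq> {0..1}" using xs w by (auto simp: bump_comb_def)
  moreover have "lin_comb ?ys (\<lambda>t. t) = lin_comb xs (\<lambda>t. t)" by (simp add: lin_comb_append)
  moreover have "bridge_var ?ys = bridge_var xs"
    unfolding bridge_var_bump_comb[OF w xs] by (simp add: k_def power2_eq_square)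
  ultimately show "(\<integral>f. iexp (lin_comb xs (flip m w f)) \<partial>L)
        = iexp (b * lin_comb xs (\<lambda>t. t)) * of_real (exp (- bridge_var xs / 2))"
    using L by (simp add: bridge_law_def)
qed

definition rotate_time :: "real \<Rightarrow> real \<Rightarrow> real" where
  "rotate_time a t = (if a + t \<le> 1 then a + t else a + t - 1)"

definition shift_comb :: "real \<Rightarrow> (real \<times> real) list \<Rightarrow> (real \<times> real) list" where
  "shift_comb a xs = concat (map (\<lambda>(t, c). [(rotate_time a t, c), (a, - c)]) xs)"

lemma lin_comb_shift_comb: "lin_comb (shift_comb a xs) f = lin_comb xs (\<lambda>t. f (rotate_time a t) - f a)"
  by (induction xs) (auto simp: shift_comb_def algebra_simps)

lemma measurable_cyclic_shift:
  assumes L: "bridge_law b L" and a: "0 \<le> a" "a \<le> 1"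
  shows "cyclic_shift b a \<in> measurable L L"
proof (rule measurable_bridge_lawI[OF L measurable_path_spaceI])
  show "cyclic_shift b a f \<in> bridge_paths b" if "f \<in> space L" for f
    using that cyclic_shift_in_bridge_paths a by (simp add: bridge_law_space[OF L])
  fix t :: real assume t: "t \<in> {0..1}"
  have [measurable]: "(\<lambda>f. f a) \<in> borel_measurable L" using a by (auto intro!: measurable_bridge_law_eval[OF L])
  show "(\<lambda>f. cyclic_shift b a f t) \<in> borel_measurable L"
  proof (cases "a + t \<le> 1")
    case True
    have [measurable]: "(\<lambda>f. f (a + t)) \<in> borel_measurable L"
      using a t True by (auto intro!: measurable_bridge_law_eval[OF L])
    show ?thesis using True unfolding cyclic_shift_def[abs_def] by simp
  next
    case False
    have [measurable]: "(\<lambda>f. f (a + t - 1)) \<in> borel_measurable L"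
      using a t False by (auto intro!: measurable_bridge_law_eval[OF L])
    show ?thesis using False unfolding cyclic_shift_def[abs_def] by simp
  qed
qed

text \<open>The increments of the bridge have constant mean \<open>b\<close> per unit time, and the covariance of increments taken from
  time \<open>a\<close>, with times read modulo 1, is again the bridge covariance.\<close>

lemma distr_cyclic_shift:
  assumes L: "bridge_law b L" and a: "0 \<le> a" "a \<le> 1"
  shows "distr L L (cyclic_shift b a) = L"
proof (rule bridge_law_distr_eqI[OF L _ measurable_cyclic_shift[OF assms]])
  show "prob_space L" using L by (simp add: bridge_law_def)
  fix xs :: "(real \<times> real) list" assume xs: "fst ` set xs \<subseteq> {0..1}"
  let ?ys = "shift_comb a xs" and ?\<rho> = "rotate_time a"
  let ?wrap = "\<lambda>t. if a + t \<le> 1 then 0 else 1 :: real"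
  have S: "cyclic_shift b a f = (\<lambda>t. (f (?\<rho> t) - f a) + b * ?wrap t)" for f
    by (auto simp: cyclic_shift_def rotate_time_def fun_eq_iff)
  have e: "lin_comb xs (cyclic_shift b a f) = lin_comb ?ys f + b * lin_comb xs ?wrap" for f
    unfolding S lin_comb_add lin_comb_cmult lin_comb_shift_comb by simp
  have ys: "fst ` set ?ys \<subseteq> {0..1}" using xs a by (fastforce simp: shift_comb_def rotate_time_def)
  have m: "lin_comb ?ys (\<lambda>t. t) + lin_comb xs ?wrap = lin_comb xs (\<lambda>t. t)"
    unfolding lin_comb_shift_comb lin_comb_add[symmetric]
    by (rule lin_comb_cong) (auto simp: rotate_time_def)
  have cov: "bridge_cov (?\<rho> t) (?\<rho> s) - bridge_cov (?\<rho> t) a - (bridge_cov a (?\<rho> s) - bridge_cov a a) = bridge_cov t s"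
    if "t \<in> {0..1}" "s \<in> {0..1}" for t s
    using that a unfolding bridge_cov_def rotate_time_def min_def by (auto simp: algebra_simps)
  have v: "bridge_var ?ys = bridge_var xs"
    unfolding bridge_var_def lin_comb_shift_comb lin_comb_diff[symmetric]
  proof (rule lin_comb_cong, rule lin_comb_cong)
    fix t s assume "t \<in> fst ` set xs" "s \<in> fst ` set xs"
    then have "t \<in> {0..1}" "s \<in> {0..1}" using xs by auto
    then show "bridge_cov (?\<rho> t) (?\<rho> s) - bridge_cov (?\<rho> t) a - (bridge_cov a (?\<rho> s) - bridge_cov a a) = bridge_cov t s"
      by (rule cov)
  qed
  have "(\<integral>f. iexp (lin_comb xs (cyclic_shift b a f)) \<partial>L)
     = (\<integral>f. iexp (lin_comb ?ys f) * iexp (b * lin_comb xs ?wrap) \<partial>L)"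
    by (simp only: e of_real_add distrib_left exp_add)
  also have "\<dots> = (\<integral>f. iexp (lin_comb ?ys f) \<partial>L) * iexp (b * lin_comb xs ?wrap)"
    by (rule integral_mult_left_zero)
  also have "\<dots> = iexp (b * lin_comb ?ys (\<lambda>t. t)) * of_real (exp (- bridge_var xs / 2)) * iexp (b * lin_comb xs ?wrap)"
    using L ys v by (simp add: bridge_law_def)
  also have "\<dots> = iexp (b * lin_comb xs (\<lambda>t. t)) * of_real (exp (- bridge_var xs / 2))"
  proof -
    have "iexp (b * (x + y)) = iexp (b * x) * iexp (b * y)" for x y
      by (simp only: of_real_mult of_real_add distrib_left exp_add)
    then show ?thesis by (simp add: m[symmetric])
  qed
  finally show "(\<integral>f. iexp (lin_comb xs (cyclic_shift b a f)) \<partial>L)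
        = iexp (b * lin_comb xs (\<lambda>t. t)) * of_real (exp (- bridge_var xs / 2))" .
qed

section \<open>Flips centred at a random time\<close>

lemma argmin_upto_cong: "(\<And>s. s \<in> {0..d} \<Longrightarrow> f s = g s) \<Longrightarrow> argmin_upto d f = argmin_upto d g"
  unfolding argmin_upto_def by (rule arg_cong[where f = Least]) auto

lemma bridge_law_argmin:
  assumes L: "bridge_law b L" and d: "0 < d" "d \<le> 1"
  shows "argmin_upto d \<in> borel_measurable L"
    and "f \<in> space L \<Longrightarrow> argmin_upto d f \<in> {0..d}"
proof -
  have c: "continuous_on {0..d} f" if "f \<in> space L" for f
    using that d unfolding bridge_law_space[OF L] bridge_paths_def
    by (auto elim!: continuous_on_subset)
  show "argmin_upto d \<in> borel_measurable L"
    by (rule borel_measurable_argmin_upto[where X = "\<lambda>f. f"])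
      (use c d in \<open>auto intro!: measurable_bridge_law_eval[OF L]\<close>)
  show "f \<in> space L \<Longrightarrow> argmin_upto d f \<in> {0..d}" using argmin_upto_props(1)[OF c] d by auto
qed

lemma measurable_bridge_law_eval_at:
  assumes L: "bridge_law b L" and "g \<in> borel_measurable L" "\<And>f. f \<in> space L \<Longrightarrow> g f \<in> {0..1}"
  shows "(\<lambda>f. f (g f)) \<in> borel_measurable L"
  by (rule borel_measurable_eval_at[where X = "\<lambda>f. f"])
    (use assms in \<open>auto intro!: measurable_bridge_law_eval[OF L] simp: bridge_law_space[OF L] bridge_paths_def\<close>)

lemma measurable_random_flip:
  assumes L: "bridge_law b L" and g [measurable]: "g \<in> borel_measurable L"
    and g01: "\<And>f. f \<in> space L \<Longrightarrow> g f \<in> {w..1 - w}" and w: "0 < w"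
  shows "(\<lambda>f. flip (g f) w f) \<in> measurable L L"
proof (rule measurable_bridge_lawI[OF L measurable_path_spaceI])
  show "flip (g f) w f \<in> bridge_paths b" if "f \<in> space L" for f
    using flip_in_bridge_paths[of f b w "g f"] that g01[OF that] w by (simp add: bridge_law_space[OF L])
  fix t :: real assume t: "t \<in> {0..1}"
  have [measurable]: "(\<lambda>f. f (g f)) \<in> borel_measurable L" "(\<lambda>f. f (g f - w)) \<in> borel_measurable L"
    "(\<lambda>f. f (g f + w)) \<in> borel_measurable L"
    by (rule measurable_bridge_law_eval_at[OF L]; use g01 w in fastforce)+
  note [measurable] = measurable_bridge_law_eval[OF L t]
  show "(\<lambda>f. flip (g f) w f t) \<in> borel_measurable L" unfolding flip_def bump_def tent_def by measurable
qed

lemma measurable_delayed_flip: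
  assumes L: "bridge_law b L" and c: "3/4 \<le> c" "c \<le> 7/8"
  shows "delayed_flip c \<in> measurable L L"
  unfolding delayed_flip_def[abs_def]
proof (rule measurable_random_flip[OF L])
  have [measurable]: "argmin_upto (1/16) \<in> borel_measurable L" by (rule bridge_law_argmin[OF L]) auto
  show "(\<lambda>f. argmin_upto (1/16) f + c) \<in> borel_measurable L" by measurable
  show "argmin_upto (1/16) f + c \<in> {1/16..1 - 1/16}" if "f \<in> space L" for f
    using bridge_law_argmin(2)[OF L _ _ that, of "1/16"] c by auto
qed simp

text \<open>When the minimiser is rounded to a grid, the event that it takes a given grid value is invariant under the
  corresponding deterministic flip, so the rounded flip preserves the law piece by piece. Continuity of the path carries
  the characteristic functional over to the limit.\<close>

lemma distr_delayed_flip: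
  assumes L: "bridge_law b L" and c: "3/4 \<le> c" "c \<le> 7/8"
  shows "distr L L (delayed_flip c) = L"
proof (rule bridge_law_distr_eqI[OF L _ measurable_delayed_flip[OF assms]])
  show "prob_space L" using L by (simp add: bridge_law_def)
  then interpret L: prob_space L .
  fix xs :: "(real \<times> real) list" assume xs: "fst ` set xs \<subseteq> {0..1}"
  define \<theta> where "\<theta> = argmin_upto (1/16)"
  have th [measurable]: "\<theta> \<in> borel_measurable L" unfolding \<theta>_def by (rule bridge_law_argmin[OF L]) auto
  have th01: "\<theta> f \<in> {0..1/16}" if "f \<in> space L" for f
    using bridge_law_argmin(2)[OF L _ _ that, of "1/16"] by (simp add: \<theta>_def)
  define k where "k n f = nat \<lfloor>real (Suc n) * \<theta> f\<rfloor>" for n f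
  define G where "G m f = iexp (lin_comb xs (flip (m + c) (1/16) f))" for m f
  note [measurable] = measurable_bridge_law_lin_comb[OF L xs]
  have kf: "real (k n f) = of_int \<lfloor>real (Suc n) * \<theta> f\<rfloor>" if "f \<in> space L" for n f
    using th01[OF that] by (simp add: k_def del: of_nat_Suc)
  have kb: "real (k n f) / real (Suc n) \<le> \<theta> f" if "f \<in> space L" for n f
    unfolding kf[OF that] by (rule floor_grid)
  have kmeas [measurable]: "k n \<in> measurable L (count_space UNIV)" for n
    unfolding k_def[abs_def] by measurable
  have ind [measurable]: "(\<lambda>f. indicator {j} (k n f) :: complex) \<in> borel_measurable L" for j n
    by (rule measurable_compose[OF kmeas]) simp
  have iexp_meas: "(\<lambda>f. iexp (h f)) \<in> borel_measurable L" if "h \<in> borel_measurable L" for h :: "(real \<Rightarrow> real) \<Rightarrow> real"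
    using that by measurable
  have [measurable]: "(\<lambda>f. iexp (lin_comb xs f)) \<in> borel_measurable L"
    by (rule iexp_meas) measurable
  \<comment> \<open>with the delay rounded to a grid, the flip is a fixed one on each piece of a partition that it preserves\<close>
  have disc: "(\<integral>f. G (real (k n f) / real (Suc n)) f \<partial>L) = (\<integral>f. iexp (lin_comb xs f) \<partial>L)" for n
  proof -
    have piece: "(\<integral>f. indicator {j} (k n f) * G (real j / real (Suc n)) f \<partial>L)
        = (\<integral>f. indicator {j} (k n f) * iexp (lin_comb xs f) \<partial>L)"
      and Gi: "integrable L (\<lambda>f. indicator {j} (k n f) * G (real j / real (Suc n)) f)" for j
    proof -
      let ?m = "real j / real (Suc n)"
      have "(\<integral>f. indicator {j} (k n f) * G ?m f \<partial>L) = (\<integral>f. indicator {j} (k n f) * iexp (lin_comb xs f) \<partial>L)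
        \<and> integrable L (\<lambda>f. indicator {j} (k n f) * G ?m f)"
      proof (cases "?m \<le> 1/16")
        case True
        have m0: "0 \<le> ?m" by simp
        have w: "0 < (1/16::real)" "0 \<le> ?m + c - 1/16" "?m + c + 1/16 \<le> 1" using True m0 c by linarith+
        note F [measurable] = measurable_flip[OF L w]
        have "\<theta> (flip (?m + c) (1/16) f) = \<theta> f" for f
          unfolding \<theta>_def
        proof (rule argmin_upto_cong)
          fix s :: real assume "s \<in> {0..1/16}"
          then have "s \<notin> {?m + c - 1/16 <..< ?m + c + 1/16}" using m0 c
            unfolding greaterThanLessThan_iff atLeastAtMost_iff by linarith
          then have "tent (?m + c) (1/16) s = 0" by (intro tent_eq_0) auto
          then show "flip (?m + c) (1/16) f s = f s" by (simp add: flip_def)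
        qed
        then have inv: "k n (flip (?m + c) (1/16) f) = k n f" for f by (simp add: k_def)
        have "(\<integral>f. indicator {j} (k n f) * iexp (lin_comb xs f) \<partial>L)
            = (\<integral>f. indicator {j} (k n f) * iexp (lin_comb xs f) \<partial>distr L L (flip (?m + c) (1/16)))"
          unfolding distr_flip[OF L w] ..
        also have "\<dots> = (\<integral>f. indicator {j} (k n f) * G ?m f \<partial>L)"
          by (subst integral_distr[OF F]) (intro borel_measurable_times ind, measurable, simp add: inv G_def del: of_nat_Suc)
        finally have "(\<integral>f. indicator {j} (k n f) * G ?m f \<partial>L) = (\<integral>f. indicator {j} (k n f) * iexp (lin_comb xs f) \<partial>L)" ..
        moreover have "integrable L (\<lambda>f. indicator {j} (k n f) * G ?m f)"
        proof (rule L.integrable_const_bound[where B = 1])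
          have "(\<lambda>f. lin_comb xs (flip (?m + c) (1/16) f)) \<in> borel_measurable L"
            by (rule measurable_compose[OF F]) measurable
          then show "(\<lambda>f. indicator {j} (k n f) * G ?m f) \<in> borel_measurable L"
            unfolding G_def by (intro borel_measurable_times ind iexp_meas)
        qed (auto simp: norm_mult G_def indicator_def)
        ultimately show ?thesis by blast
      next
        case False
        have "k n f \<noteq> j" if "f \<in> space L" for f
        proof
          assume e: "k n f = j"
          show False using kb[OF that, of n] th01[OF that] False unfolding e atLeastAtMost_iff by linarith
        qed
        then have z: "indicator {j} (k n f) = (0 :: complex)" if "f \<in> space L" for f using that by auto
        show ?thesis by (auto simp: z cong: Bochner_Integration.integral_cong Bochner_Integration.integrable_cong)
      qed
      then show "(\<integral>f. indicator {j} (k n f) * G ?m f \<partial>L) = (\<integral>f. indicator {j} (k n f) * iexp (lin_comb xs f) \<partial>L)"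
        "integrable L (\<lambda>f. indicator {j} (k n f) * G ?m f)" by auto
    qed
    have kn: "k n f \<in> {..Suc n}" if "f \<in> space L" for f
    proof -
      have "real (k n f) \<le> real (Suc n) * \<theta> f"
        using kb[OF that, of n] by (simp add: pos_divide_le_eq mult.commute del: of_nat_Suc)
      also have "\<dots> \<le> real (Suc n) * 1" using th01[OF that] by (intro mult_left_mono) auto
      finally show ?thesis by simp
    qed
    have sum: "(\<Sum>j\<le>Suc n. indicator {j} (k n f) * H j) = H (k n f)" if "f \<in> space L" for f and H :: "nat \<Rightarrow> complex"
    proof -
      have "(\<Sum>j\<le>Suc n. indicator {j} (k n f) * H j) = (\<Sum>j\<le>Suc n. if j = k n f then H j else 0)"
        by (intro sum.cong) (auto simp: indicator_def)
      then show ?thesis using kn[OF that] by simp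
    qed
    have "(\<integral>f. G (real (k n f) / real (Suc n)) f \<partial>L) = (\<integral>f. (\<Sum>j\<le>Suc n. indicator {j} (k n f) * G (real j / real (Suc n)) f) \<partial>L)"
      by (intro Bochner_Integration.integral_cong refl sum[symmetric])
    also have "\<dots> = (\<Sum>j\<le>Suc n. (\<integral>f. indicator {j} (k n f) * G (real j / real (Suc n)) f \<partial>L))"
      by (rule Bochner_Integration.integral_sum[OF Gi])
    also have "\<dots> = (\<Sum>j\<le>Suc n. (\<integral>f. indicator {j} (k n f) * iexp (lin_comb xs f) \<partial>L))"
      by (simp only: piece)
    also have "\<dots> = (\<integral>f. (\<Sum>j\<le>Suc n. indicator {j} (k n f) * iexp (lin_comb xs f)) \<partial>L)"
      by (intro Bochner_Integration.integral_sum[symmetric] L.integrable_const_bound[where B = 1])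
        (auto simp: norm_mult indicator_def)
    also have "\<dots> = (\<integral>f. iexp (lin_comb xs f) \<partial>L)"
      by (intro Bochner_Integration.integral_cong refl sum)
    finally show ?thesis .
  qed
  have lim: "(\<lambda>n. G (real (k n f) / real (Suc n)) f) \<longlonglongrightarrow> iexp (lin_comb xs (delayed_flip c f))"
    if f: "f \<in> space L" for f
  proof -
    have cont: "continuous_on {0..1} f" using f by (simp add: bridge_law_space[OF L] bridge_paths_def)
    let ?m = "\<lambda>n. real (k n f) / real (Suc n)"
    have m: "?m \<longlonglongrightarrow> \<theta> f" unfolding kf[OF f] by (rule floor_grid_tendsto)
    have m0: "0 \<le> ?m n" for n by simp
    have m01: "?m n \<in> {0..1/16}" for n
      using kb[OF f, of n] th01[OF f] m0[of n] unfolding atLeastAtMost_iff by linarith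
    have ev: "(\<lambda>n. f (?m n + c + e)) \<longlonglongrightarrow> f (\<theta> f + c + e)" if e: "e \<in> {-1/16..1/16}" for e
    proof (rule continuous_on_tendsto_compose[OF cont])
      show "(\<lambda>n. ?m n + c + e) \<longlonglongrightarrow> \<theta> f + c + e" by (intro tendsto_intros m)
      show "\<theta> f + c + e \<in> {0..1}" using th01[OF f] e c by auto
      show "\<forall>\<^sub>F n in sequentially. ?m n + c + e \<in> {0..1}"
      proof (rule always_eventually, rule allI)
        fix n show "?m n + c + e \<in> {0..1}" using m01[of n] e c unfolding atLeastAtMost_iff by linarith
      qed
    qed
    have "(\<lambda>n. flip (?m n + c) (1/16) f t) \<longlonglongrightarrow> delayed_flip c f t" for t
      unfolding flip_def delayed_flip_def bump_def tent_def \<theta>_def[symmetric]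
      using ev[of 0] ev[of "-1/16"] ev[of "1/16"] m
      by (intro tendsto_intros) auto
    then have "(\<lambda>n. lin_comb xs (flip (?m n + c) (1/16) f)) \<longlonglongrightarrow> lin_comb xs (delayed_flip c f)"
      by (induction xs) (auto intro!: tendsto_intros)
    then show ?thesis unfolding G_def by (intro tendsto_intros)
  qed
  have "(\<lambda>n. \<integral>f. G (real (k n f) / real (Suc n)) f \<partial>L) \<longlonglongrightarrow> (\<integral>f. iexp (lin_comb xs (delayed_flip c f)) \<partial>L)"
  proof (rule integral_dominated_convergence[where w = "\<lambda>_. 1"])
    have "(\<lambda>f. lin_comb xs (delayed_flip c f)) \<in> borel_measurable L"
      by (rule measurable_compose[OF measurable_delayed_flip[OF L c]]) measurable
    then show "(\<lambda>f. iexp (lin_comb xs (delayed_flip c f))) \<in> borel_measurable L" by measurable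
    fix n
    have "(\<lambda>f. flip (real (k n f) / real (Suc n) + c) (1/16) f) \<in> measurable L L"
    proof (rule measurable_random_flip[OF L])
      show "real (k n f) / real (Suc n) + c \<in> {1/16..1 - 1/16}" if "f \<in> space L" for f
      proof -
        have "0 \<le> real (k n f) / real (Suc n)" by simp
        then show ?thesis using kb[OF that, of n] th01[OF that] c unfolding atLeastAtMost_iff by linarith
      qed
      have kr: "(\<lambda>f. real (k n f)) \<in> borel_measurable L" by (rule measurable_compose[OF kmeas]) simp
      show "(\<lambda>f. real (k n f) / real (Suc n) + c) \<in> borel_measurable L"
        by (intro borel_measurable_add borel_measurable_divide kr) auto
    qed simp
    then have "(\<lambda>f. lin_comb xs (flip (real (k n f) / real (Suc n) + c) (1/16) f)) \<in> borel_measurable L"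
      by (rule measurable_compose) measurable
    then show "(\<lambda>f. G (real (k n f) / real (Suc n)) f) \<in> borel_measurable L" unfolding G_def by measurable
  qed (use lim in \<open>auto simp: G_def\<close>)
  then have "(\<integral>f. iexp (lin_comb xs (delayed_flip c f)) \<partial>L) = (\<integral>f. iexp (lin_comb xs f) \<partial>L)"
    unfolding disc by (rule LIMSEQ_unique) (rule tendsto_const)
  then show "(\<integral>f. iexp (lin_comb xs (delayed_flip c f)) \<partial>L)
      = iexp (b * lin_comb xs (\<lambda>t. t)) * of_real (exp (- bridge_var xs / 2))"
    using L xs by (simp add: bridge_law_def)
qed

section \<open>Translations by hat functions and full support\<close>

text \<open>Removes the hat component of the path and puts in a fresh one; \<open>sqrt (w / 2)\<close> is the standard deviation of a
  hat coefficient of the bridge.\<close>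

definition resample :: "real \<Rightarrow> real \<Rightarrow> (real \<Rightarrow> real) \<times> real \<Rightarrow> real \<Rightarrow> real" where
  "resample m w = (\<lambda>(f, z) t. f t - bump m w f * tent m w t + sqrt (w / 2) * z * tent m w t)"

lemma bridge_paths_add_tent:
  assumes "f \<in> bridge_paths b" "0 < w" "0 \<le> m - w" "m + w \<le> 1"
  shows "(\<lambda>t. f t + a * tent m w t) \<in> bridge_paths b"
proof -
  have "tent m w 0 = 0" "tent m w 1 = 0" using assms by (auto intro!: tent_eq_0)
  then show ?thesis using assms(1) by (auto simp: bridge_paths_def intro!: continuous_intros)
qed

lemma measurable_add_tent:
  assumes L: "bridge_law b L" and w: "0 < w" "0 \<le> m - w" "m + w \<le> 1"
  shows "(\<lambda>f t. f t + a * tent m w t) \<in> measurable L L"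
proof (rule measurable_bridge_lawI[OF L measurable_path_spaceI])
  show "(\<lambda>t. f t + a * tent m w t) \<in> bridge_paths b" if "f \<in> space L" for f
    using bridge_paths_add_tent that w by (simp add: bridge_law_space[OF L])
  fix t :: real assume t: "t \<in> {0..1}"
  note [measurable] = measurable_bridge_law_eval[OF L t]
  show "(\<lambda>f. f t + a * tent m w t) \<in> borel_measurable L" by measurable
qed

lemma measurable_resample:
  assumes L: "bridge_law b L" and w: "0 < w" "0 \<le> m - w" "m + w \<le> 1"
  shows "resample m w \<in> measurable (L \<Otimes>\<^sub>M std_normal_distribution) L"
proof (rule measurable_bridge_lawI[OF L measurable_path_spaceI])
  show "resample m w p \<in> bridge_paths b" if "p \<in> space (L \<Otimes>\<^sub>M std_normal_distribution)" for p
  proof -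
    obtain f z where p: "p = (f, z)" by (cases p)
    then have f: "f \<in> bridge_paths b" using that by (simp add: space_pair_measure bridge_law_space[OF L])
    have "resample m w p = (\<lambda>t. f t + (sqrt (w / 2) * z - bump m w f) * tent m w t)"
      by (auto simp: p resample_def fun_eq_iff algebra_simps)
    then show ?thesis using bridge_paths_add_tent[OF f w] by simp
  qed
  fix t :: real assume t: "t \<in> {0..1}"
  note [measurable] = measurable_bridge_law_eval[OF L t] measurable_bump[OF L w]
  have [measurable]: "(\<lambda>z. z) \<in> borel_measurable std_normal_distribution" by simp
  have 1: "(\<lambda>p. fst p t) \<in> borel_measurable (L \<Otimes>\<^sub>M std_normal_distribution)"
    by (rule measurable_compose[OF measurable_fst]) measurable
  have 2: "(\<lambda>p. bump m w (fst p)) \<in> borel_measurable (L \<Otimes>\<^sub>M std_normal_distribution)"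
    by (rule measurable_compose[OF measurable_fst]) measurable
  have 3: "(\<lambda>p. snd p) \<in> borel_measurable (L \<Otimes>\<^sub>M std_normal_distribution)"
    by (rule measurable_compose[OF measurable_snd]) measurable
  have "(\<lambda>p. fst p t - bump m w (fst p) * tent m w t + sqrt (w / 2) * snd p * tent m w t)
      \<in> borel_measurable (L \<Otimes>\<^sub>M std_normal_distribution)"
    using 1 2 3 by (intro borel_measurable_add borel_measurable_diff borel_measurable_times) auto
  then show "(\<lambda>p. resample m w p t) \<in> borel_measurable (L \<Otimes>\<^sub>M std_normal_distribution)"
    by (simp add: resample_def case_prod_beta)
qed

lemma distr_resample:
  assumes L: "bridge_law b L" and w: "0 < w" "0 \<le> m - w" "m + w \<le> 1"
  shows "distr (L \<Otimes>\<^sub>M std_normal_distribution) L (resample m w) = L"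
proof (rule bridge_law_distr_eqI[OF L _ measurable_resample[OF assms]])
  have "prob_space L" using L by (simp add: bridge_law_def)
  then interpret L: prob_space L .
  interpret N: prob_space std_normal_distribution
    using real_dist_normal_dist by (simp add: real_distribution_def)
  interpret P: pair_prob_space L std_normal_distribution ..
  show "prob_space (L \<Otimes>\<^sub>M std_normal_distribution)" by (rule P.prob_space_axioms)
  fix xs :: "(real \<times> real) list" assume xs: "fst ` set xs \<subseteq> {0..1}"
  define q where "q = lin_comb xs (tent m w)"
  define s where "s = sqrt (w / 2)"
  have s2: "s\<^sup>2 = w / 2" using w by (simp add: s_def)
  let ?ys = "xs @ bump_comb m w (- q)"
  have ys: "fst ` set ?ys \<subseteq> {0..1}" using xs w by (auto simp: bump_comb_def)
  have e: "lin_comb xs (resample m w (f, z)) = lin_comb ?ys f + s * z * q" for f z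
    unfolding resample_def case_prod_conv lin_comb_add lin_comb_diff lin_comb_append lin_comb_cmult lin_comb_bump_comb
    by (simp add: q_def s_def)
  have "(\<lambda>p. lin_comb xs (resample m w p)) \<in> borel_measurable (L \<Otimes>\<^sub>M std_normal_distribution)"
    by (rule measurable_compose[OF measurable_resample[OF L w] measurable_bridge_law_lin_comb[OF L xs]])
  then have int: "integrable (L \<Otimes>\<^sub>M std_normal_distribution) (\<lambda>p. iexp (lin_comb xs (resample m w p)))"
    by (intro P.integrable_const_bound[where B = 1]) auto
  have "(\<integral>p. iexp (lin_comb xs (resample m w p)) \<partial>(L \<Otimes>\<^sub>M std_normal_distribution))
     = (\<integral>f. (\<integral>z. iexp (lin_comb ?ys f + s * z * q) \<partial>std_normal_distribution) \<partial>L)"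
    unfolding P.integral_fst'[OF int, symmetric] e ..
  also have "\<dots> = (\<integral>f. iexp (lin_comb ?ys f) * of_real (exp (- (s * q)\<^sup>2 / 2)) \<partial>L)"
  proof (rule Bochner_Integration.integral_cong[OF refl])
    fix f
    have "(\<integral>z. iexp (lin_comb ?ys f + s * z * q) \<partial>std_normal_distribution)
       = (\<integral>z. iexp (lin_comb ?ys f) * iexp (s * q * z) \<partial>std_normal_distribution)"
      by (intro Bochner_Integration.integral_cong refl)
        (simp only: of_real_add distrib_left exp_add, simp add: mult_ac)
    also have "\<dots> = iexp (lin_comb ?ys f) * char std_normal_distribution (s * q)"
      unfolding char_def by (rule integral_mult_right_zero)
    finally show "(\<integral>z. iexp (lin_comb ?ys f + s * z * q) \<partial>std_normal_distribution)
       = iexp (lin_comb ?ys f) * of_real (exp (- (s * q)\<^sup>2 / 2))"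
      by (simp only: char_std_normal_distribution)
  qed
  also have "\<dots> = (\<integral>f. iexp (lin_comb ?ys f) \<partial>L) * of_real (exp (- (s * q)\<^sup>2 / 2))"
    by (rule integral_mult_left_zero)
  also have "\<dots> = iexp (b * lin_comb ?ys (\<lambda>t. t)) * (of_real (exp (- bridge_var ?ys / 2)) * of_real (exp (- (s * q)\<^sup>2 / 2)))"
    using L ys by (simp only: bridge_law_def mult.assoc)
  \<comment> \<open>the variance lost with the old hat component is restored by the new one\<close>
  also have "of_real (exp (- bridge_var ?ys / 2)) * of_real (exp (- (s * q)\<^sup>2 / 2))
      = (of_real (exp (- bridge_var xs / 2)) :: complex)"
  proof -
    have "bridge_var ?ys + (s * q)\<^sup>2 = bridge_var xs"
      unfolding bridge_var_bump_comb[OF w xs] q_def[symmetric] power_mult_distrib s2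
      by (simp add: power2_eq_square)
    then have "- bridge_var ?ys / 2 + - (s * q)\<^sup>2 / 2 = - bridge_var xs / 2" by (simp add: field_simps)
    then show ?thesis unfolding of_real_mult[symmetric] exp_add[symmetric] by simp
  qed
  finally show "(\<integral>p. iexp (lin_comb xs (resample m w p)) \<partial>(L \<Otimes>\<^sub>M std_normal_distribution))
        = iexp (b * lin_comb xs (\<lambda>t. t)) * of_real (exp (- bridge_var xs / 2))"
    by (simp add: lin_comb_append)
qed

lemma AE_std_normal_shift:
  assumes [measurable]: "Measurable.pred borel P" and "AE z in std_normal_distribution. P z"
  shows "AE z in std_normal_distribution. P (z + c)"
proof -
  have pos: "0 < std_normal_density z" for z :: real by (rule normal_density_pos) simp
  have "AE z in lborel. P z" using assms(2) by (subst (asm) AE_density) (auto simp: pos)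
  from AE_borel_affine[OF _ assms(1) this, of 1 c] have "AE z in lborel. P (z + c)" by (simp add: add.commute)
  then show ?thesis by (subst AE_density) (auto elim!: AE_mp)
qed

text \<open>By resampling, the bridge is a path plus an independent Gaussian multiple of the hat function, and a Gaussian has
  the null sets of Lebesgue measure, which are translation invariant.\<close>

lemma AE_add_tent:
  assumes L: "bridge_law b L" and w: "0 < w" "0 \<le> m - w" "m + w \<le> 1"
    and E [measurable]: "E \<in> sets L" and ae: "AE f in L. f \<notin> E"
  shows "AE f in L. (\<lambda>t. f t + a * tent m w t) \<notin> E"
proof -
  have "prob_space L" using L by (simp add: bridge_law_def)
  then interpret L: prob_space L .
  interpret N: prob_space std_normal_distribution
    using real_dist_normal_dist by (simp add: real_distribution_def)
  interpret P: pair_prob_space L std_normal_distribution ..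
  let ?\<Phi> = "resample m w" and ?T = "\<lambda>f t. f t + a * tent m w t"
  note \<Phi> [measurable] = measurable_resample[OF L w]
  note T [measurable] = measurable_add_tent[OF L w, of a]
  define c where "c = a / sqrt (w / 2)"
  have shift: "?T (?\<Phi> (f, z)) = ?\<Phi> (f, z + c)" for f z
    using w by (auto simp: resample_def c_def fun_eq_iff algebra_simps)
  have "AE f in distr (L \<Otimes>\<^sub>M std_normal_distribution) L ?\<Phi>. f \<notin> E"
    unfolding distr_resample[OF L w] by (rule ae)
  then have "AE p in L \<Otimes>\<^sub>M std_normal_distribution. ?\<Phi> p \<notin> E"
    by (subst (asm) AE_distr_iff) auto
  then have 1: "AE f in L. AE z in std_normal_distribution. ?\<Phi> (f, z) \<notin> E" by (rule P.AE_pair)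
  have 2: "AE f in L. AE z in std_normal_distribution. ?T (?\<Phi> (f, z)) \<notin> E"
    using 1 AE_space
  proof eventually_elim
    fix f assume f: "f \<in> space L" and z: "AE z in std_normal_distribution. ?\<Phi> (f, z) \<notin> E"
    have "(\<lambda>z. ?\<Phi> (f, z)) \<in> measurable borel L"
    proof -
      have "(\<lambda>z. (f, z)) \<in> measurable borel (L \<Otimes>\<^sub>M std_normal_distribution)"
        using f by (intro measurable_Pair measurable_const) auto
      then show ?thesis by (rule measurable_compose[OF _ \<Phi>])
    qed
    note [measurable] = this
    show "AE z in std_normal_distribution. ?T (?\<Phi> (f, z)) \<notin> E"
      unfolding shift by (rule AE_std_normal_shift[OF _ z]) measurable
  qed
  have "AE p in L \<Otimes>\<^sub>M std_normal_distribution. ?T (?\<Phi> p) \<notin> E"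
    by (rule P.AE_pair_measure[OF _ 2]) measurable
  then have "AE f in distr (L \<Otimes>\<^sub>M std_normal_distribution) L ?\<Phi>. ?T f \<notin> E"
    by (subst AE_distr_iff) auto
  then show ?thesis unfolding distr_resample[OF L w] .
qed

definition tent_sum :: "real \<Rightarrow> (real \<times> real) list \<Rightarrow> real \<Rightarrow> real" where
  "tent_sum w ps t = (\<Sum>(m, a)\<leftarrow>ps. a * tent m w t)"

lemma AE_add_tent_sum:
  assumes L: "bridge_law b L" and w: "0 < w" and E: "E \<in> sets L" and ae: "AE f in L. f \<notin> E"
    and ps: "\<And>m a. (m, a) \<in> set ps \<Longrightarrow> 0 \<le> m - w \<and> m + w \<le> 1"
  shows "AE f in L. (\<lambda>t. f t + tent_sum w ps t) \<notin> E"
  using ps E ae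
proof (induction ps arbitrary: E)
  case Nil
  then show ?case by (simp add: tent_sum_def)
next
  case (Cons p ps)
  obtain m a where p: "p = (m, a)" by (cases p)
  have v: "0 \<le> m - w" "m + w \<le> 1" using Cons(2)[of m a] by (auto simp: p)
  note T = measurable_add_tent[OF L w v, of a]
  let ?E = "(\<lambda>f t. f t + a * tent m w t) -` E \<inter> space L"
  have "?E \<in> sets L" using T Cons.prems(2) by (rule measurable_sets)
  moreover have "AE f in L. f \<notin> ?E" using AE_add_tent[OF L w v Cons.prems(2,3), of a] by eventually_elim auto
  ultimately have ae': "AE f in L. (\<lambda>t. f t + tent_sum w ps t) \<notin> ?E"
    using Cons.prems(1) by (intro Cons.IH) auto
  have sp: "f \<in> space L \<Longrightarrow> (\<lambda>t. f t + tent_sum w qs t) \<in> space L"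
    if "\<And>m a. (m, a) \<in> set qs \<Longrightarrow> 0 \<le> m - w \<and> m + w \<le> 1" for f qs
    using that
  proof (induction qs arbitrary: f)
    case Nil
    then show ?case by (simp add: tent_sum_def)
  next
    case (Cons q qs)
    obtain m' a' where q: "q = (m', a')" by (cases q)
    have v': "0 \<le> m' - w" "m' + w \<le> 1" using Cons(3)[of m' a'] by (auto simp: q)
    have "(\<lambda>t. f t + a' * tent m' w t) \<in> space L"
      using bridge_paths_add_tent[OF _ w v'] Cons.prems(1) by (simp add: bridge_law_space[OF L])
    then have "(\<lambda>t. (f t + a' * tent m' w t) + tent_sum w qs t) \<in> space L"
      by (rule Cons.IH) (use Cons.prems(2) in auto)
    then show ?case by (simp add: q tent_sum_def add.assoc)
  qed
  from ae' AE_space show ?case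
  proof eventually_elim
    case (elim f)
    have "(\<lambda>t. f t + tent_sum w ps t) \<in> space L" by (rule sp) (use elim(2) Cons.prems(1) in auto)
    then show ?case using elim(1) by (simp add: p tent_sum_def algebra_simps)
  qed
qed

text \<open>On a grid of mesh \<open>1/n\<close> the hat functions are a partition of unity with at most two nonzero terms at each point.\<close>

lemma tent_partition:
  assumes n: "0 < n" and x: "x \<in> {0..1}"
  obtains k where "k < n" "\<bar>x - k / n\<bar> \<le> 1 / n" "\<bar>x - Suc k / n\<bar> \<le> 1 / n"
    "0 \<le> tent (k / n) (1 / n) x" "0 \<le> tent (Suc k / n) (1 / n) x"
    "tent (k / n) (1 / n) x + tent (Suc k / n) (1 / n) x = 1"
    "\<And>g. (\<Sum>i\<le>n. g i * tent (i / n) (1 / n) x)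
        = g k * tent (k / n) (1 / n) x + g (Suc k) * tent (Suc k / n) (1 / n) x"
proof -
  define k where "k = min (n - 1) (nat \<lfloor>n * x\<rfloor>)"
  have kn: "k < n" using n by (auto simp: k_def)
  have nx: "0 \<le> n * x" "n * x \<le> n" using x mult_left_mono[of x 1 "real n"] by auto
  have k: "real k \<le> n * x" "n * x \<le> real k + 1"
  proof -
    have "real (nat \<lfloor>n * x\<rfloor>) = of_int \<lfloor>n * x\<rfloor>" using nx by simp
    then have a: "real (nat \<lfloor>n * x\<rfloor>) \<le> n * x" "n * x \<le> real (nat \<lfloor>n * x\<rfloor>) + 1" by linarith+
    then show "real k \<le> n * x" by (simp add: k_def min_def)
    show "n * x \<le> real k + 1"
    proof (cases "nat \<lfloor>n * x\<rfloor> \<le> n - 1")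
      case True
      then show ?thesis using a by (simp add: k_def)
    next
      case False
      then have "k = n - 1" by (simp add: k_def)
      then have "real k + 1 = n" using n by (simp add: of_nat_diff)
      then show ?thesis using nx by simp
    qed
  qed
  have n0: "0 < real n" using n by simp
  have t: "tent (real i / n) (1 / n) x = max 0 (1 - \<bar>n * x - i\<bar>)" for i :: nat
  proof -
    have "\<bar>x - real i / n\<bar> / (1 / n) = \<bar>n * x - i\<bar>"
    proof -
      have "n * x - i = n * (x - real i / n)" using n0 by (simp add: field_simps)
      then show ?thesis using n0 by (simp add: abs_mult)
    qed
    then show ?thesis by (simp only: tent_def)
  qed
  have d: "\<bar>x - real i / n\<bar> \<le> 1 / n \<longleftrightarrow> \<bar>n * x - i\<bar> \<le> 1" for i :: nat
  proof -
    have "n * x - i = n * (x - real i / n)" using n0 by (simp add: field_simps)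
    then show ?thesis using n0 by (simp add: abs_mult field_simps)
  qed
  show thesis
  proof (rule that[of k])
    show "k < n" by (rule kn)
    show "\<bar>x - real k / n\<bar> \<le> 1 / n" "\<bar>x - real (Suc k) / n\<bar> \<le> 1 / n" unfolding d using k by auto
    show "0 \<le> tent (k / n) (1 / n) x" "0 \<le> tent (Suc k / n) (1 / n) x" unfolding t by auto
    show "tent (k / n) (1 / n) x + tent (Suc k / n) (1 / n) x = 1" unfolding t using k by auto
    fix g :: "nat \<Rightarrow> real"
    have "(\<Sum>i\<le>n. g i * tent (i / n) (1 / n) x) = (\<Sum>i\<in>{k, Suc k}. g i * tent (i / n) (1 / n) x)"
    proof (rule sum.mono_neutral_right)
      show "\<forall>i\<in>{..n} - {k, Suc k}. g i * tent (real i / real n) (1 / real n) x = 0"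
      proof
        fix i assume "i \<in> {..n} - {k, Suc k}"
        then have "real i + 1 \<le> k \<or> real k + 2 \<le> i" by auto
        then show "g i * tent (real i / real n) (1 / real n) x = 0" unfolding t using k by auto
      qed
    qed (use kn in auto)
    then show "(\<Sum>i\<le>n. g i * tent (i / n) (1 / n) x)
        = g k * tent (k / n) (1 / n) x + g (Suc k) * tent (Suc k / n) (1 / n) x" by simp
  qed
qed

text \<open>Sums of hat functions with rational coefficients are countable in number and dense. If one tube were null, all its
  translates by such sums would be null by quasi-invariance; but these translates cover the path space.\<close>

lemma tube_not_null:
  assumes L: "bridge_law b L" and f0: "f0 \<in> bridge_paths b" and \<eta>: "0 < \<eta>"
  shows "0 < measure L {f \<in> space L. \<forall>t\<in>{0..1}. \<bar>f t - f0 t\<bar> \<le> \<eta>}"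
    and "{f \<in> space L. \<forall>t\<in>{0..1}. \<bar>f t - f0 t\<bar> \<le> \<eta>} \<in> sets L"
proof -
  have "prob_space L" using L by (simp add: bridge_law_def)
  then interpret L: prob_space L .
  let ?E = "{f \<in> space L. \<forall>t\<in>{0..1}. \<bar>f t - f0 t\<bar> \<le> \<eta>}"
  have c: "continuous_on {0..1} f" if "f \<in> space L" for f
    using that by (simp add: bridge_law_space[OF L] bridge_paths_def)
  have c0: "continuous_on {0..1} f0" using f0 by (simp add: bridge_paths_def)
  have "?E = {f \<in> space L. nonneg_on 0 1 (\<lambda>t. \<eta> - \<bar>f t - f0 t\<bar>)}"
    by (auto simp: nonneg_on_iff continuous_intros c c0)
  also have "\<dots> \<in> sets L"
    by (rule measurable_nonneg_on)
      (intro borel_measurable_diff borel_measurable_abs borel_measurable_const measurable_bridge_law_eval[OF L])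
  finally show E: "?E \<in> sets L" .
  show "0 < measure L ?E"
  proof (rule ccontr)
    assume "\<not> 0 < measure L ?E"
    then have "measure L ?E = 0" using measure_nonneg[of L ?E] by linarith
    then have ae: "AE f in L. f \<notin> ?E" using E by (simp add: L.prob_eq_0)
    define pts :: "nat \<Rightarrow> (nat \<times> rat) list \<Rightarrow> (real \<times> real) list"
      where "pts n qs = map (\<lambda>(i, q). (real i / real n, of_rat q)) qs" for n qs
    define valid :: "nat \<Rightarrow> (nat \<times> rat) list \<Rightarrow> bool"
      where "valid n qs \<longleftrightarrow> 0 < n \<and> (\<forall>(i, q)\<in>set qs. 0 < i \<and> i < n)" for n qs
    \<comment> \<open>one null set serves all the countably many translations\<close>
    have "AE f in L. \<forall>n qs. valid n qs \<longrightarrow> (\<lambda>t. f t + tent_sum (1 / n) (pts n qs) t) \<notin> ?E"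
      unfolding AE_all_countable
    proof (intro allI)
      fix n qs
      show "AE f in L. valid n qs \<longrightarrow> (\<lambda>t. f t + tent_sum (1 / n) (pts n qs) t) \<notin> ?E"
      proof (cases "valid n qs")
        case True
        have "AE f in L. (\<lambda>t. f t + tent_sum (1 / n) (pts n qs) t) \<notin> ?E"
        proof (rule AE_add_tent_sum[OF L _ E ae])
          show "0 < 1 / real n" using True by (simp add: valid_def)
          fix m a assume "(m, a) \<in> set (pts n qs)"
          then obtain i where i: "m = real i / real n" "0 < i" "i < n"
            using True by (auto simp: pts_def valid_def)
          then have "real i + 1 \<le> real n" "1 \<le> real i" by linarith+
          then show "0 \<le> m - 1 / real n \<and> m + 1 / real n \<le> 1"
            using i by (simp add: divide_right_mono field_simps)
        qed
        then show ?thesis by eventually_elim simp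
      qed simp
    qed
    then have "AE f in L. False"
      using AE_space
    proof eventually_elim
      fix f assume f: "f \<in> space L" and no: "\<forall>n qs. valid n qs \<longrightarrow> (\<lambda>t. f t + tent_sum (1 / n) (pts n qs) t) \<notin> ?E"
      define g where "g t = f0 t - f t" for t
      have cg: "continuous_on {0..1} g" unfolding g_def using c[OF f] c0 by (intro continuous_intros)
      have g01: "g 0 = 0" "g 1 = 0" using f f0 by (auto simp: g_def bridge_law_space[OF L] bridge_paths_def)
      obtain \<delta> where \<delta>: "0 < \<delta>" "\<And>x y. x \<in> {0..1} \<Longrightarrow> y \<in> {0..1} \<Longrightarrow> dist y x < \<delta> \<Longrightarrow> dist (g y) (g x) < \<eta> / 2"
        using compact_uniformly_continuous[OF cg compact_Icc] \<eta>
        unfolding uniformly_continuous_on_def by (metis half_gt_zero)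
      obtain n0 where n0: "1 / real (Suc n0) < \<delta>" using nat_approx_posE[OF \<delta>(1)] by blast
      define n where "n = Suc n0"
      have n: "0 < n" "1 / real n < \<delta>" using n0 by (auto simp: n_def)
      have "\<exists>q. \<bar>of_rat q - g (real i / real n)\<bar> < \<eta> / 2" for i
      proof -
        obtain q where "g (real i / real n) < of_rat q" "of_rat q < g (real i / real n) + \<eta> / 2"
          using of_rat_dense[of "g (real i / real n)" "g (real i / real n) + \<eta> / 2"] \<eta> by auto
        then show ?thesis by (intro exI[of _ q]) auto
      qed
      then obtain q where q: "\<And>i. \<bar>of_rat (q i) - g (real i / real n)\<bar> < \<eta> / 2" by metis
      define r where "r i = (if 0 < i \<and> i < n then of_rat (q i) else 0 :: real)" for i
      have r: "\<bar>r i - g (real i / real n)\<bar> < \<eta> / 2" if "i \<le> n" for i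
        using q[of i] that g01 \<eta> n(1) by (cases "i = 0 \<or> i = n") (auto simp: r_def)
      define qs where "qs = map (\<lambda>i. (i, q i)) [1..<n]"
      have v: "valid n qs" using n by (auto simp: valid_def qs_def)
      have ts: "tent_sum (1 / n) (pts n qs) x = (\<Sum>i\<le>n. r i * tent (i / n) (1 / n) x)" for x
      proof -
        have "tent_sum (1 / n) (pts n qs) x = (\<Sum>i\<leftarrow>[1..<n]. of_rat (q i) * tent (i / n) (1 / n) x)"
          by (simp add: tent_sum_def pts_def qs_def o_def)
        also have "\<dots> = (\<Sum>i = 1..<n. of_rat (q i) * tent (i / n) (1 / n) x)"
          by (simp only: interv_sum_list_conv_sum_set_nat set_upt)
        also have "\<dots> = (\<Sum>i\<le>n. r i * tent (i / n) (1 / n) x)"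
          by (rule sum.mono_neutral_cong_left) (auto simp: r_def)
        finally show ?thesis .
      qed
      have "\<bar>tent_sum (1 / n) (pts n qs) x - g x\<bar> \<le> \<eta>" if x: "x \<in> {0..1}" for x
      proof -
        obtain k where k: "k < n" "\<bar>x - k / n\<bar> \<le> 1 / n" "\<bar>x - Suc k / n\<bar> \<le> 1 / n"
          "0 \<le> tent (k / n) (1 / n) x" "0 \<le> tent (Suc k / n) (1 / n) x"
          and k1: "tent (k / n) (1 / n) x + tent (Suc k / n) (1 / n) x = 1"
          and ks: "\<And>g. (\<Sum>i\<le>n. g i * tent (i / n) (1 / n) x)
              = g k * tent (k / n) (1 / n) x + g (Suc k) * tent (Suc k / n) (1 / n) x"
          using tent_partition[OF n(1) x] by blast
        have near: "\<bar>r i - g x\<bar> \<le> \<eta>" if i: "i \<le> n" "\<bar>x - real i / n\<bar> \<le> 1 / n" for i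
        proof -
          have "real i / n \<in> {0..1}" using i n by (auto simp: divide_le_eq_1)
          moreover have "dist (real i / n) x < \<delta>" using i n by (auto simp: dist_real_def)
          ultimately have "dist (g (real i / n)) (g x) < \<eta> / 2" using \<delta>(2)[OF x] by blast
          then show ?thesis using r[OF i(1)] unfolding dist_real_def by linarith
        qed
        let ?a = "tent (k / n) (1 / n) x" and ?b = "tent (Suc k / n) (1 / n) x"
        have "tent_sum (1 / n) (pts n qs) x - g x = (r k - g x) * ?a + (r (Suc k) - g x) * ?b"
        proof -
          have "(r k - g x) * ?a + (r (Suc k) - g x) * ?b = r k * ?a + r (Suc k) * ?b - g x * (?a + ?b)"
            by (simp only: left_diff_distrib distrib_left)
          then show ?thesis using k1 by (simp only: ts ks)
        qed
        also have "\<bar>\<dots>\<bar> \<le> \<bar>r k - g x\<bar> * ?a + \<bar>r (Suc k) - g x\<bar> * ?b"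
          using k(4,5) by (intro order_trans[OF abs_triangle_ineq]) (simp add: abs_mult)
        also have "\<dots> \<le> \<eta> * ?a + \<eta> * ?b"
          using near[of k] near[of "Suc k"] k by (intro add_mono mult_right_mono) auto
        also have "\<dots> = \<eta>" using k1 by (simp only: distrib_left[symmetric] mult_1_right)
        finally show ?thesis .
      qed
      moreover have "(\<lambda>t. f t + tent_sum (1 / n) (pts n qs) t) \<in> space L"
      proof -
        have "tent (real i / n) (1 / n) 0 = 0 \<and> tent (real i / n) (1 / n) 1 = 0" if "0 < i" "i < n" for i
        proof -
          have "real i + 1 \<le> real n" "1 \<le> real i" using that by linarith+
          then show ?thesis using n by (auto intro!: tent_eq_0 simp: field_simps)
        qed
        then have z: "tent_sum (1 / n) (pts n qs) 0 = 0" "tent_sum (1 / n) (pts n qs) 1 = 0"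
          unfolding ts by (auto intro!: sum.neutral simp: r_def)
        have "continuous_on {0..1} (\<lambda>t. f t + tent_sum (1 / n) (pts n qs) t)"
          unfolding ts using c[OF f] by (intro continuous_intros)
        then show ?thesis using f z by (simp add: bridge_law_space[OF L] bridge_paths_def)
      qed
      ultimately have "(\<lambda>t. f t + tent_sum (1 / n) (pts n qs) t) \<in> ?E" by (auto simp: g_def algebra_simps)
      then show False using no v by blast
    qed
    then show False by simp
  qed
qed

section \<open>Past and future events and their joint probabilities\<close>

text \<open>Trimmed version of \<open>V > b\<close> on \<open>[1/4, 13/16]\<close>. The other two conditions say that flipping around \<open>3/4\<close>, on the
  window \<open>[11/16, 13/16]\<close>, takes the path below \<open>b\<close> but keeps it nonnegative, so the flipped path is one on which
  the excursion above \<open>b\<close> has begun later than \<open>3/4\<close>.\<close>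

definition past_event :: "real \<Rightarrow> (real \<Rightarrow> real) \<Rightarrow> bool" where
  "past_event b g \<longleftrightarrow> above (1/4) (13/16) b g \<and> flip (3/4) (1/16) g (3/4) < b \<and>
     nonneg_on (11/16) (13/16) (flip (3/4) (1/16) g)"

text \<open>The same construction after time \<open>13/16\<close>: the path stays above \<open>b\<close> up to time 1, where it equals \<open>b\<close>, while the
  path flipped around \<open>7/8\<close> goes below \<open>b\<close> at time \<open>7/8\<close>. The windows of the two flips meet only in the end
  point \<open>13/16\<close>, where both hat functions vanish.\<close>

definition future_event :: "real \<Rightarrow> (real \<Rightarrow> real) \<Rightarrow> bool" where
  "future_event b g \<longleftrightarrow> (\<forall>n::nat. above (13/16) (1 - 1 / Suc n) b g) \<and> flip (7/8) (1/16) g (7/8) < b \<and>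
     nonneg_on (13/16) (15/16) (flip (7/8) (1/16) g)"

lemma above_cong: "(\<And>r. r \<in> {p..q} \<Longrightarrow> f r = g r) \<Longrightarrow> above p q c f = above p q c g"
  by (simp add: above_def)

lemma nonneg_on_cong: "(\<And>r. r \<in> {p..q} \<Longrightarrow> f r = g r) \<Longrightarrow> nonneg_on p q f = nonneg_on p q g"
  by (simp add: nonneg_on_def)

lemma flip_cong: "f x = g x \<Longrightarrow> bump m w f = bump m w g \<Longrightarrow> flip m w f x = flip m w g x"
  by (simp add: flip_def)

lemma past_event_cong:
  assumes "\<And>r. r \<in> {1/4..13/16} \<Longrightarrow> f r = g r"
  shows "past_event b f = past_event b g"
proof -
  have "bump (3/4) (1/16) f = bump (3/4) (1/16) g" by (rule bump_cong) (auto intro!: assms)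
  then have fl: "flip (3/4) (1/16) f r = flip (3/4) (1/16) g r" if "r \<in> {1/4..13/16}" for r
    using assms[OF that] by (intro flip_cong)
  have 1: "above (1/4) (13/16) b f = above (1/4) (13/16) b g" by (rule above_cong) (rule assms)
  have 2: "nonneg_on (11/16) (13/16) (flip (3/4) (1/16) f) = nonneg_on (11/16) (13/16) (flip (3/4) (1/16) g)"
    by (rule nonneg_on_cong) (rule fl, auto)
  show ?thesis unfolding past_event_def 1 2 by (simp add: fl)
qed

lemma future_event_cong:
  assumes "\<And>r. r \<in> {13/16..1} \<Longrightarrow> f r = g r"
  shows "future_event b f = future_event b g"
proof -
  have "bump (7/8) (1/16) f = bump (7/8) (1/16) g" by (rule bump_cong) (auto intro!: assms)
  then have fl: "flip (7/8) (1/16) f r = flip (7/8) (1/16) g r" if "r \<in> {13/16..1}" for r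
    using assms[OF that] by (intro flip_cong)
  have 1: "above (13/16) (1 - 1 / Suc n) b f = above (13/16) (1 - 1 / Suc n) b g" for n
    by (rule above_cong) (rule assms, auto intro: order_trans)
  have 2: "nonneg_on (13/16) (15/16) (flip (7/8) (1/16) f) = nonneg_on (13/16) (15/16) (flip (7/8) (1/16) g)"
    by (rule nonneg_on_cong) (rule fl, auto)
  show ?thesis unfolding future_event_def 1 2 by (simp add: fl)
qed

lemma past_event_flip_cong:
  assumes "\<And>r. r \<in> {1/4..13/16} \<Longrightarrow> f r = g r"
  shows "past_event b (flip (3/4) (1/16) f) = past_event b (flip (3/4) (1/16) g)"
proof -
  have "bump (3/4) (1/16) f = bump (3/4) (1/16) g" by (rule bump_cong) (use assms in auto)
  then show ?thesis by (intro past_event_cong flip_cong) (use assms in auto)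
qed

lemma future_event_flip_cong:
  assumes "\<And>r. r \<in> {13/16..1} \<Longrightarrow> f r = g r"
  shows "future_event b (flip (7/8) (1/16) f) = future_event b (flip (7/8) (1/16) g)"
proof -
  have "bump (7/8) (1/16) f = bump (7/8) (1/16) g" by (rule bump_cong) (use assms in auto)
  then show ?thesis by (intro future_event_cong flip_cong) (use assms in auto)
qed

lemma measurable_flip_process:
  fixes X :: "'a \<Rightarrow> real \<Rightarrow> real"
  assumes [measurable]: "(\<lambda>\<omega>. X \<omega> r) \<in> borel_measurable N" "(\<lambda>\<omega>. X \<omega> m) \<in> borel_measurable N"
    "(\<lambda>\<omega>. X \<omega> (m - w)) \<in> borel_measurable N" "(\<lambda>\<omega>. X \<omega> (m + w)) \<in> borel_measurable N"
  shows "(\<lambda>\<omega>. flip m w (X \<omega>) r) \<in> borel_measurable N"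
  unfolding flip_def bump_def by measurable

lemma measurable_past_event:
  fixes X :: "'a \<Rightarrow> real \<Rightarrow> real"
  assumes X: "\<And>r. r \<in> {0..13/16} \<Longrightarrow> (\<lambda>\<omega>. X \<omega> r) \<in> borel_measurable N"
  shows "{\<omega> \<in> space N. past_event b (X \<omega>)} \<in> sets N"
    and "{\<omega> \<in> space N. past_event b (flip (3/4) (1/16) (X \<omega>))} \<in> sets N"
proof -
  have main: "{\<omega> \<in> space N. past_event b (Y \<omega>)} \<in> sets N"
    if Y: "\<And>r. r \<in> {0..13/16} \<Longrightarrow> (\<lambda>\<omega>. Y \<omega> r) \<in> borel_measurable N" for Y :: "'a \<Rightarrow> real \<Rightarrow> real"
  proof -
    have F: "(\<lambda>\<omega>. flip (3/4) (1/16) (Y \<omega>) r) \<in> borel_measurable N" if "r \<in> {0..13/16}" for r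
      using that by (intro measurable_flip_process Y) auto
    have [measurable]: "(\<lambda>\<omega>. flip (3/4) (1/16) (Y \<omega>) (3/4)) \<in> borel_measurable N" by (rule F) simp
    have "{\<omega> \<in> space N. flip (3/4) (1/16) (Y \<omega>) (3/4) < b} \<in> sets N" by measurable
    then show ?thesis unfolding past_event_def
      by (intro sets.sets_Collect_conj measurable_above measurable_nonneg_on) (auto intro!: F Y)
  qed
  show "{\<omega> \<in> space N. past_event b (X \<omega>)} \<in> sets N" by (rule main[OF X])
  show "{\<omega> \<in> space N. past_event b (flip (3/4) (1/16) (X \<omega>))} \<in> sets N"
    by (rule main) (intro measurable_flip_process X, auto)
qed

lemma measurable_future_event:
  fixes X :: "'a \<Rightarrow> real \<Rightarrow> real"
  assumes X: "\<And>r. r \<in> {13/16..1} \<Longrightarrow> (\<lambda>\<omega>. X \<omega> r) \<in> borel_measurable N"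
  shows "{\<omega> \<in> space N. future_event b (X \<omega>)} \<in> sets N"
    and "{\<omega> \<in> space N. future_event b (flip (7/8) (1/16) (X \<omega>))} \<in> sets N"
proof -
  have main: "{\<omega> \<in> space N. future_event b (Y \<omega>)} \<in> sets N"
    if Y: "\<And>r. r \<in> {13/16..1} \<Longrightarrow> (\<lambda>\<omega>. Y \<omega> r) \<in> borel_measurable N" for Y :: "'a \<Rightarrow> real \<Rightarrow> real"
  proof -
    have F: "(\<lambda>\<omega>. flip (7/8) (1/16) (Y \<omega>) r) \<in> borel_measurable N" if "r \<in> {13/16..1}" for r
      using that by (intro measurable_flip_process Y) auto
    have [measurable]: "(\<lambda>\<omega>. flip (7/8) (1/16) (Y \<omega>) (7/8)) \<in> borel_measurable N" by (rule F) simp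
    have "{\<omega> \<in> space N. flip (7/8) (1/16) (Y \<omega>) (7/8) < b} \<in> sets N" by measurable
    moreover have "r \<le> 1" if "r \<le> 1 - 1 / (1 + real n)" for r n
      using that by (rule order_trans) simp
    ultimately show ?thesis unfolding future_event_def
      by (intro sets.sets_Collect_conj sets.sets_Collect_countable_All measurable_above measurable_nonneg_on)
        (auto intro!: F Y)
  qed
  show "{\<omega> \<in> space N. future_event b (X \<omega>)} \<in> sets N" by (rule main[OF X])
  show "{\<omega> \<in> space N. future_event b (flip (7/8) (1/16) (X \<omega>))} \<in> sets N"
    by (rule main) (intro measurable_flip_process X, auto)
qed

lemma future_event_above:
  assumes "future_event b g" "continuous_on {0..1} g" "r \<in> {13/16..<1}"
  shows "b < g r"
proof -
  obtain n where "1 / Suc n < 1 - r" using nat_approx_posE[of "1 - r"] assms(3) by auto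
  then have n: "r \<in> {13/16..1 - 1 / Suc n}" using assms(3) by auto
  moreover have "r < 1 - 1 / Suc n" using \<open>1 / Suc n < 1 - r\<close> by linarith
  moreover have "1 - 1 / real (Suc n) \<le> 1" by simp
  moreover have "continuous_on {13/16..1 - 1 / Suc n} g"
    by (rule continuous_on_subset[OF assms(2)]) auto
  moreover have "above (13/16) (1 - 1 / Suc n) b g" using assms(1) by (simp add: future_event_def)
  ultimately show ?thesis using assms(3) above_iff[of "13/16" "1 - 1 / Suc n" g b] by auto
qed

lemma past_event_above:
  assumes "past_event b g" "continuous_on {0..1} g" "r \<in> {1/4..13/16}"
  shows "b < g r"
proof -
  have "continuous_on {1/4..13/16} g" by (rule continuous_on_subset[OF assms(2)]) auto
  then show ?thesis using assms above_iff[of "1/4" "13/16" g b] by (auto simp: past_event_def)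
qed

lemma flip_nonneg_of_nonneg_on:
  assumes "nonneg_on p q (flip m w g)" "continuous_on {0..1} g" "p < q" "0 \<le> p" "q \<le> 1" "r \<in> {p..q}"
  shows "0 \<le> flip m w g r"
proof -
  have "continuous_on {p..q} (flip m w g)"
    by (rule continuous_on_flip, rule continuous_on_subset[OF assms(2)]) (use assms in auto)
  then show ?thesis using nonneg_on_iff[of p q "flip m w g"] assms by auto
qed

context
  fixes b :: real and L :: "(real \<Rightarrow> real) measure"
  assumes b: "0 < b" and L: "bridge_law b L"
begin

interpretation L: prob_space L using L by (simp add: bridge_law_def)

definition "path_event Q = {f \<in> space L. Q (vervaat f)}"

definition "early_event Q = {f \<in> space L. first_argmin f < 1/16 \<and> Q (vervaat f)}"

definition "window_event Q k = {f \<in> space L. first_argmin f \<in> {real k / 16..<real (Suc k) / 16} \<and> Q (vervaat f)}"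

lemma meas_first_argmin: "first_argmin \<in> borel_measurable L"
  using bridge_law_argmin(1)[OF L, of 1] by (simp add: first_argmin_eq_argmin_upto[abs_def])

lemma meas_vervaat: "(\<lambda>f. vervaat f t) \<in> borel_measurable L"
  by (rule borel_measurable_vervaat[where X = "\<lambda>f. f"])
    (auto intro!: measurable_bridge_law_eval[OF L] simp: bridge_law_space[OF L] bridge_paths_def)

text \<open>Shifts and flips control the transform only on \<open>[0,1]\<close>.\<close>

definition "admissible Q \<longleftrightarrow> (\<forall>f g. (\<forall>r\<in>{0..1::real}. f r = g r) \<longrightarrow> Q f = Q g) \<and> path_event Q \<in> sets L"

lemma admissibleD:
  assumes "admissible Q" "\<And>r. r \<in> {0..1} \<Longrightarrow> f r = g r" "Q g"
  shows "Q f"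
  using assms unfolding admissible_def by metis

lemma window_sets:
  assumes "path_event Q \<in> sets L"
  shows "window_event Q k \<in> sets L" and "early_event Q \<in> sets L"
proof -
  note [measurable] = meas_first_argmin assms
  have "{f \<in> space L. first_argmin f \<in> {real k / 16..<real (Suc k) / 16}} \<inter> path_event Q \<in> sets L"
    "{f \<in> space L. first_argmin f < 1/16} \<inter> path_event Q \<in> sets L" by measurable
  moreover have "{f \<in> space L. first_argmin f \<in> {real k / 16..<real (Suc k) / 16}} \<inter> path_event Q = window_event Q k"
    "{f \<in> space L. first_argmin f < 1/16} \<inter> path_event Q = early_event Q"
    by (auto simp: path_event_def early_event_def window_event_def)
  ultimately show "window_event Q k \<in> sets L" "early_event Q \<in> sets L"
    by (simp_all only:)
qed

lemma measure_le_transport: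
  assumes T: "T \<in> measurable L L" "distr L L T = L" and S: "S \<in> sets L"
    and sub: "\<And>f. f \<in> A \<Longrightarrow> f \<in> space L \<and> T f \<in> S"
  shows "measure L A \<le> measure L S"
proof -
  have "measure L A \<le> measure L (T -` S \<inter> space L)"
    using sub measurable_sets[OF T(1) S] by (intro L.finite_measure_mono) auto
  also have "\<dots> = measure L S" by (rule bridge_law_transport[OF L T(2,1) S])
  finally show ?thesis .
qed

lemma early_flip_le:
  assumes c: "3/4 \<le> c" "c \<le> 7/8" and Q: "admissible Q" "path_event (\<lambda>g. Q (flip c (1/16) g)) \<in> sets L"
    and nn: "\<And>f r. f \<in> space L \<Longrightarrow> Q (vervaat f) \<Longrightarrow> r \<in> {c - 1/16..c + 1/16} \<Longrightarrow> 0 \<le> flip c (1/16) (vervaat f) r"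
  shows "measure L (early_event Q) \<le> measure L (early_event (\<lambda>g. Q (flip c (1/16) g)))"
proof (rule measure_le_transport[OF measurable_delayed_flip[OF L c] distr_delayed_flip[OF L c] window_sets(2)[OF Q(2)]])
  fix f assume "f \<in> early_event Q"
  then have f: "f \<in> space L" "first_argmin f < 1/16" "Q (vervaat f)" by (auto simp: early_event_def)
  have fb: "f \<in> bridge_paths b" using f by (simp add: bridge_law_space[OF L])
  note d = delayed_flip_vervaat[OF fb b c f(2) nn[OF f(1,3)]]
  have 1: "bump c (1/16) (vervaat (delayed_flip c f)) = bump c (1/16) (flip c (1/16) (vervaat f))"
    by (rule bump_cong) (use d(2) c in auto)
  have "flip c (1/16) (vervaat (delayed_flip c f)) r = vervaat f r" if "r \<in> {0..1}" for r
  proof -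
    have "flip c (1/16) (vervaat (delayed_flip c f)) r = flip c (1/16) (flip c (1/16) (vervaat f)) r"
      using d(2)[OF _ that] 1 by (intro flip_cong) auto
    then show ?thesis by (simp add: flip_flip)
  qed
  then have "Q (flip c (1/16) (vervaat (delayed_flip c f)))" 
    using admissibleD[OF Q(1), of "flip c (1/16) (vervaat (delayed_flip c f))" "vervaat f"] f(3) by blast
  moreover have "delayed_flip c f \<in> space L"
    using measurable_space[OF measurable_delayed_flip[OF L c] f(1)] .
  ultimately show "f \<in> space L \<and> delayed_flip c f \<in> early_event (\<lambda>g. Q (flip c (1/16) g))"
    using f d(1) by (auto simp: early_event_def)
qed

text \<open>The random flip is an involution on the paths concerned, so one inequality applied to \<open>Q\<close> and to \<open>Q\<close> after a flip
  gives both directions. The hypothesis covers both because flipping twice is the identity.\<close>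

lemma early_flip_eq:
  assumes c: "3/4 \<le> c" "c \<le> 7/8" and Q: "admissible Q" "admissible (\<lambda>g. Q (flip c (1/16) g))"
    and nn: "\<And>f r. f \<in> space L \<Longrightarrow> Q (vervaat f) \<or> Q (flip c (1/16) (vervaat f)) \<Longrightarrow>
      r \<in> {c - 1/16..c + 1/16} \<Longrightarrow> 0 \<le> flip c (1/16) (vervaat f) r"
  shows "measure L (early_event Q) = measure L (early_event (\<lambda>g. Q (flip c (1/16) g)))"
proof (rule antisym)
  have Q2: "path_event (\<lambda>g. Q (flip c (1/16) g)) \<in> sets L" using Q(2) by (simp add: admissible_def)
  show "measure L (early_event Q) \<le> measure L (early_event (\<lambda>g. Q (flip c (1/16) g)))"
    by (rule early_flip_le[OF c Q(1) Q2]) (use nn in blast)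
  have ff: "flip c (1/16) (flip c (1/16) g) = g" for g by (rule ext) (simp add: flip_flip)
  have "path_event (\<lambda>g. Q (flip c (1/16) (flip c (1/16) g))) \<in> sets L"
    unfolding ff using Q(1) by (simp add: admissible_def)
  from early_flip_le[OF c Q(2) this] nn
  show "measure L (early_event (\<lambda>g. Q (flip c (1/16) g))) \<le> measure L (early_event Q)"
    unfolding ff by blast
qed

text \<open>Restarting the path at time \<open>k/16\<close> moves its minimiser into the first window.\<close>

lemma late_window_le:
  assumes Q: "admissible Q" and k: "k < (16::nat)"
  shows "measure L (window_event Q k) \<le> measure L (early_event Q)"
proof -
  have a: "0 \<le> real k / 16" "real k / 16 \<le> 1" using k by auto
  have Qs: "path_event Q \<in> sets L" using Q by (simp add: admissible_def)
  show ?thesis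
  proof (rule measure_le_transport[OF measurable_cyclic_shift[OF L a] distr_cyclic_shift[OF L a] window_sets(2)[OF Qs]])
    fix f assume "f \<in> window_event Q k"
    then have f: "f \<in> space L" "real k / 16 \<le> first_argmin f" "first_argmin f < real (Suc k) / 16" "Q (vervaat f)"
      by (auto simp: window_event_def)
    have fb: "f \<in> bridge_paths b" using f by (simp add: bridge_law_space[OF L])
    note s = shift_back_argmin[OF fb b a(1) f(2)]
    have "Q (vervaat (cyclic_shift b (k/16) f))" 
      using admissibleD[OF Q, of "vervaat (cyclic_shift b (k/16) f)" "vervaat f"] f(4) s(2) by blast
    then show "f \<in> space L \<and> cyclic_shift b (real k / 16) f \<in> early_event Q"
      using f s(1) measurable_space[OF measurable_cyclic_shift[OF L a] f(1)]
      by (simp add: early_event_def field_simps)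
  qed
qed

text \<open>The inverse shift is available when the transform exceeds \<open>b\<close> on \<open>[1/4, 1)\<close>: for \<open>k \<le> 11\<close> the piece that is moved
  to the front starts no earlier than \<open>1 - 11/16 - 1/16 = 1/4\<close> in the time of the transform.\<close>

lemma late_window_ge:
  assumes Q: "admissible Q" and k: "k < (12::nat)"
    and abv: "\<And>f r. f \<in> space L \<Longrightarrow> Q (vervaat f) \<Longrightarrow> r \<in> {1/4..<1} \<Longrightarrow> b < vervaat f r"
  shows "measure L (early_event Q) \<le> measure L (window_event Q k)"
proof (cases "k = 0")
  case True
  have "early_event Q = window_event Q k"
    using first_argmin_props(1)[OF _ b] by (auto simp: early_event_def window_event_def True bridge_law_space[OF L])
  then show ?thesis by simp
next
  case False
  have Qs: "path_event Q \<in> sets L" using Q by (simp add: admissible_def)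
  have a: "0 \<le> 1 - real k / 16" "1 - real k / 16 \<le> 1" using k by auto
  show ?thesis
  proof (rule measure_le_transport[OF measurable_cyclic_shift[OF L a] distr_cyclic_shift[OF L a] window_sets(1)[OF Qs]])
    fix f assume "f \<in> early_event Q"
    then have f: "f \<in> space L" "first_argmin f < 1/16" "Q (vervaat f)" by (auto simp: early_event_def)
    have fb: "f \<in> bridge_paths b" using f by (simp add: bridge_law_space[OF L])
    have k11: "real k / 16 \<le> 11/16" using k by simp
    have k0: "0 < real k / 16" "real k / 16 + first_argmin f < 1" using False f(2) k11 by auto
    note s = shift_forward_argmin[OF fb b k0 abv[OF f(1,3)]]
    have r: "r \<in> {1/4..<1}" if "r \<in> {1 - real k / 16 - first_argmin f..<1}" for r
      using that f(2) k11 unfolding atLeastLessThan_iff by linarith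
    have "Q (vervaat (cyclic_shift b (1 - k/16) f))" 
      using admissibleD[OF Q, of "vervaat (cyclic_shift b (1 - k/16) f)" "vervaat f"] f(3) s(2)[OF r] by blast
    then show "f \<in> space L \<and> cyclic_shift b (1 - real k / 16) f \<in> window_event Q k"
      using f s(1)[OF r] measurable_space[OF measurable_cyclic_shift[OF L a] f(1)] first_argmin_props(1)[OF fb b]
      by (simp add: window_event_def field_simps)
  qed
qed

lemma measure_windows:
  assumes Q: "path_event Q \<in> sets L"
    and S: "S = {f \<in> space L. first_argmin f < real n / 16 \<and> Q (vervaat f)}"
  shows "measure L S = (\<Sum>k<n. measure L (window_event Q k))"
proof -
  let ?W = "window_event Q"
  have "S = (\<Union>k\<in>{..<n}. ?W k)"
  proof (intro set_eqI iffI)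
    fix f assume f: "f \<in> S"
    then have t: "0 \<le> first_argmin f" "first_argmin f < real n / 16" "f \<in> space L" "Q (vervaat f)"
      using first_argmin_props(1)[OF _ b, of f] by (auto simp: S bridge_law_space[OF L])
    define k where "k = nat \<lfloor>16 * first_argmin f\<rfloor>"
    have "real k = of_int \<lfloor>16 * first_argmin f\<rfloor>" using t by (simp add: k_def)
    then have k: "real k \<le> 16 * first_argmin f" "16 * first_argmin f < real k + 1" by linarith+
    then have "k < n" using t(2) by linarith
    moreover have "f \<in> ?W k" using k t by (auto simp: window_event_def)
    ultimately show "f \<in> (\<Union>k\<in>{..<n}. ?W k)" by blast
  next
    fix f assume "f \<in> (\<Union>k\<in>{..<n}. ?W k)"
    then obtain k where k: "k < n" "f \<in> ?W k" by blast
    then have "real (Suc k) / 16 \<le> real n / 16" by simp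
    then show "f \<in> S" using k unfolding S window_event_def by auto
  qed
  moreover have "disjoint_family_on ?W {..<n}"
    unfolding disjoint_family_on_def
  proof (intro ballI impI)
    fix i j :: nat assume "i \<noteq> j"
    then have "real i + 1 \<le> real j \<or> real j + 1 \<le> real i" by linarith
    then show "?W i \<inter> ?W j = {}" by (auto simp: window_event_def)
  qed
  moreover have "?W ` {..<n} \<subseteq> sets L"
    by (rule image_subsetI) (rule window_sets(1)[OF Q])
  ultimately show ?thesis by (simp only: L.finite_measure_finite_Union finite_lessThan)
qed

lemma path_event_le:
  assumes Q: "admissible Q" and n: "n \<le> 16"
    and cover: "\<And>f. f \<in> space L \<Longrightarrow> Q (vervaat f) \<Longrightarrow> first_argmin f < real n / 16"
  shows "measure L (path_event Q) \<le> real n * measure L (early_event Q)"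
proof -
  have Qs: "path_event Q \<in> sets L" using Q by (simp add: admissible_def)
  have "path_event Q = {f \<in> space L. first_argmin f < real n / 16 \<and> Q (vervaat f)}"
    using cover by (auto simp: path_event_def)
  then have "measure L (path_event Q)
      = (\<Sum>k<n. measure L (window_event Q k))"
    by (rule measure_windows[OF Qs])
  also have "\<dots> \<le> (\<Sum>k<n. measure L (early_event Q))"
    using n by (intro sum_mono late_window_le[OF Q]) auto
  finally show ?thesis by simp
qed

lemma path_event_ge:
  assumes Q: "admissible Q"
    and abv: "\<And>f r. f \<in> space L \<Longrightarrow> Q (vervaat f) \<Longrightarrow> r \<in> {1/4..<1} \<Longrightarrow> b < vervaat f r"
  shows "12 * measure L (early_event Q) \<le> measure L (path_event Q)"
proof -
  have Qs: "path_event Q \<in> sets L" using Q by (simp add: admissible_def)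
  let ?S = "{f \<in> space L. first_argmin f < real 12 / 16 \<and> Q (vervaat f)}"
  have "12 * measure L (early_event Q) = (\<Sum>k<12::nat. measure L (early_event Q))" by simp
  also have "\<dots> \<le> (\<Sum>k<12. measure L (window_event Q k))"
    by (intro sum_mono late_window_ge[OF Q]) (use abv in auto)
  also have "\<dots> = measure L ?S"
    by (rule measure_windows[OF Qs refl, symmetric])
  also have "\<dots> \<le> measure L (path_event Q)"
    using Qs by (intro L.finite_measure_mono) (auto simp: path_event_def)
  finally show ?thesis .
qed

lemma admissible_cross:
  assumes S: "S \<in> sets borel"
    and Q: "Q = past_event b \<or> Q = (\<lambda>g. past_event b (flip (3/4) (1/16) g))"
    and R: "R = future_event b \<or> R = (\<lambda>g. future_event b (flip (7/8) (1/16) g))"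
  shows "admissible (\<lambda>g. Q g \<and> R g \<and> g (13/16) \<in> S)"
  unfolding admissible_def
proof (intro conjI allI impI)
  fix f g :: "real \<Rightarrow> real" assume e: "\<forall>r\<in>{0..1}. f r = g r"
  have "Q f = Q g" using Q e past_event_cong[of f g b] past_event_flip_cong[of f g b] by auto
  moreover have "R f = R g" using R e future_event_cong[of f g b] future_event_flip_cong[of f g b] by auto
  ultimately show "(Q f \<and> R f \<and> f (13/16) \<in> S) = (Q g \<and> R g \<and> g (13/16) \<in> S)" using e by auto
next
  have "path_event (past_event b) \<in> sets L" "path_event (\<lambda>g. past_event b (flip (3/4) (1/16) g)) \<in> sets L"
    unfolding path_event_def by (rule measurable_past_event; rule meas_vervaat)+
  moreover have "path_event (future_event b) \<in> sets L" "path_event (\<lambda>g. future_event b (flip (7/8) (1/16) g)) \<in> sets L"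
    unfolding path_event_def by (rule measurable_future_event; rule meas_vervaat)+
  moreover have "path_event (\<lambda>g. g (13/16) \<in> S) \<in> sets L"
    using measurable_sets[OF meas_vervaat S, of "13/16"]
    by (simp add: path_event_def vimage_def Int_def conj_commute)
  moreover have "path_event (\<lambda>g. Q g \<and> R g \<and> g (13/16) \<in> S)
      = path_event Q \<inter> path_event R \<inter> path_event (\<lambda>g. g (13/16) \<in> S)"
    by (auto simp: path_event_def)
  ultimately show "path_event (\<lambda>g. Q g \<and> R g \<and> g (13/16) \<in> S) \<in> sets L" using Q R by auto
qed

text \<open>The four early events have the common probability \<open>a\<close> by the two flips. The factors count the windows of
  length \<open>1/16\<close> in which the minimiser can lie: 12 windows are open to it if \<open>V > b\<close> on \<open>[1/4, 1)\<close>, while \<open>V\<^sub>t < b\<close> forces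
  \<open>\<tau> < 1 - t\<close>, since the transform is at least \<open>b\<close> after the cut; this leaves 4 windows for \<open>t = 3/4\<close>
  and 2 for \<open>t = 7/8\<close>.\<close>

lemma cross_bounds:
  assumes S: "S \<in> sets borel"
  defines "in_S \<equiv> \<lambda>g :: real \<Rightarrow> real. g (13/16) \<in> S"
  defines "P \<equiv> past_event b" and "P' \<equiv> \<lambda>g. past_event b (flip (3/4) (1/16) g)"
    and "F \<equiv> future_event b" and "F' \<equiv> \<lambda>g. future_event b (flip (7/8) (1/16) g)"
  defines "a \<equiv> measure L (early_event (\<lambda>g. P g \<and> F g \<and> in_S g))"
  shows "12 * a \<le> measure L (path_event (\<lambda>g. P g \<and> F g \<and> in_S g))"
    and "measure L (path_event (\<lambda>g. P' g \<and> F g \<and> in_S g)) \<le> 4 * a"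
    and "measure L (path_event (\<lambda>g. P g \<and> F' g \<and> in_S g)) \<le> 2 * a"
    and "a \<le> measure L (path_event (\<lambda>g. P' g \<and> F' g \<and> in_S g))"
    and "measure L (path_event (\<lambda>g. P g \<and> F g \<and> in_S g)) \<le> 16 * a"
proof -
  have cV: "continuous_on {0..1} (vervaat f)" if "f \<in> space L" for f
    using continuous_on_vervaat[OF _ b] that by (simp add: bridge_law_space[OF L])
  have congP: "P f = P g" "P' f = P' g" if "\<And>r. r \<in> {0..13/16} \<Longrightarrow> f r = g r" for f g
    unfolding P_def P'_def using that by (intro past_event_cong past_event_flip_cong; auto)+
  have congF: "F f = F g" "F' f = F' g" if "\<And>r. r \<in> {13/16..1} \<Longrightarrow> f r = g r" for f g
    unfolding F_def F'_def using that by (intro future_event_cong future_event_flip_cong; auto)+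
  have t1: "flip (3/4) (1/16) g r = g r" if "r \<in> {13/16..1}" for g r
    using that tent_eq_0[of "1/16" r "3/4"] by (simp add: flip_def)
  have t2: "flip (7/8) (1/16) g r = g r" if "r \<in> {0..13/16}" for g r
    using that tent_eq_0[of "1/16" r "7/8"] by (simp add: flip_def)
  have loc: "admissible (\<lambda>g. Q g \<and> R g \<and> in_S g)"
    if "Q = P \<or> Q = P'" "R = F \<or> R = F'" for Q R
    using admissible_cross[OF S, of Q R] that by (simp add: P_def P'_def F_def F'_def in_S_def)
  have flipP: "(P (flip (3/4) (1/16) g) \<and> R (flip (3/4) (1/16) g) \<and> in_S (flip (3/4) (1/16) g))
      = (P' g \<and> R g \<and> in_S g)" if "R = F \<or> R = F'" for R g
    using that congF[of "flip (3/4) (1/16) g" g] t1 by (auto simp: P_def P'_def in_S_def)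
  have flipF: "(Q (flip (7/8) (1/16) g) \<and> F (flip (7/8) (1/16) g) \<and> in_S (flip (7/8) (1/16) g))
      = (Q g \<and> F' g \<and> in_S g)" if "Q = P \<or> Q = P'" for Q g
    using that congP[of "flip (7/8) (1/16) g" g] t2 by (auto simp: F_def F'_def in_S_def)
  have cflip: "continuous_on {0..1} (flip m w (vervaat f))" if "f \<in> space L" for f m w
    using cV[OF that] by (rule continuous_on_flip)
  have "measure L (early_event (\<lambda>g. P g \<and> F g \<and> in_S g)) = measure L (early_event (\<lambda>g. P (flip (3/4) (1/16) g)
     \<and> F (flip (3/4) (1/16) g) \<and> in_S (flip (3/4) (1/16) g)))"
  proof (rule early_flip_eq)
    show "admissible (\<lambda>g. P g \<and> F g \<and> in_S g)" by (rule loc) auto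
    show "admissible (\<lambda>g. P (flip (3/4) (1/16) g) \<and> F (flip (3/4) (1/16) g) \<and> in_S (flip (3/4) (1/16) g))"
      by (subst flipP) (auto intro!: loc)
    fix f r assume f: "f \<in> space L" and r: "r \<in> {3/4 - 1/16..3/4 + 1/16::real}"
      and "(P (vervaat f) \<and> F (vervaat f) \<and> in_S (vervaat f)) \<or> (P (flip (3/4) (1/16) (vervaat f))
        \<and> F (flip (3/4) (1/16) (vervaat f)) \<and> in_S (flip (3/4) (1/16) (vervaat f)))"
    then consider "P (vervaat f)" | "P (flip (3/4) (1/16) (vervaat f))" by blast
    then show "0 \<le> flip (3/4) (1/16) (vervaat f) r"
    proof cases
      case 1
      then have "nonneg_on (11/16) (13/16) (flip (3/4) (1/16) (vervaat f))" by (simp add: P_def past_event_def)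
      then show ?thesis by (rule flip_nonneg_of_nonneg_on[OF _ cV[OF f]]) (use r in auto)
    next
      case 2
      then have "b < flip (3/4) (1/16) (vervaat f) r"
        unfolding P_def by (rule past_event_above[OF _ cflip[OF f]]) (use r in auto)
      then show ?thesis using b by simp
    qed
  qed auto
  then have e1: "measure L (early_event (\<lambda>g. P' g \<and> F g \<and> in_S g)) = a" by (simp add: a_def flipP)
  have e: "measure L (early_event (\<lambda>g. Q g \<and> F g \<and> in_S g)) = measure L (early_event (\<lambda>g. Q g \<and> F' g \<and> in_S g))"
    if Q: "Q = P \<or> Q = P'" for Q
  proof -
    have "measure L (early_event (\<lambda>g. Q g \<and> F g \<and> in_S g)) = measure L (early_event (\<lambda>g. Q (flip (7/8) (1/16) g)
       \<and> F (flip (7/8) (1/16) g) \<and> in_S (flip (7/8) (1/16) g)))"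
    proof (rule early_flip_eq)
      show "admissible (\<lambda>g. Q g \<and> F g \<and> in_S g)" by (rule loc) (use Q in auto)
      show "admissible (\<lambda>g. Q (flip (7/8) (1/16) g) \<and> F (flip (7/8) (1/16) g) \<and> in_S (flip (7/8) (1/16) g))"
        by (subst flipF[OF Q]) (use Q in \<open>auto intro!: loc\<close>)
      fix f r assume f: "f \<in> space L" and r: "r \<in> {7/8 - 1/16..7/8 + 1/16::real}"
        and "(Q (vervaat f) \<and> F (vervaat f) \<and> in_S (vervaat f)) \<or> (Q (flip (7/8) (1/16) (vervaat f))
          \<and> F (flip (7/8) (1/16) (vervaat f)) \<and> in_S (flip (7/8) (1/16) (vervaat f)))"
      then consider "F (vervaat f)" | "F (flip (7/8) (1/16) (vervaat f))" by blast
      then show "0 \<le> flip (7/8) (1/16) (vervaat f) r"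
      proof cases
        case 1
        then have "nonneg_on (13/16) (15/16) (flip (7/8) (1/16) (vervaat f))" by (simp add: F_def future_event_def)
        then show ?thesis by (rule flip_nonneg_of_nonneg_on[OF _ cV[OF f]]) (use r in auto)
      next
        case 2
        then have "b < flip (7/8) (1/16) (vervaat f) r"
          unfolding F_def by (rule future_event_above[OF _ cflip[OF f]]) (use r in auto)
        then show ?thesis using b by simp
      qed
    qed auto
    then show ?thesis by (simp add: flipF[OF Q])
  qed
  have e2: "measure L (early_event (\<lambda>g. P g \<and> F' g \<and> in_S g)) = a" using e[of P] by (simp add: a_def)
  have e3: "measure L (early_event (\<lambda>g. P' g \<and> F' g \<and> in_S g)) = a" using e[of P'] e1 by simp
  have cut: "first_argmin f < 1 - r" if f: "f \<in> space L" and r: "r \<in> {0..1}" "vervaat f r < b" for f r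
    using vervaat_above_after_cut[OF _ b r(1), of f] f r(2) by (force simp: bridge_law_space[OF L])
  have P'lt: "vervaat f (3/4) < b" if "P' (vervaat f)" for f
    using that by (simp add: P'_def past_event_def flip_flip)
  have F'lt: "vervaat f (7/8) < b" if "F' (vervaat f)" for f
    using that by (simp add: F'_def future_event_def flip_flip)
  show "12 * a \<le> measure L (path_event (\<lambda>g. P g \<and> F g \<and> in_S g))"
    unfolding a_def
  proof (rule path_event_ge[OF loc])
    fix f r assume f: "f \<in> space L" and Q: "P (vervaat f) \<and> F (vervaat f) \<and> in_S (vervaat f)" and r: "r \<in> {1/4..<1::real}"
    show "b < vervaat f r"
    proof (cases "r \<le> 13/16")
      case True
      then show ?thesis using Q r past_event_above[OF _ cV[OF f], of b r] by (auto simp: P_def)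
    next
      case False
      then show ?thesis using Q r future_event_above[OF _ cV[OF f], of b r] by (auto simp: F_def)
    qed
  qed auto
  have "measure L (path_event (\<lambda>g. P' g \<and> F g \<and> in_S g)) \<le> real 4 * measure L (early_event (\<lambda>g. P' g \<and> F g \<and> in_S g))"
    by (rule path_event_le[OF loc]) (use cut[of _ "3/4"] P'lt in force)+
  then show "measure L (path_event (\<lambda>g. P' g \<and> F g \<and> in_S g)) \<le> 4 * a" by (simp add: e1)
  have "measure L (path_event (\<lambda>g. P g \<and> F' g \<and> in_S g)) \<le> real 2 * measure L (early_event (\<lambda>g. P g \<and> F' g \<and> in_S g))"
    by (rule path_event_le[OF loc]) (use cut[of _ "7/8"] F'lt in force)+
  then show "measure L (path_event (\<lambda>g. P g \<and> F' g \<and> in_S g)) \<le> 2 * a" by (simp add: e2)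
  have "measure L (early_event (\<lambda>g. P' g \<and> F' g \<and> in_S g)) \<le> measure L (path_event (\<lambda>g. P' g \<and> F' g \<and> in_S g))"
    using loc[of P' F'] by (intro L.finite_measure_mono) (auto simp: admissible_def path_event_def early_event_def)
  then show "a \<le> measure L (path_event (\<lambda>g. P' g \<and> F' g \<and> in_S g))" by (simp add: e3)
  have "measure L (path_event (\<lambda>g. P g \<and> F g \<and> in_S g)) \<le> real 16 * measure L (early_event (\<lambda>g. P g \<and> F g \<and> in_S g))"
    by (rule path_event_le[OF loc]) (use first_argmin_props(2)[OF _ b] in \<open>auto simp: bridge_law_space[OF L]\<close>)
  then show "measure L (path_event (\<lambda>g. P g \<and> F g \<and> in_S g)) \<le> 16 * a" by (simp add: a_def)
qed

end

section \<open>Conditional independence of past and future\<close>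

definition future_algebra :: "'a measure \<Rightarrow> (real \<Rightarrow> 'a \<Rightarrow> real) \<Rightarrow> real \<Rightarrow> 'a measure" where
  "future_algebra M X s = sigma (space M) {{\<omega> \<in> space M. \<forall>t\<in>J. X t \<omega> \<in> C t} |J C.
     finite J \<and> J \<subseteq> {s..1} \<and> (\<forall>t\<in>J. C t \<in> sets borel)}"

lemma sets_future_algebra: "sets (future_algebra M X s) = sigma_sets (space M)
    {{\<omega> \<in> space M. \<forall>t\<in>J. X t \<omega> \<in> C t} |J C. finite J \<and> J \<subseteq> {s..1} \<and> (\<forall>t\<in>J. C t \<in> sets borel)}"
  unfolding future_algebra_def by (rule sets_measure_of) auto

lemma space_future_algebra [simp]: "space (future_algebra M X s) = space M"
  by (simp add: future_algebra_def space_measure_of_conv)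

lemma measurable_future_algebra:
  assumes "t \<in> {s..1}"
  shows "X t \<in> borel_measurable (future_algebra M X s)"
proof (rule measurableI)
  fix S :: "real set" assume S: "S \<in> sets borel"
  have "{\<omega> \<in> space M. \<forall>u\<in>{t}. X u \<omega> \<in> S} \<in> sets (future_algebra M X s)"
    unfolding sets_future_algebra
    by (rule sigma_sets.Basic) (use assms S in \<open>auto intro!: exI[of _ "{t}"] exI[of _ "\<lambda>_. S"]\<close>)
  moreover have "X t -` S \<inter> space (future_algebra M X s) = {\<omega> \<in> space M. \<forall>u\<in>{t}. X u \<omega> \<in> S}"
    by auto
  ultimately show "X t -` S \<inter> space (future_algebra M X s) \<in> sets (future_algebra M X s)" by simp
qed simp

lemma integrable_indicator_times:
  fixes f :: "'a \<Rightarrow> real"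
  assumes "integrable M f" "a \<in> sets M"
  shows "integrable M (\<lambda>x. indicator a x * f x)"
  using integrable_mult_indicator[OF assms(2,1)] by simp

text \<open>Test with the set on which the inequality fails; it belongs to \<open>G\<close>.\<close>

lemma real_cond_exp_le_of_set_integrals:
  fixes f g :: "'a \<Rightarrow> real"
  assumes "finite_measure_subalgebra M G" and fi [measurable]: "integrable M f" and gi [measurable]: "integrable M g"
    and le: "\<And>D. D \<in> sets G \<Longrightarrow> (\<integral>x\<in>D. f x \<partial>M) \<le> (\<integral>x\<in>D. g x \<partial>M)"
  shows "AE x in M. real_cond_exp M G f x \<le> real_cond_exp M G g x"
proof -
  interpret finite_measure_subalgebra M G by fact
  let ?f = "real_cond_exp M G f" and ?g = "real_cond_exp M G g"
  define D where "D = {x \<in> space G. ?g x < ?f x}"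
  have D: "D \<in> sets G" unfolding D_def by measurable
  then have DM [measurable]: "D \<in> sets M" using subalg by (auto simp: subalgebra_def)
  have ci: "integrable M ?f" "integrable M ?g" using fi gi by auto
  have hi: "integrable M (\<lambda>x. indicator D x * (?f x - ?g x))"
    using ci by (intro integrable_indicator_times Bochner_Integration.integrable_diff) auto
  have "(\<integral>x. indicator D x * (?f x - ?g x) \<partial>M) = (\<integral>x\<in>D. ?f x \<partial>M) - (\<integral>x\<in>D. ?g x \<partial>M)"
    unfolding set_lebesgue_integral_def using ci
    by (subst Bochner_Integration.integral_diff[symmetric]) (auto intro!: integrable_indicator_times simp: algebra_simps)
  also have "\<dots> \<le> 0" using le[OF D] real_cond_exp_intA[OF fi D] real_cond_exp_intA[OF gi D] by simp
  finally have le0: "(\<integral>x. indicator D x * (?f x - ?g x) \<partial>M) \<le> 0" .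
  have nn: "0 \<le> indicator D x * (?f x - ?g x)" for x by (auto simp: D_def indicator_def)
  then have "(\<integral>x. indicator D x * (?f x - ?g x) \<partial>M) = 0" using le0 by (intro antisym) auto
  then have "AE x in M. indicator D x * (?f x - ?g x) = 0"
    using integral_nonneg_eq_0_iff_AE[OF hi] nn by auto
  then show ?thesis using AE_space
  proof eventually_elim
    case (elim x)
    then show ?case using subalg by (auto simp: D_def indicator_def subalgebra_def split: if_splits)
  qed
qed

context
  fixes M :: "'a measure" and X :: "real \<Rightarrow> 'a \<Rightarrow> real"
  assumes M: "prob_space M" and X [measurable]: "\<And>t. t \<in> {0..1} \<Longrightarrow> X t \<in> borel_measurable M"
    and markov: "markov_process M {0..1} (induced_filtration M {0..1} X) X"
begin

interpretation prob_space M by (rule M)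

abbreviation (input) "past \<equiv> induced_filtration M {0..1} X"
abbreviation (input) "present t \<equiv> vimage_algebra (space M) (X t) borel"

lemma sets_past: "sets (past s) = sigma_sets (space M) (\<Union>u\<in>{u\<in>{0..1}. u \<le> s}. sets (present u))"
  unfolding induced_filtration_def by (rule sets_measure_of) (auto simp: sets_vimage_algebra2)

lemma space_past [simp]: "space (past s) = space M"
  by (simp add: induced_filtration_def space_measure_of_conv)

lemma sets_present: "sets (present t) = {X t -` A \<inter> space M |A. A \<in> sets borel}"
  by (rule sets_vimage_algebra2) auto

lemma present_sub_past: "t \<in> {0..1} \<Longrightarrow> t \<le> s \<Longrightarrow> sets (present t) \<subseteq> sets (past s)"
  unfolding sets_past by (auto intro!: sigma_sets.Basic)

lemma past_mono: "s \<le> t \<Longrightarrow> sets (past s) \<subseteq> sets (past t)"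
  unfolding sets_past by (rule sigma_sets_subseteq) auto

lemma subalgebra_present: "t \<in> {0..1} \<Longrightarrow> subalgebra M (present t)"
  unfolding subalgebra_def using measurable_sets[OF X] by (auto simp: sets_present)

lemma subalgebra_past: "subalgebra M (past s)"
  unfolding subalgebra_def
proof
  show "sets (past s) \<subseteq> sets M"
    unfolding sets_past
    by (rule sets.sigma_sets_subset) (use subalgebra_present in \<open>auto simp: subalgebra_def\<close>)
qed simp

lemma measurable_past: "t \<in> {0..1} \<Longrightarrow> t \<le> s \<Longrightarrow> X t \<in> borel_measurable (past s)"
proof (rule measurableI)
  fix A :: "real set" assume "t \<in> {0..1}" "t \<le> s" "A \<in> sets borel"
  then show "X t -` A \<inter> space (past s) \<in> sets (past s)"
    using present_sub_past[of t s] by (auto simp: sets_present)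
qed simp

lemma sub_past: "finite_measure_subalgebra M (past s)"
  by unfold_locales (rule subalgebra_past)

lemma sub_present: "t \<in> {0..1} \<Longrightarrow> finite_measure_subalgebra M (present t)"
  by unfold_locales (rule subalgebra_present)

text \<open>The Markov property in dual form: a past variable that is orthogonal to the present at time \<open>s\<close> is orthogonal to the
  present at every later time. In this form it can be iterated, because multiplying such a variable by an event of the
  later time \<open>t\<close> gives a past variable at time \<open>t\<close> that is orthogonal to the present at time \<open>t\<close>.\<close>

lemma markov_step:
  fixes Y :: "'a \<Rightarrow> real"
  assumes s: "s \<in> {0..1}" and t: "t \<in> {0..1}" "s \<le> t"
    and Y: "Y \<in> borel_measurable (past s)" and Yi: "integrable M Y"
    and orth: "\<And>D. D \<in> sets (present s) \<Longrightarrow> (\<integral>\<omega>\<in>D. Y \<omega> \<partial>M) = 0"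
    and A [measurable]: "A \<in> sets borel"
  shows "(\<integral>\<omega>. Y \<omega> * indicator A (X t \<omega>) \<partial>M) = 0"
proof -
  interpret F: finite_measure_subalgebra M "past s" by (rule sub_past)
  interpret G: finite_measure_subalgebra M "present s" by (rule sub_present[OF s])
  note [measurable] = X[OF t(1)]
  have YM [measurable]: "Y \<in> borel_measurable M" using Yi by auto
  define h where "h \<omega> = (indicator A (X t \<omega>) :: real)" for \<omega>
  have hM [measurable]: "h \<in> borel_measurable M" unfolding h_def[abs_def] by measurable
  have hi: "integrable M h" by (rule integrable_const_bound[where B = 1]) (auto simp: h_def)
  let ?hG = "real_cond_exp M (present s) h"
  have Yh: "integrable M (\<lambda>\<omega>. Y \<omega> * h \<omega>)"
    by (rule Bochner_Integration.integrable_bound[OF Yi]) (auto simp: h_def indicator_def)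
  have b1: "AE \<omega> in M. 0 \<le> ?hG \<omega>" by (rule G.real_cond_exp_pos) (auto simp: h_def)
  have b2: "AE \<omega> in M. ?hG \<omega> \<le> 1" by (rule G.real_cond_exp_le_c[OF hi]) (auto simp: h_def)
  have hGY: "integrable M (\<lambda>\<omega>. ?hG \<omega> * Y \<omega>)"
  proof (rule Bochner_Integration.integrable_bound[OF Yi])
    show "AE \<omega> in M. norm (?hG \<omega> * Y \<omega>) \<le> norm (Y \<omega>)"
      using b1 b2 by eventually_elim (auto simp: abs_mult intro: mult_left_le_one_le)
  qed measurable
  have zero: "AE \<omega> in M. real_cond_exp M (present s) Y \<omega> = 0"
    by (rule G.real_cond_exp_charact) (use orth Yi in \<open>auto simp: set_lebesgue_integral_def\<close>)
  have mk: "AE \<omega> in M. real_cond_exp M (past s) h \<omega> = ?hG \<omega>"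
    using markov s t A unfolding markov_process_def h_def by blast
  have "(\<integral>\<omega>. Y \<omega> * h \<omega> \<partial>M) = (\<integral>\<omega>. Y \<omega> * real_cond_exp M (past s) h \<omega> \<partial>M)"
    by (rule F.real_cond_exp_intg(2)[OF Yh Y hM, symmetric])
  also have "\<dots> = (\<integral>\<omega>. ?hG \<omega> * Y \<omega> \<partial>M)"
    by (rule integral_cong_AE) (use mk in \<open>auto simp: mult.commute\<close>)
  also have "\<dots> = (\<integral>\<omega>. ?hG \<omega> * real_cond_exp M (present s) Y \<omega> \<partial>M)"
    by (rule G.real_cond_exp_intg(2)[OF hGY _ YM, symmetric]) measurable
  also have "\<dots> = (\<integral>\<omega>. 0 \<partial>M)"
    by (rule integral_cong_AE) (use zero in auto)
  finally show ?thesis by (simp add: h_def)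
qed

lemma markov_finite_future:
  fixes Y :: "'a \<Rightarrow> real"
  assumes "finite J" "J \<subseteq> {s..1}" "s \<in> {0..1}"
    and "Y \<in> borel_measurable (past s)" "integrable M Y"
    and "\<And>D. D \<in> sets (present s) \<Longrightarrow> (\<integral>\<omega>\<in>D. Y \<omega> \<partial>M) = 0"
    and "\<And>t. t \<in> J \<Longrightarrow> C t \<in> sets borel"
  shows "(\<integral>\<omega>. Y \<omega> * (\<Prod>t\<in>J. indicator (C t) (X t \<omega>)) \<partial>M) = 0"
  using assms
proof (induction J arbitrary: s Y rule: finite_linorder_min_induct)
  case empty
  have "space M \<in> sets (present s)" using sets.top[of "present s"] by simp
  then show ?case using empty.prems(5)[of "space M"] by (simp add: set_integral_space[OF empty.prems(4)])
next
  case (insert t J)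
  have t: "t \<in> {0..1}" "s \<le> t" "s \<in> {0..1}" using insert.prems by auto
  have Ct [measurable]: "C t \<in> sets borel" using insert.prems by auto
  note [measurable] = X[OF t(1)]
  let ?Y = "\<lambda>\<omega>. Y \<omega> * indicator (C t) (X t \<omega>)"
  have tJ: "t \<notin> J" using insert.hyps by auto
  have "(\<integral>\<omega>. ?Y \<omega> * (\<Prod>u\<in>J. indicator (C u) (X u \<omega>)) \<partial>M) = 0"
  proof (rule insert.IH[of t])
    show "J \<subseteq> {t..1}"
    proof
      fix u assume u: "u \<in> J"
      then have "u \<in> {s..1}" using insert.prems(1) by blast
      then show "u \<in> {t..1}" using u insert.hyps by auto
    qed
    show "t \<in> {0..1}" by fact
    have "(\<lambda>\<omega>. indicator (C t) (X t \<omega>) :: real) \<in> borel_measurable (past t)"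
      by (rule measurable_compose[OF measurable_past[OF t(1)]]) auto
    moreover have "Y \<in> borel_measurable (past t)"
      using insert.prems(3) past_mono[OF t(2)]
      by (rule borel_measurable_subalgebra[rotated 2]) simp
    ultimately show "?Y \<in> borel_measurable (past t)" by (rule borel_measurable_times[rotated])
    show "integrable M ?Y"
      using insert.prems(4) by (rule Bochner_Integration.integrable_bound)
        (use insert.prems(4) in \<open>auto simp: indicator_def\<close>)
    fix D assume "D \<in> sets (present t)"
    then obtain A where A: "A \<in> sets borel" "D = X t -` A \<inter> space M" by (auto simp: sets_present)
    have "(\<integral>\<omega>\<in>D. ?Y \<omega> \<partial>M) = (\<integral>\<omega>. Y \<omega> * indicator (C t \<inter> A) (X t \<omega>) \<partial>M)"
      unfolding set_lebesgue_integral_def by (intro Bochner_Integration.integral_cong refl) (auto simp: A indicator_def)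
    also have "\<dots> = 0" by (rule markov_step[OF t(3,1,2) insert.prems(3,4,5)]) (use A in auto)
    finally show "(\<integral>\<omega>\<in>D. ?Y \<omega> \<partial>M) = 0" .
  qed (use insert.prems in auto)
  then show ?case using insert.hyps tJ by (simp add: mult.assoc)
qed

lemma sets_future_subset: "0 \<le> s \<Longrightarrow> sets (future_algebra M X s) \<subseteq> sets M"
  unfolding sets_future_algebra
proof (rule sets.sigma_sets_subset, rule subsetI)
  fix a assume s: "0 \<le> s" and "a \<in> {{\<omega> \<in> space M. \<forall>t\<in>J. X t \<omega> \<in> C t} |J C. finite J \<and> J \<subseteq> {s..1} \<and> (\<forall>t\<in>J. C t \<in> sets borel)}"
  then obtain J C where J: "finite J" "J \<subseteq> {s..1}" "\<forall>t\<in>J. C t \<in> sets (borel :: real measure)"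
    and a: "a = {\<omega> \<in> space M. \<forall>t\<in>J. X t \<omega> \<in> C t}" by blast
  show "a \<in> sets M" unfolding a
  proof (rule sets.sets_Collect_finite_All[OF _ J(1)])
    fix t assume "t \<in> J"
    then have "t \<in> {0..1}" "C t \<in> sets borel" using J s by auto
    from measurable_sets[OF X[OF this(1)] this(2)] show "{\<omega> \<in> space M. X t \<omega> \<in> C t} \<in> sets M"
      by (simp add: vimage_def Int_def conj_commute)
  qed
qed

lemma markov_future:
  fixes Y :: "'a \<Rightarrow> real"
  assumes s: "s \<in> {0..1}" and Y: "Y \<in> borel_measurable (past s)" "integrable M Y"
    and orth: "\<And>D. D \<in> sets (present s) \<Longrightarrow> (\<integral>\<omega>\<in>D. Y \<omega> \<partial>M) = 0"
    and Q: "Q \<in> sets (future_algebra M X s)"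
  shows "(\<integral>\<omega>\<in>Q. Y \<omega> \<partial>M) = 0"
proof -
  let ?E = "{{\<omega> \<in> space M. \<forall>t\<in>J. X t \<omega> \<in> C t} |J C. finite J \<and> J \<subseteq> {s..1} \<and> (\<forall>t\<in>J. C t \<in> sets (borel :: real measure))}"
  have sub: "sigma_sets (space M) ?E \<subseteq> sets M" using sets_future_subset s by (simp add: sets_future_algebra)
  have top: "(\<integral>\<omega>\<in>space M. Y \<omega> \<partial>M) = 0" by (rule orth) (use sets.top[of "present s"] in simp)
  have Yi: "set_integrable M a Y" if "a \<in> sets M" for a
    unfolding set_integrable_def using integrable_mult_indicator[OF that Y(2)] .
  have "?E \<subseteq> Pow (space M)" by auto
  from Int_stable_cylinders this Q[unfolded sets_future_algebra] show ?thesis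
  proof (induction rule: sigma_sets_induct_disjoint)
    case (basic a)
    then obtain J C where J: "finite J" "J \<subseteq> {s..1}" "\<And>t. t \<in> J \<Longrightarrow> C t \<in> sets (borel :: real measure)"
      and a: "a = {\<omega> \<in> space M. \<forall>t\<in>J. X t \<omega> \<in> C t}" by blast
    have "(\<Prod>t\<in>J. indicator (C t) (X t \<omega>)) = (indicator a \<omega> :: real)" if "\<omega> \<in> space M" for \<omega>
      using J(1) that by (auto simp: a indicator_def)
    then have "(\<integral>\<omega>\<in>a. Y \<omega> \<partial>M) = (\<integral>\<omega>. Y \<omega> * (\<Prod>t\<in>J. indicator (C t) (X t \<omega>)) \<partial>M)"
      unfolding set_lebesgue_integral_def by (intro Bochner_Integration.integral_cong refl) (simp add: mult.commute)
    then show ?case using markov_finite_future[OF J(1,2) s Y orth J(3)] by simp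
  next
    case empty
    then show ?case by (simp add: set_lebesgue_integral_def)
  next
    case (compl a)
    have aM: "a \<in> sets M" using compl sub by auto
    have "(\<integral>\<omega>\<in>space M. Y \<omega> \<partial>M) = (\<integral>\<omega>\<in>a \<union> (space M - a). Y \<omega> \<partial>M)"
      using sets.sets_into_space[OF aM] by (simp add: Un_absorb1)
    also have "\<dots> = (\<integral>\<omega>\<in>a. Y \<omega> \<partial>M) + (\<integral>\<omega>\<in>space M - a. Y \<omega> \<partial>M)"
      by (rule set_integral_Un) (use aM in \<open>auto intro!: Yi\<close>)
    finally show ?case using compl top by simp
  next
    case (union a)
    have aM: "a i \<in> sets M" for i using union sub by auto
    have "(\<integral>\<omega>\<in>(\<Union>i. a i). Y \<omega> \<partial>M) = (\<Sum>i. \<integral>\<omega>\<in>a i. Y \<omega> \<partial>M)"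
      by (rule lebesgue_integral_countable_add) (use aM union(1) in \<open>auto intro!: Yi simp: disjoint_family_on_def\<close>)
    then show ?case using union by simp
  qed
qed

lemma markov_past_future:
  assumes s: "s \<in> {0..1}" and P: "P \<in> sets (past s)" and Q: "Q \<in> sets (future_algebra M X s)"
  shows "AE \<omega> in M. real_cond_exp M (present s) (indicator (P \<inter> Q)) \<omega>
    = real_cond_exp M (present s) (indicator P) \<omega> * real_cond_exp M (present s) (indicator Q) \<omega>"
proof -
  interpret G: finite_measure_subalgebra M "present s" by (rule sub_present[OF s])
  have PM [measurable]: "P \<in> sets M" using P subalgebra_past by (auto simp: subalgebra_def)
  have QM [measurable]: "Q \<in> sets M" using Q sets_future_subset s by auto
  let ?p = "real_cond_exp M (present s) (indicator P)" and ?q = "real_cond_exp M (present s) (indicator Q)"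
  have ii: "integrable M (indicator a :: 'a \<Rightarrow> real)" if "a \<in> sets M" for a
    using that by (intro integrable_const_bound[where B = 1]) auto
  have pi: "integrable M ?p" using ii[OF PM] by auto
  have b: "AE \<omega> in M. 0 \<le> real_cond_exp M (present s) (indicator a) \<omega>"
    "AE \<omega> in M. real_cond_exp M (present s) (indicator a) \<omega> \<le> 1" if "a \<in> sets M" for a
    using that ii by (auto intro!: G.real_cond_exp_pos G.real_cond_exp_le_c[OF ii])
  \<comment> \<open>the deviation of a past event from its conditional probability is orthogonal to the present, hence to the future\<close>
  define Y where "Y \<omega> = indicator P \<omega> - ?p \<omega>" for \<omega>
  have sub: "sets (present s) \<subseteq> sets (past s)" using present_sub_past[of s s] s by simp
  have Ym: "Y \<in> borel_measurable (past s)"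
  proof -
    have "?p \<in> borel_measurable (past s)"
      by (rule borel_measurable_subalgebra[OF sub]) auto
    then show ?thesis unfolding Y_def[abs_def] using P by (intro borel_measurable_diff) auto
  qed
  have Yi: "integrable M Y" unfolding Y_def[abs_def] using ii[OF PM] pi by auto
  have si: "set_integrable M a f" if "a \<in> sets M" "integrable M f" for a and f :: "'a \<Rightarrow> real"
    unfolding set_integrable_def using integrable_mult_indicator[OF that] .
  have Yd: "(\<integral>\<omega>\<in>a. Y \<omega> \<partial>M) = (\<integral>\<omega>\<in>a. indicator P \<omega> \<partial>M) - (\<integral>\<omega>\<in>a. ?p \<omega> \<partial>M)" if "a \<in> sets M" for a
    unfolding Y_def using ii[OF PM] pi that by (intro set_integral_diff si)
  have orth: "(\<integral>\<omega>\<in>D. Y \<omega> \<partial>M) = 0" if "D \<in> sets (present s)" for D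
  proof -
    have "D \<in> sets M" using that G.subalg by (auto simp: subalgebra_def)
    then show ?thesis using G.real_cond_exp_intA[OF ii[OF PM] that] by (simp add: Yd)
  qed
  have pqi: "integrable M (\<lambda>\<omega>. ?p \<omega> * ?q \<omega>)"
  proof (rule Bochner_Integration.integrable_bound[OF pi])
    show "AE \<omega> in M. norm (?p \<omega> * ?q \<omega>) \<le> norm (?p \<omega>)"
      using b(1)[OF QM] b(2)[OF QM] by eventually_elim (auto simp: abs_mult intro: mult_right_le_one_le)
  qed measurable
  show ?thesis
  proof (rule G.real_cond_exp_charact)
    show "integrable M (indicator (P \<inter> Q) :: 'a \<Rightarrow> real)" by (rule ii) measurable
    show "integrable M (\<lambda>\<omega>. ?p \<omega> * ?q \<omega>)" by (rule pqi)
    show "(\<lambda>\<omega>. ?p \<omega> * ?q \<omega>) \<in> borel_measurable (present s)" by measurable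
    fix D assume D: "D \<in> sets (present s)"
    then have DM [measurable]: "D \<in> sets M" using G.subalg by (auto simp: subalgebra_def)
    obtain A where A: "A \<in> sets borel" "D = X s -` A \<inter> space M" using D by (auto simp: sets_present)
    have "D \<in> sets (future_algebra M X s)"
      using measurable_sets[OF measurable_future_algebra A(1), of s s X M] s A(2) by simp
    then have QD: "Q \<inter> D \<in> sets (future_algebra M X s)" using Q by auto
    have "(\<integral>\<omega>\<in>D. indicator (P \<inter> Q) \<omega> \<partial>M) = (\<integral>\<omega>\<in>Q \<inter> D. indicator P \<omega> \<partial>M)"
      unfolding set_lebesgue_integral_def by (intro Bochner_Integration.integral_cong refl) (auto simp: indicator_def)
    also have "\<dots> = (\<integral>\<omega>\<in>Q \<inter> D. ?p \<omega> \<partial>M)"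
      using markov_future[OF s Ym Yi orth QD] Yd[of "Q \<inter> D"] by simp
    also have "\<dots> = (\<integral>\<omega>. (indicator D \<omega> * ?p \<omega>) * indicator Q \<omega> \<partial>M)"
      unfolding set_lebesgue_integral_def by (intro Bochner_Integration.integral_cong refl) (auto simp: indicator_def)
    also have "\<dots> = (\<integral>\<omega>. (indicator D \<omega> * ?p \<omega>) * ?q \<omega> \<partial>M)"
    proof (rule G.real_cond_exp_intg(2)[symmetric])
      show "integrable M (\<lambda>\<omega>. indicator D \<omega> * ?p \<omega> * indicator Q \<omega>)"
        by (rule Bochner_Integration.integrable_bound[OF pi]) (auto simp: indicator_def)
      show "(\<lambda>\<omega>. indicator D \<omega> * ?p \<omega>) \<in> borel_measurable (present s)"
        using D by (intro borel_measurable_times) auto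
    qed measurable
    also have "\<dots> = (\<integral>\<omega>\<in>D. ?p \<omega> * ?q \<omega> \<partial>M)"
      unfolding set_lebesgue_integral_def by (simp add: mult.assoc)
    finally show "(\<integral>\<omega>\<in>D. indicator (P \<inter> Q) \<omega> \<partial>M) = (\<integral>\<omega>\<in>D. ?p \<omega> * ?q \<omega> \<partial>M)" .
  qed
qed

text \<open>Conditionally on the present, the probabilities of the four intersections factorise, so the two ways of pairing them
  have equal products. The bounds give \<open>12 \<alpha>\<^sup>2 \<le> 8 \<alpha>\<^sup>2\<close> for the conditional probability \<open>\<alpha>\<close> of \<open>A\<close>.\<close>

lemma markov_cross_ratio:
  assumes s: "s \<in> {0..1}" and P: "P \<in> sets (past s)" "P' \<in> sets (past s)"
    and Q: "Q \<in> sets (future_algebra M X s)" "Q' \<in> sets (future_algebra M X s)"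
    and A: "A \<in> sets M"
    and PQ: "\<And>D. D \<in> sets (present s) \<Longrightarrow> 12 * measure M (A \<inter> D) \<le> measure M (P \<inter> Q \<inter> D)"
    and P'Q: "\<And>D. D \<in> sets (present s) \<Longrightarrow> measure M (P' \<inter> Q \<inter> D) \<le> 4 * measure M (A \<inter> D)"
    and PQ': "\<And>D. D \<in> sets (present s) \<Longrightarrow> measure M (P \<inter> Q' \<inter> D) \<le> 2 * measure M (A \<inter> D)"
    and P'Q': "\<And>D. D \<in> sets (present s) \<Longrightarrow> measure M (A \<inter> D) \<le> measure M (P' \<inter> Q' \<inter> D)"
  shows "measure M A = 0"
proof -
  note G = sub_present[OF s]
  interpret G: finite_measure_subalgebra M "present s" by (rule G)
  have PM: "P \<in> sets M" "P' \<in> sets M" using P subalgebra_past by (auto simp: subalgebra_def)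
  have QM: "Q \<in> sets M" "Q' \<in> sets M" using Q sets_future_subset s by auto
  let ?e = "\<lambda>a. real_cond_exp M (present s) (indicator a)"
  have ii: "integrable M (indicator a :: 'a \<Rightarrow> real)" if "a \<in> sets M" for a
    using that by (intro integrable_const_bound[where B = 1]) auto
  have pos: "AE \<omega> in M. 0 \<le> ?e a \<omega>" if "a \<in> sets M" for a
    using that by (intro G.real_cond_exp_pos) auto
  have DM: "D \<in> sets M" if "D \<in> sets (present s)" for D using that G.subalg by (auto simp: subalgebra_def)
  have int: "(\<integral>\<omega>\<in>D. c * indicator a \<omega> \<partial>M) = c * measure M (a \<inter> D)"
    if "a \<in> sets M" "D \<in> sets (present s)" for a D and c :: real
  proof -
    have "(\<integral>\<omega>\<in>D. c * indicator a \<omega> \<partial>M) = c * (\<integral>\<omega>. indicator (a \<inter> D) \<omega> \<partial>M)"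
      unfolding set_lebesgue_integral_def
      by (subst integral_mult_right_zero[symmetric]) (intro Bochner_Integration.integral_cong refl, auto simp: indicator_def)
    then show ?thesis using that DM by simp
  qed
  have le: "AE \<omega> in M. c * ?e a \<omega> \<le> d * ?e a' \<omega>"
    if a: "a \<in> sets M" "a' \<in> sets M" and m: "\<And>D. D \<in> sets (present s) \<Longrightarrow> c * measure M (a \<inter> D) \<le> d * measure M (a' \<inter> D)"
    for a a' and c d :: real
  proof -
    have "AE \<omega> in M. real_cond_exp M (present s) (\<lambda>\<omega>. c * indicator a \<omega>) \<omega>
        \<le> real_cond_exp M (present s) (\<lambda>\<omega>. d * indicator a' \<omega>) \<omega>"
    proof (rule real_cond_exp_le_of_set_integrals[OF G])
      show "integrable M (\<lambda>\<omega>. c * indicator a \<omega>)" "integrable M (\<lambda>\<omega>. d * indicator a' \<omega>)"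
        using a ii by auto
      fix D assume D: "D \<in> sets (present s)"
      show "(\<integral>\<omega>\<in>D. c * indicator a \<omega> \<partial>M) \<le> (\<integral>\<omega>\<in>D. d * indicator a' \<omega> \<partial>M)"
        unfolding int[OF a(1) D] int[OF a(2) D] by (rule m[OF D])
    qed
    moreover have "AE \<omega> in M. real_cond_exp M (present s) (\<lambda>\<omega>. c * indicator a \<omega>) \<omega> = c * ?e a \<omega>"
      "AE \<omega> in M. real_cond_exp M (present s) (\<lambda>\<omega>. d * indicator a' \<omega>) \<omega> = d * ?e a' \<omega>"
      using a ii by auto
    ultimately show ?thesis by eventually_elim simp
  qed
  have "AE \<omega> in M. 12 * ?e A \<omega> \<le> 1 * ?e (P \<inter> Q) \<omega>" "AE \<omega> in M. 1 * ?e (P' \<inter> Q) \<omega> \<le> 4 * ?e A \<omega>"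
    "AE \<omega> in M. 1 * ?e (P \<inter> Q') \<omega> \<le> 2 * ?e A \<omega>" "AE \<omega> in M. 1 * ?e A \<omega> \<le> 1 * ?e (P' \<inter> Q') \<omega>"
    using A PM QM by (intro le; use PQ P'Q PQ' P'Q' in auto)+
  then have zero: "AE \<omega> in M. ?e A \<omega> = 0"
    using markov_past_future[OF s P(1) Q(1)] markov_past_future[OF s P(2) Q(1)]
      markov_past_future[OF s P(1) Q(2)] markov_past_future[OF s P(2) Q(2)]
      pos[OF A] pos[OF PM(1)] pos[OF PM(2)] pos[OF QM(1)] pos[OF QM(2)]
  proof eventually_elim
    case (elim \<omega>)
    define \<alpha> p p' q q' where "\<alpha> = ?e A \<omega>" and "p = ?e P \<omega>" and "p' = ?e P' \<omega>" and "q = ?e Q \<omega>" and "q' = ?e Q' \<omega>"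
    have h: "12 * \<alpha> \<le> p * q" "p' * q \<le> 4 * \<alpha>" "p * q' \<le> 2 * \<alpha>" "\<alpha> \<le> p' * q'" "0 \<le> \<alpha>" "0 \<le> p" "0 \<le> p'" "0 \<le> q" "0 \<le> q'"
      using elim by (simp_all add: \<alpha>_def p_def p'_def q_def q'_def)
    have "(12 * \<alpha>) * \<alpha> \<le> (p * q) * (p' * q')" by (rule mult_mono) (use h in auto)
    also have "\<dots> = (p' * q) * (p * q')" by (simp add: mult_ac)
    also have "\<dots> \<le> (4 * \<alpha>) * (2 * \<alpha>)" by (rule mult_mono) (use h in auto)
    finally have "4 * (\<alpha> * \<alpha>) \<le> 0" by simp
    then have "\<alpha> * \<alpha> = 0" using mult_nonneg_nonneg[OF h(5) h(5)] by linarith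
    then show ?case by (simp add: \<alpha>_def)
  qed
  have "measure M A = (\<integral>\<omega>. indicator A \<omega> \<partial>M)" using A by simp
  also have "\<dots> = (\<integral>\<omega>. ?e A \<omega> \<partial>M)" using G.real_cond_exp_int(2)[OF ii[OF A]] by simp
  also have "\<dots> = (\<integral>\<omega>. 0 \<partial>M)" by (rule integral_cong_AE) (use zero in auto)
  finally show ?thesis by simp
qed

end

section \<open>The law of a Brownian bridge as a law on paths\<close>

text \<open>In the degenerate case the formula holds with variance 0.\<close>

lemma gaussian_variable_char:
  assumes M: "prob_space M" and Y: "gaussian_variable M Y"
  shows "integrable M Y" "integrable M (\<lambda>\<omega>. (Y \<omega>)\<^sup>2)"
    and "(\<integral>\<omega>. iexp (Y \<omega>) \<partial>M)
      = iexp (\<integral>\<omega>. Y \<omega> \<partial>M) * of_real (exp (- (\<integral>\<omega>. (Y \<omega> - (\<integral>\<omega>. Y \<omega> \<partial>M))\<^sup>2 \<partial>M) / 2))"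
proof -
  interpret prob_space M by (rule M)
  have "integrable M Y \<and> integrable M (\<lambda>\<omega>. (Y \<omega>)\<^sup>2) \<and> (\<integral>\<omega>. iexp (Y \<omega>) \<partial>M)
      = iexp (\<integral>\<omega>. Y \<omega> \<partial>M) * of_real (exp (- (\<integral>\<omega>. (Y \<omega> - (\<integral>\<omega>. Y \<omega> \<partial>M))\<^sup>2 \<partial>M) / 2))"
    using Y unfolding gaussian_variable_def
  proof (elim disjE exE conjE)
    fix \<mu> \<sigma> :: real assume \<sigma>: "0 < \<sigma>" and D: "distributed M lborel Y (normal_density \<mu> \<sigma>)"
    have i1: "integrable M Y"
      using distributed_integrable[OF D, of "\<lambda>x. x"] integrable_normal_moment_nz_1[OF \<sigma>, of \<mu>] by simp
    have i2: "integrable M (\<lambda>\<omega>. (Y \<omega> - \<mu>)\<^sup>2)"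
      using distributed_integrable[OF D, of "\<lambda>x. (x - \<mu>)\<^sup>2"] integrable_normal_moment[OF \<sigma>, of \<mu> 2] by simp
    have "integrable M (\<lambda>\<omega>. (Y \<omega> - \<mu>)\<^sup>2 + 2 * \<mu> * Y \<omega> - \<mu>\<^sup>2)"
      using i1 i2 by auto
    moreover have "(\<lambda>\<omega>. (Y \<omega> - \<mu>)\<^sup>2 + 2 * \<mu> * Y \<omega> - \<mu>\<^sup>2) = (\<lambda>\<omega>. (Y \<omega>)\<^sup>2)"
      by (simp add: fun_eq_iff power2_eq_square algebra_simps)
    ultimately have i3: "integrable M (\<lambda>\<omega>. (Y \<omega>)\<^sup>2)" by simp
    have E: "expectation Y = \<mu>" "variance Y = \<sigma>\<^sup>2"
      by (rule normal_distributed_expectation[OF \<sigma> D], rule normal_distributed_variance[OF \<sigma> D])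
    define Z where "Z \<omega> = (Y \<omega> - \<mu>) / \<sigma>" for \<omega>
    have "distributed M lborel Z std_normal_density"
      unfolding Z_def[abs_def] using normal_standard_normal_convert[OF \<sigma>, of Y \<mu>] D by simp
    then have d: "distr M lborel Z = std_normal_distribution" and Zm [measurable]: "Z \<in> measurable M lborel"
      by (auto simp: distributed_def)
    have "(\<integral>\<omega>. iexp (Y \<omega>) \<partial>M) = (\<integral>\<omega>. iexp \<mu> * iexp (\<sigma> * Z \<omega>) \<partial>M)"
    proof (intro Bochner_Integration.integral_cong refl)
      fix \<omega>
      have "Y \<omega> = \<mu> + \<sigma> * Z \<omega>" using \<sigma> by (simp add: Z_def)
      then show "iexp (Y \<omega>) = iexp \<mu> * iexp (\<sigma> * Z \<omega>)" by (simp only: of_real_add distrib_left exp_add)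
    qed
    also have "\<dots> = iexp \<mu> * (\<integral>\<omega>. iexp (\<sigma> * Z \<omega>) \<partial>M)" by (rule integral_mult_right_zero)
    also have "(\<integral>\<omega>. iexp (\<sigma> * Z \<omega>) \<partial>M) = (\<integral>z. iexp (\<sigma> * z) \<partial>distr M lborel Z)"
      by (subst integral_distr[OF Zm]) simp_all
    also have "\<dots> = of_real (exp (- \<sigma>\<^sup>2 / 2))"
      unfolding d using fun_cong[OF char_std_normal_distribution, of \<sigma>] by (simp add: char_def)
    finally show ?thesis using i1 i3 E by simp
  next
    fix \<mu> assume Ym [measurable]: "Y \<in> borel_measurable M" and ae: "AE \<omega> in M. Y \<omega> = \<mu>"
    have i1: "integrable M Y" by (rule integrable_const_bound[where B = "\<bar>\<mu>\<bar>"]) (use ae in auto)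
    have i2: "integrable M (\<lambda>\<omega>. (Y \<omega>)\<^sup>2)" by (rule integrable_const_bound[where B = "\<mu>\<^sup>2"]) (use ae in auto)
    have E: "(\<integral>\<omega>. Y \<omega> \<partial>M) = (\<integral>\<omega>. \<mu> \<partial>M)" by (rule integral_cong_AE) (use ae in auto)
    have V: "(\<integral>\<omega>. (Y \<omega> - \<mu>)\<^sup>2 \<partial>M) = (\<integral>\<omega>. 0 \<partial>M)" by (rule integral_cong_AE) (use ae in auto)
    have C: "(\<integral>\<omega>. iexp (Y \<omega>) \<partial>M) = (\<integral>\<omega>. iexp \<mu> \<partial>M)" by (rule integral_cong_AE) (use ae in auto)
    show ?thesis using i1 i2 E V C by (simp add: prob_space)
  qed
  then show "integrable M Y" "integrable M (\<lambda>\<omega>. (Y \<omega>)\<^sup>2)"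
    "(\<integral>\<omega>. iexp (Y \<omega>) \<partial>M)
      = iexp (\<integral>\<omega>. Y \<omega> \<partial>M) * of_real (exp (- (\<integral>\<omega>. (Y \<omega> - (\<integral>\<omega>. Y \<omega> \<partial>M))\<^sup>2 \<partial>M) / 2))" by auto
qed

lemma integral_lin_comb:
  assumes "\<And>t. t \<in> fst ` set xs \<Longrightarrow> integrable M (Z t)"
  shows "integrable M (\<lambda>\<omega>. lin_comb xs (\<lambda>t. Z t \<omega>))"
    and "(\<integral>\<omega>. lin_comb xs (\<lambda>t. Z t \<omega>) \<partial>M) = lin_comb xs (\<lambda>t. \<integral>\<omega>. Z t \<omega> \<partial>M)"
proof -
  have "integrable M (\<lambda>\<omega>. lin_comb xs (\<lambda>t. Z t \<omega>)) \<and>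
    (\<integral>\<omega>. lin_comb xs (\<lambda>t. Z t \<omega>) \<partial>M) = lin_comb xs (\<lambda>t. \<integral>\<omega>. Z t \<omega> \<partial>M)"
    using assms
  proof (induction xs)
    case (Cons x xs)
    obtain t c where x: "x = (t, c)" by (cases x)
    have "integrable M (Z t)" using Cons.prems[of t] by (simp add: x)
    then show ?case using Cons by (simp add: x)
  qed simp
  then show "integrable M (\<lambda>\<omega>. lin_comb xs (\<lambda>t. Z t \<omega>))"
    "(\<integral>\<omega>. lin_comb xs (\<lambda>t. Z t \<omega>) \<partial>M) = lin_comb xs (\<lambda>t. \<integral>\<omega>. Z t \<omega> \<partial>M)" by auto
qed

lemma gaussian_variable_measurable: "gaussian_variable M Y \<Longrightarrow> Y \<in> borel_measurable M"
  by (auto simp: gaussian_variable_def distributed_def)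

context
  fixes M :: "'a measure" and b :: real and B :: "real \<Rightarrow> 'a \<Rightarrow> real"
  assumes M: "prob_space M" and B: "brownian_bridge M b B"
begin

interpretation prob_space M by (rule M)

lemma bridge_gaussian: "fst ` set xs \<subseteq> {0..1} \<Longrightarrow> gaussian_variable M (\<lambda>\<omega>. lin_comb xs (\<lambda>t. B t \<omega>))"
proof -
  assume xs: "fst ` set xs \<subseteq> {0..1}"
  obtain c where "\<And>f. lin_comb xs f = (\<Sum>t\<in>fst ` set xs. c t * f t)" using lin_comb_as_sum[of xs] by blast
  moreover have "gaussian_process M {0..1} B" using B by (simp add: brownian_bridge_def)
  ultimately show ?thesis using xs by (simp add: gaussian_process_def)
qed

lemma bridge_gaussian_single: "t \<in> {0..1} \<Longrightarrow> gaussian_variable M (B t)"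
  using bridge_gaussian[of "[(t, 1)]"] by simp

lemma bridge_measurable: "t \<in> {0..1} \<Longrightarrow> B t \<in> borel_measurable M"
  by (rule gaussian_variable_measurable[OF bridge_gaussian_single])

lemma bridge_centred_product:
  assumes st: "s \<in> {0..1}" "t \<in> {0..1}"
  shows "integrable M (\<lambda>\<omega>. (B s \<omega> - b * s) * (B t \<omega> - b * t))"
    and "(\<integral>\<omega>. (B s \<omega> - b * s) * (B t \<omega> - b * t) \<partial>M) = bridge_cov s t"
proof -
  have sq: "integrable M (\<lambda>\<omega>. (B t \<omega> - b * t)\<^sup>2)" if "t \<in> {0..1}" for t
  proof -
    note g = gaussian_variable_char(1,2)[OF M bridge_gaussian_single[OF that]]
    have "integrable M (\<lambda>\<omega>. (B t \<omega>)\<^sup>2 - 2 * b * t * B t \<omega> + (b * t)\<^sup>2)" using g by auto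
    then show ?thesis by (simp add: power2_eq_square algebra_simps)
  qed
  note [measurable] = bridge_measurable[OF st(1)] bridge_measurable[OF st(2)]
  show "integrable M (\<lambda>\<omega>. (B s \<omega> - b * s) * (B t \<omega> - b * t))"
  proof (rule Bochner_Integration.integrable_bound[OF Bochner_Integration.integrable_add[OF sq[OF st(1)] sq[OF st(2)]]])
    show "AE \<omega> in M. norm ((B s \<omega> - b * s) * (B t \<omega> - b * t)) \<le> norm ((B s \<omega> - b * s)\<^sup>2 + (B t \<omega> - b * t)\<^sup>2)"
    proof (rule AE_I2)
      fix \<omega>
      have "\<bar>x * y\<bar> \<le> x\<^sup>2 + y\<^sup>2" for x y :: real
      proof -
        have "0 \<le> (\<bar>x\<bar> - \<bar>y\<bar>)\<^sup>2" by simp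
        then have "2 * \<bar>x * y\<bar> \<le> x\<^sup>2 + y\<^sup>2" by (simp add: power2_eq_square abs_mult algebra_simps)
        then show ?thesis by simp
      qed
      then show "norm ((B s \<omega> - b * s) * (B t \<omega> - b * t)) \<le> norm ((B s \<omega> - b * s)\<^sup>2 + (B t \<omega> - b * t)\<^sup>2)" by simp
    qed
  qed measurable
  have c: "(\<integral>\<omega>. (B s \<omega> - b * s) * (B t \<omega> - b * t) \<partial>M) = s * (1 - t)" if "s \<in> {0..1}" "t \<in> {0..1}" "s \<le> t" for s t
    using B that unfolding brownian_bridge_def by blast
  show "(\<integral>\<omega>. (B s \<omega> - b * s) * (B t \<omega> - b * t) \<partial>M) = bridge_cov s t"
    using c[OF st] c[OF st(2,1)] by (cases "s \<le> t") (simp_all add: bridge_cov_def min_def mult.commute algebra_simps)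
qed

lemma bridge_char:
  assumes xs: "fst ` set xs \<subseteq> {0..1}"
  shows "(\<integral>\<omega>. iexp (lin_comb xs (\<lambda>t. B t \<omega>)) \<partial>M)
    = iexp (b * lin_comb xs (\<lambda>t. t)) * of_real (exp (- bridge_var xs / 2))"
proof -
  let ?Y = "\<lambda>\<omega>. lin_comb xs (\<lambda>t. B t \<omega>)"
  have mean: "(\<integral>\<omega>. B t \<omega> \<partial>M) = b * t" if "t \<in> {0..1}" for t using B that by (simp add: brownian_bridge_def)
  have E: "(\<integral>\<omega>. ?Y \<omega> \<partial>M) = b * lin_comb xs (\<lambda>t. t)"
  proof -
    have "(\<integral>\<omega>. ?Y \<omega> \<partial>M) = lin_comb xs (\<lambda>t. \<integral>\<omega>. B t \<omega> \<partial>M)"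
      by (rule integral_lin_comb(2)) (use xs gaussian_variable_char(1)[OF M bridge_gaussian_single] in blast)
    also have "\<dots> = lin_comb xs (\<lambda>t. b * t)" by (rule lin_comb_cong) (use mean xs in blast)
    finally show ?thesis by (simp add: lin_comb_cmult)
  qed
  have sq: "(?Y \<omega> - b * lin_comb xs (\<lambda>t. t))\<^sup>2
     = lin_comb xs (\<lambda>s. lin_comb xs (\<lambda>t. (B s \<omega> - b * s) * (B t \<omega> - b * t)))" for \<omega>
  proof -
    have "?Y \<omega> - b * lin_comb xs (\<lambda>t. t) = lin_comb xs (\<lambda>t. B t \<omega> - b * t)"
      by (simp add: lin_comb_diff lin_comb_cmult)
    moreover have "lin_comb xs (\<lambda>s. lin_comb xs (\<lambda>t. h s * h t)) = (lin_comb xs h)\<^sup>2" for h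
      unfolding lin_comb_cmult using lin_comb_cmult[of xs "lin_comb xs h" h] by (simp add: power2_eq_square mult.commute)
    ultimately show ?thesis by simp
  qed
  have "(\<integral>\<omega>. (?Y \<omega> - b * lin_comb xs (\<lambda>t. t))\<^sup>2 \<partial>M)
     = lin_comb xs (\<lambda>s. \<integral>\<omega>. lin_comb xs (\<lambda>t. (B s \<omega> - b * s) * (B t \<omega> - b * t)) \<partial>M)"
    unfolding sq
    by (intro integral_lin_comb(2) integral_lin_comb(1) bridge_centred_product(1)) (use xs in blast)+
  also have "\<dots> = bridge_var xs"
    unfolding bridge_var_def
  proof (rule lin_comb_cong)
    fix s assume s: "s \<in> fst ` set xs"
    have "(\<integral>\<omega>. lin_comb xs (\<lambda>t. (B s \<omega> - b * s) * (B t \<omega> - b * t)) \<partial>M)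
       = lin_comb xs (\<lambda>t. \<integral>\<omega>. (B s \<omega> - b * s) * (B t \<omega> - b * t) \<partial>M)"
      by (intro integral_lin_comb(2) bridge_centred_product(1)) (use xs s in blast)+
    also have "\<dots> = lin_comb xs (bridge_cov s)"
      by (intro lin_comb_cong bridge_centred_product(2)) (use xs s in blast)+
    finally show "(\<integral>\<omega>. lin_comb xs (\<lambda>t. (B s \<omega> - b * s) * (B t \<omega> - b * t)) \<partial>M) = lin_comb xs (bridge_cov s)" .
  qed
  finally have V: "(\<integral>\<omega>. (?Y \<omega> - b * lin_comb xs (\<lambda>t. t))\<^sup>2 \<partial>M) = bridge_var xs" .
  show ?thesis using gaussian_variable_char(3)[OF M bridge_gaussian[OF xs]] unfolding E V .
qed

lemma bridge_endpoint: "AE \<omega> in M. B 1 \<omega> = b"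
proof -
  have i: "integrable M (\<lambda>\<omega>. (B 1 \<omega> - b * 1) * (B 1 \<omega> - b * 1))"
    and "(\<integral>\<omega>. (B 1 \<omega> - b * 1) * (B 1 \<omega> - b * 1) \<partial>M) = 0"
    using bridge_centred_product[of 1 1] by (auto simp: bridge_cov_def)
  then have "AE \<omega> in M. (B 1 \<omega> - b * 1) * (B 1 \<omega> - b * 1) = 0"
    by (subst (asm) integral_nonneg_eq_0_iff_AE) auto
  then show ?thesis by eventually_elim simp
qed

text \<open>The end point equals \<open>b\<close> only almost surely; on the exceptional null set the path is replaced by a straight line so that
  every outcome gives an element of \<open>bridge_paths b\<close>.\<close>

definition "bridge_path \<omega> = (if B 1 \<omega> = b then (\<lambda>t. B t \<omega>) else (\<lambda>t. b * t))"

lemma AE_bridge_path: "AE \<omega> in M. bridge_path \<omega> = (\<lambda>t. B t \<omega>)"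
  using bridge_endpoint by eventually_elim (simp add: bridge_path_def)

lemma bridge_path_measurable: "bridge_path \<in> measurable M (path_space (bridge_paths b))"
proof (rule measurable_path_spaceI)
  show "bridge_path \<omega> \<in> bridge_paths b" if "\<omega> \<in> space M" for \<omega>
    using B that by (auto simp: bridge_path_def bridge_paths_def brownian_bridge_def intro!: continuous_intros)
  fix t :: real assume t: "t \<in> {0..1}"
  have [measurable]: "B 1 \<in> borel_measurable M" "B t \<in> borel_measurable M" using t by (auto intro!: bridge_measurable)
  have "(\<lambda>\<omega>. if B 1 \<omega> = b then B t \<omega> else b * t) \<in> borel_measurable M" by measurable
  then show "(\<lambda>\<omega>. bridge_path \<omega> t) \<in> borel_measurable M"
    by (simp add: bridge_path_def if_distrib[where f = "\<lambda>f. f t"] cong: if_cong)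
qed

lemma bridge_law_bridge_path: "bridge_law b (distr M (path_space (bridge_paths b)) bridge_path)"
  unfolding bridge_law_def
proof (intro conjI allI impI)
  note [measurable] = bridge_path_measurable
  show "prob_space (distr M (path_space (bridge_paths b)) bridge_path)" by (rule prob_space_distr) measurable
  show "sets (distr M (path_space (bridge_paths b)) bridge_path) = sets (path_space (bridge_paths b))" by simp
  fix xs :: "(real \<times> real) list" assume xs: "fst ` set xs \<subseteq> {0..1}"
  note [measurable] = measurable_lin_comb[OF xs]
  have Ym: "(\<lambda>\<omega>. lin_comb xs (\<lambda>t. B t \<omega>)) \<in> borel_measurable M"
    by (rule gaussian_variable_measurable[OF bridge_gaussian[OF xs]])
  have Xm: "(\<lambda>\<omega>. lin_comb xs (bridge_path \<omega>)) \<in> borel_measurable M" by measurable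
  have "(\<integral>f. iexp (lin_comb xs f) \<partial>distr M (path_space (bridge_paths b)) bridge_path)
     = (\<integral>\<omega>. iexp (lin_comb xs (bridge_path \<omega>)) \<partial>M)"
    by (rule integral_distr) measurable
  also have "\<dots> = (\<integral>\<omega>. iexp (lin_comb xs (\<lambda>t. B t \<omega>)) \<partial>M)"
    using AE_bridge_path by (intro integral_cong_AE) (use Xm Ym in auto)
  finally show "(\<integral>f. iexp (lin_comb xs f) \<partial>distr M (path_space (bridge_paths b)) bridge_path)
     = iexp (b * lin_comb xs (\<lambda>t. t)) * of_real (exp (- bridge_var xs / 2))"
    by (simp only: bridge_char[OF xs])
qed

end

section \<open>Positive probability and the conclusion\<close>

text \<open>The minimum is at \<open>7/8\<close>, so the transform spends the time from \<open>1/8\<close> to \<open>15/16\<close> at height \<open>3 b / 2\<close> apart from two hats of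
  height \<open>b\<close>, centred at \<open>3/4\<close> and \<open>7/8\<close>. Flipping a hat turns its peak \<open>5 b / 2\<close> into a trough \<open>b / 2\<close>, which is
  below \<open>b\<close> and positive, as the past and future events require.\<close>

definition target_path :: "real \<Rightarrow> real \<Rightarrow> real" where
  "target_path b x = b * (tent (5/8) (1/16) x + tent (3/4) (1/16) x - tent (7/8) (1/16) x / 2 + tent 1 (1/16) x)"

lemma tent_Lipschitz: "0 < w \<Longrightarrow> \<bar>tent m w x - tent m w y\<bar> \<le> \<bar>x - y\<bar> / w"
proof -
  assume w: "0 < w"
  have "\<bar>max 0 (1 - u) - max 0 (1 - v)\<bar> \<le> \<bar>u - v\<bar>" for u v :: real by auto
  then have "\<bar>tent m w x - tent m w y\<bar> \<le> \<bar>\<bar>x - m\<bar> / w - \<bar>y - m\<bar> / w\<bar>" by (simp add: tent_def)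
  also have "\<dots> = \<bar>\<bar>x - m\<bar> - \<bar>y - m\<bar>\<bar> / w" using w by (simp add: diff_divide_distrib[symmetric])
  also have "\<dots> \<le> \<bar>x - y\<bar> / w" using w by (intro divide_right_mono) auto
  finally show ?thesis .
qed

lemma target_path_in_bridge_paths: "target_path b \<in> bridge_paths b"
  by (auto simp: bridge_paths_def target_path_def tent_def intro!: continuous_intros)

lemma above_antimono: "above p q c g \<Longrightarrow> q' \<le> q \<Longrightarrow> above p q' c g"
  unfolding above_def by (meson IntD1 IntD2 IntI atLeastAtMost_iff order_trans)

text \<open>The target path rises from its minimum with slope at least \<open>8 b\<close>, so in a tube of radius \<open>b / 256\<close> the minimiser is
  within \<open>1/1024\<close> of \<open>7/8\<close>. Since the hats have slope \<open>16 b\<close>, the transform then differs from that of the target path by at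
  most \<open>3 b / 64\<close>, and all inequalities have room for this. That the transform exceeds \<open>b\<close> near time 1 does not follow from
  closeness but from strict minimality of \<open>f \<tau>\<close> on \<open>[0, \<tau>)\<close>.\<close>

lemma vervaat_near_target:
  assumes f: "f \<in> bridge_paths b" and b: "0 < b"
    and near: "\<And>t. t \<in> {0..1} \<Longrightarrow> \<bar>f t - target_path b t\<bar> \<le> b / 256"
  shows "past_event b (vervaat f)" "future_event b (vervaat f)"
proof -
  note p = first_argmin_props[OF f b]
  define \<tau> where "\<tau> = first_argmin f"
  have \<tau>01: "0 \<le> \<tau>" "\<tau> < 1" using p by (auto simp: \<tau>_def)
  have tb: "0 \<le> tent m (1/16) x" "tent m (1/16) x \<le> 1" for m x by (simp_all add: tent_bounds)
  have f78: "target_path b (7/8) = - (b / 2)" by (simp add: target_path_def tent_def)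
  have f\<tau>: "f \<tau> \<le> - (b / 2) + b / 256"
  proof -
    have "f \<tau> \<le> f (7/8)" using p(3)[of "7/8"] by (simp add: \<tau>_def)
    moreover have "\<bar>f (7/8) - target_path b (7/8)\<bar> \<le> b / 256" by (rule near) simp
    ultimately show ?thesis unfolding f78 abs_le_iff by linarith
  qed
  have lower: "- (b * tent (7/8) (1/16) x) / 2 \<le> target_path b x" for x
  proof -
    have "- (1 / 2) * tent (7/8) (1/16) x \<le> tent (5/8) (1/16) x + tent (3/4) (1/16) x - tent (7/8) (1/16) x / 2 + tent 1 (1/16) x"
      using tb[of "5/8" x] tb[of "3/4" x] tb[of 1 x] by linarith
    from mult_left_mono[OF this, of b] b show ?thesis by (simp add: target_path_def algebra_simps)
  qed
  have near\<tau>: "\<bar>f \<tau> - target_path b \<tau>\<bar> \<le> b / 256" by (rule near) (use \<tau>01 in auto)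
  have "b * (63 / 64) \<le> b * tent (7/8) (1/16) \<tau>"
    using lower[of \<tau>] near\<tau> f\<tau> unfolding abs_le_iff by linarith
  then have "63 / 64 \<le> tent (7/8) (1/16) \<tau>" by (rule mult_left_le_imp_le) (rule b)
  then have close: "\<bar>\<tau> - 7/8\<bar> \<le> 1/1024" by (simp add: tent_def max_def split: if_splits)
  then have \<tau>b: "7/8 - 1/1024 \<le> \<tau>" "\<tau> \<le> 7/8 + 1/1024" unfolding abs_le_iff by linarith+
  have f\<tau>': "- (b / 2) - b / 256 \<le> f \<tau>"
  proof -
    have "b * tent (7/8) (1/16) \<tau> \<le> b * 1" using tb b by (intro mult_left_mono) auto
    then show ?thesis using lower[of \<tau>] near\<tau> unfolding abs_le_iff by linarith
  qed
  have V: "vervaat f r = f (\<tau> + r - 1) + b - f \<tau>" if "r \<in> {0..1}" "1 < \<tau> + r" for r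
    using vervaat_eq_cyclic_shift[OF f b that(1)] that(2) by (simp add: cyclic_shift_def \<tau>_def)
  have cV: "continuous_on {0..1} (vervaat f)" by (rule continuous_on_vervaat[OF f b])
  have gt: "b < vervaat f r" if "r \<in> {1/4..<1}" for r
  proof -
    have "1 < \<tau> + r" using that \<tau>b by auto
    then show ?thesis using V[of r] p(4)[of "\<tau> + r - 1"] that by (simp add: \<tau>_def)
  qed
  define T1 T2 where "T1 = tent (3/4) (1/16)" and "T2 = tent (7/8) (1/16)"
  have est: "\<bar>vervaat f r - (3/2 * b + b * (T1 r + T2 r))\<bar> \<le> 3/64 * b" if r: "r \<in> {11/16..15/16}" for r
  proof -
    define x where "x = \<tau> + r - 1"
    have x: "x \<in> {0..1}" "1 < \<tau> + r" "\<bar>x - (r - 1/8)\<bar> \<le> 1/1024" "x \<le> 13/16 + 1/1024"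
      using r \<tau>b close by (auto simp: x_def)
    have L: "\<bar>tent m (1/16) x - tent m (1/16) y\<bar> \<le> 1/64" if "\<bar>x - y\<bar> \<le> 1/1024" for m y
      using tent_Lipschitz[of "1/16" m x y] that by simp
    have t1: "tent (5/8) (1/16) (r - 1/8) = T1 r" and t2: "tent (3/4) (1/16) (r - 1/8) = T2 r"
      by (simp_all add: T1_def T2_def tent_def)
    have z1: "tent 1 (1/16) x = 0" using x by (intro tent_eq_0) auto
    have z7: "tent (7/8) (1/16) x \<le> 1/64" using x(4) by (auto simp add: tent_def max_def)
    have u: "\<bar>(tent (5/8) (1/16) x + tent (3/4) (1/16) x - tent (7/8) (1/16) x / 2 + tent 1 (1/16) x) - (T1 r + T2 r)\<bar> \<le> 5/128"
      using L[OF x(3), of "5/8"] L[OF x(3), of "3/4"] z1 z7 tb(1)[of "7/8" x] unfolding t1 t2 abs_le_iff by linarith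
    have "target_path b x - b * (T1 r + T2 r) = b * ((tent (5/8) (1/16) x + tent (3/4) (1/16) x - tent (7/8) (1/16) x / 2 + tent 1 (1/16) x) - (T1 r + T2 r))"
      by (simp add: target_path_def right_diff_distrib)
    then have "\<bar>target_path b x - b * (T1 r + T2 r)\<bar> \<le> b * (5/128)"
      using u b by (simp add: abs_mult)
    moreover have "vervaat f r = f x + b - f \<tau>" using V[of r] x r by (simp add: x_def)
    ultimately show ?thesis using near[OF x(1)] f\<tau> f\<tau>' unfolding abs_le_iff by linarith
  qed
  have cab: "above (1/4) (13/16) b (vervaat f)"
  proof (subst above_iff)
    show "continuous_on {1/4..13/16} (vervaat f)" by (rule continuous_on_subset[OF cV]) auto
  qed (use gt in auto)
  have fab: "above (13/16) (1 - 1 / Suc n) b (vervaat f)" for n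
  proof -
    let ?q = "max (15/16) (1 - 1 / real (Suc n))"
    have q: "?q < 1" by simp
    have "above (13/16) ?q b (vervaat f)"
    proof (subst above_iff)
      show "continuous_on {13/16..?q} (vervaat f)"
        by (rule continuous_on_subset[OF cV]) (use q in auto)
      show "(13/16::real) < ?q" by (simp add: less_max_iff_disj)
      show "\<forall>r\<in>{13/16..?q}. b < vervaat f r"
      proof
        fix r assume "r \<in> {13/16..?q}"
        then have "13/16 \<le> r" "r < 1" using q unfolding atLeastAtMost_iff by linarith+
        then show "b < vervaat f r" by (intro gt) auto
      qed
    qed
    then show ?thesis by (rule above_antimono) simp
  qed
  have vals: "T1 (11/16) = 0" "T2 (11/16) = 0" "T1 (3/4) = 1" "T2 (3/4) = 0" "T1 (13/16) = 0" "T2 (13/16) = 0"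
    "T1 (7/8) = 0" "T2 (7/8) = 1" "T1 (15/16) = 0" "T2 (15/16) = 0"
    by (simp_all add: T1_def T2_def tent_def)
  have e: "\<bar>vervaat f (11/16) - 3/2 * b\<bar> \<le> 3/64 * b" "\<bar>vervaat f (3/4) - 5/2 * b\<bar> \<le> 3/64 * b"
    "\<bar>vervaat f (13/16) - 3/2 * b\<bar> \<le> 3/64 * b" "\<bar>vervaat f (7/8) - 5/2 * b\<bar> \<le> 3/64 * b"
    "\<bar>vervaat f (15/16) - 3/2 * b\<bar> \<le> 3/64 * b"
    using est[of "11/16"] est[of "3/4"] est[of "13/16"] est[of "7/8"] est[of "15/16"] by (simp_all add: vals)
  have center: "flip m w g m = g (m - w) + g (m + w) - g m" for m w g
    by (simp add: flip_def bump_def field_simps)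
  have "flip (3/4) (1/16) (vervaat f) (3/4) = vervaat f (11/16) + vervaat f (13/16) - vervaat f (3/4)"
    "flip (7/8) (1/16) (vervaat f) (7/8) = vervaat f (13/16) + vervaat f (15/16) - vervaat f (7/8)"
    by (simp_all add: center)
  then have c1: "flip (3/4) (1/16) (vervaat f) (3/4) < b" and c2: "flip (7/8) (1/16) (vervaat f) (7/8) < b"
    using e b unfolding abs_le_iff by linarith+
  have nn: "0 \<le> flip m (1/16) (vervaat f) r"
    if r: "r \<in> {11/16..15/16}" and bu: "bump m (1/16) (vervaat f) \<le> b * (35/32)"
      and T: "tent m (1/16) r \<le> T1 r + T2 r" for m r
  proof -
    let ?t = "tent m (1/16) r"
    have "bump m (1/16) (vervaat f) * ?t \<le> b * (35/32) * ?t" using bu tb by (intro mult_right_mono) auto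
    moreover have "b * ?t \<le> b * (T1 r + T2 r)" using T b by (intro mult_left_mono) auto
    moreover have "b * ?t \<le> b * 1" using tb b by (intro mult_left_mono) auto
    moreover have "flip m (1/16) (vervaat f) r = vervaat f r - 2 * (bump m (1/16) (vervaat f) * ?t)"
      by (simp add: flip_def)
    ultimately show ?thesis using est[OF r] b unfolding abs_le_iff by linarith
  qed
  have "2 * bump (3/4) (1/16) (vervaat f) = 2 * vervaat f (3/4) - vervaat f (11/16) - vervaat f (13/16)"
    "2 * bump (7/8) (1/16) (vervaat f) = 2 * vervaat f (7/8) - vervaat f (13/16) - vervaat f (15/16)"
    by (simp_all add: bump_def field_simps)
  then have b1: "bump (3/4) (1/16) (vervaat f) \<le> b * (35/32)" and b2: "bump (7/8) (1/16) (vervaat f) \<le> b * (35/32)"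
    using e b unfolding abs_le_iff by linarith+
  have "nonneg_on (11/16) (13/16) (flip (3/4) (1/16) (vervaat f))"
    unfolding nonneg_on_def
    by (intro ballI nn[OF _ b1]) (use tb[of "7/8"] in \<open>auto simp: T1_def T2_def\<close>)
  then show "past_event b (vervaat f)" using cab c1 by (simp add: past_event_def)
  have "nonneg_on (13/16) (15/16) (flip (7/8) (1/16) (vervaat f))"
    unfolding nonneg_on_def
    by (intro ballI nn[OF _ b2]) (use tb[of "3/4"] in \<open>auto simp: T1_def T2_def\<close>)
  then show "future_event b (vervaat f)" using fab c2 by (simp add: future_event_def)
qed

theorem corollary3p3:
  fixes M :: "'a measure" and b :: real and B V :: "real \<Rightarrow> 'a \<Rightarrow> real"
  assumes "prob_space M"
    and "b > 0"
    and "brownian_bridge M b B"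
  defines "V \<equiv> \<lambda>t \<omega>. vervaat (\<lambda>u. B u \<omega>) t"
  shows "\<not> markov_process M {0..1} (induced_filtration M {0..1} V) V"
proof
  assume markov: "markov_process M {0..1} (induced_filtration M {0..1} V) V"
  interpret prob_space M by fact
  note M = assms(1) and b = assms(2) and B = assms(3)
  define X where "X = bridge_path b B"
  define L where "L = distr M (path_space (bridge_paths b)) X"
  have Xm [measurable]: "X \<in> measurable M (path_space (bridge_paths b))"
    unfolding X_def by (rule bridge_path_measurable[OF M B])
  have L: "bridge_law b L" unfolding L_def X_def by (rule bridge_law_bridge_path[OF M B])
  have sL: "sets L = sets (path_space (bridge_paths b))" by (simp add: L_def)
  have XV: "AE \<omega> in M. vervaat (X \<omega>) = (\<lambda>t. V t \<omega>)"
    using AE_bridge_path[OF M B] by eventually_elim (simp add: X_def V_def)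
  have Vm: "V t \<in> borel_measurable M" for t
    unfolding V_def
    by (rule borel_measurable_vervaat[where X = "\<lambda>\<omega> u. B u \<omega>"])
      (use bridge_measurable[OF M B] B in \<open>auto simp: brownian_bridge_def\<close>)
  let ?s = "13/16 :: real"
  let ?past = "induced_filtration M {0..1} V" and ?present = "vimage_algebra (space M) (V ?s) borel"
  define P where "P = past_event b"
  define P' where "P' g = past_event b (flip (3/4) (1/16) g)" for g
  define F where "F = future_event b"
  define F' where "F' g = future_event b (flip (7/8) (1/16) g)" for g
  let ?ev = "\<lambda>Q. {\<omega> \<in> space M. Q (\<lambda>t. V t \<omega>)}"
  have s: "?s \<in> {0..1}" by simp
  have P: "?ev P \<in> sets (?past ?s)" "?ev P' \<in> sets (?past ?s)"
    using measurable_past_event[where N = "?past ?s" and X = "\<lambda>\<omega> t. V t \<omega>"] measurable_past[OF M Vm markov]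
    by (auto simp: P_def P'_def space_past[OF M Vm markov])
  have F: "?ev F \<in> sets (future_algebra M V ?s)" "?ev F' \<in> sets (future_algebra M V ?s)"
    using measurable_future_event[where N = "future_algebra M V ?s" and X = "\<lambda>\<omega> t. V t \<omega>"]
      measurable_future_algebra[of _ ?s V M]
    by (auto simp: F_def F'_def)
  have sub: "sets ?present \<subseteq> sets M" "sets (?past ?s) \<subseteq> sets M" "sets (future_algebra M V ?s) \<subseteq> sets M"
    using subalgebra_present[OF M Vm markov s] subalgebra_past[OF M Vm markov] sets_future_subset[OF M Vm markov, of ?s]
    by (auto simp: subalgebra_def)
  note sets = P[THEN subsetD[OF sub(2)]] F[THEN subsetD[OF sub(3)]]
  have inS: "\<exists>S\<in>sets borel. D = ?ev (\<lambda>g. g ?s \<in> S)" if "D \<in> sets ?present" for D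
    using that by (auto simp: sets_present[OF M Vm markov])
  let ?in = "\<lambda>S g. g (13/16) \<in> (S :: real set)"
  \<comment> \<open>\<open>A\<close> is not determined by \<open>V\<close>, but its probabilities bound those of the four intersections of past and future\<close>
  define A where "A = X -` early_event L (\<lambda>g. P g \<and> F g \<and> ?in UNIV g) \<inter> space M"
  have loc: "admissible L (\<lambda>g. Q g \<and> R g \<and> ?in S g)"
    if "S \<in> sets borel" "Q = P \<or> Q = P'" "R = F \<or> R = F'" for S Q R
    by (rule admissible_cross[OF b L that(1)])
      (use that(2,3) in \<open>simp_all only: P_def P'_def[abs_def] F_def F'_def[abs_def]\<close>)
  have path_sets: "path_event L (\<lambda>g. Q g \<and> R g \<and> ?in S g) \<in> sets (path_space (bridge_paths b))"
    "early_event L (\<lambda>g. Q g \<and> R g \<and> ?in S g) \<in> sets (path_space (bridge_paths b))"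
    if "S \<in> sets borel" "Q = P \<or> Q = P'" "R = F \<or> R = F'" for S Q R
  proof -
    have 1: "path_event L (\<lambda>g. Q g \<and> R g \<and> ?in S g) \<in> sets L"
      using loc[OF that] unfolding admissible_def[OF b L] by (rule conjunct2)
    show "path_event L (\<lambda>g. Q g \<and> R g \<and> ?in S g) \<in> sets (path_space (bridge_paths b))"
      "early_event L (\<lambda>g. Q g \<and> R g \<and> ?in S g) \<in> sets (path_space (bridge_paths b))"
      using 1 window_sets(2)[OF b L 1] by (simp_all only: sL)
  qed
  have spX: "X \<omega> \<in> space L" if "\<omega> \<in> space M" for \<omega>
    using measurable_space[OF Xm that] by (simp add: L_def)
  have A: "A \<in> sets M" unfolding A_def using path_sets(2)[of UNIV P F] by (intro measurable_sets[OF Xm]) auto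
  have path: "measure M (?ev Q \<inter> ?ev R \<inter> ?ev (?in S)) = measure L (path_event L (\<lambda>g. Q g \<and> R g \<and> ?in S g))"
    if S: "S \<in> sets borel" and Q: "Q = P \<or> Q = P'" and R: "R = F \<or> R = F'" for S Q R
  proof -
    note E = path_sets(1)[OF that]
    have "?ev (?in S) \<in> sets M" using measurable_sets[OF Vm S, of ?s] by (simp add: vimage_def Int_def conj_commute)
    then have "?ev Q \<inter> ?ev R \<inter> ?ev (?in S) \<in> sets M" using sets Q R by auto
    moreover have "X -` path_event L (\<lambda>g. Q g \<and> R g \<and> ?in S g) \<inter> space M \<in> sets M"
      by (rule measurable_sets[OF Xm E])
    moreover have "AE \<omega> in M. \<omega> \<in> ?ev Q \<inter> ?ev R \<inter> ?ev (?in S) \<longleftrightarrow>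
        \<omega> \<in> X -` path_event L (\<lambda>g. Q g \<and> R g \<and> ?in S g) \<inter> space M"
      using XV AE_space by eventually_elim (auto simp: path_event_def[OF b L] spX)
    ultimately show ?thesis
      unfolding L_def measure_distr[OF Xm E[unfolded L_def]] by (intro finite_measure_eq_AE) (auto simp: L_def)
  qed
  have early: "measure M (A \<inter> ?ev (?in S)) = measure L (early_event L (\<lambda>g. P g \<and> F g \<and> ?in S g))"
    if S: "S \<in> sets borel" for S
  proof -
    have E: "early_event L (\<lambda>g. P g \<and> F g \<and> ?in S g) \<in> sets (path_space (bridge_paths b))"
      by (rule path_sets(2)[OF S]) auto
    have "?ev (?in S) \<in> sets M" using measurable_sets[OF Vm S, of ?s] by (simp add: vimage_def Int_def conj_commute)
    then have "A \<inter> ?ev (?in S) \<in> sets M" using A by auto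
    moreover have "X -` early_event L (\<lambda>g. P g \<and> F g \<and> ?in S g) \<inter> space M \<in> sets M"
      by (rule measurable_sets[OF Xm E])
    moreover have "AE \<omega> in M. \<omega> \<in> A \<inter> ?ev (?in S) \<longleftrightarrow>
        \<omega> \<in> X -` early_event L (\<lambda>g. P g \<and> F g \<and> ?in S g) \<inter> space M"
      using XV AE_space by eventually_elim (auto simp: A_def early_event_def[OF b L] spX)
    ultimately show ?thesis
      unfolding L_def measure_distr[OF Xm E[unfolded L_def]] by (intro finite_measure_eq_AE) (auto simp: L_def)
  qed
  note bounds = cross_bounds[OF b L, folded P_def P'_def F_def F'_def]
  have "measure M A = 0"
  proof (rule markov_cross_ratio[OF M Vm markov s P F A])
    fix D assume "D \<in> sets ?present"
    then obtain S where S: "S \<in> sets borel" and D: "D = ?ev (?in S)" using inS by blast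
    show "12 * measure M (A \<inter> D) \<le> measure M (?ev P \<inter> ?ev F \<inter> D)"
      unfolding D early[OF S] using bounds(1)[OF S] by (subst path[OF S]) auto
    show "measure M (?ev P' \<inter> ?ev F \<inter> D) \<le> 4 * measure M (A \<inter> D)"
      unfolding D early[OF S] using bounds(2)[OF S] by (subst path[OF S]) auto
    show "measure M (?ev P \<inter> ?ev F' \<inter> D) \<le> 2 * measure M (A \<inter> D)"
      unfolding D early[OF S] using bounds(3)[OF S] by (subst path[OF S]) auto
    show "measure M (A \<inter> D) \<le> measure M (?ev P' \<inter> ?ev F' \<inter> D)"
      unfolding D early[OF S] using bounds(4)[OF S] by (subst path[OF S]) auto
  qed
  moreover have "A \<inter> ?ev (?in UNIV) = A" by (auto simp: A_def)
  ultimately have "measure L (early_event L (\<lambda>g. P g \<and> F g \<and> ?in UNIV g)) = 0"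
    using early[of UNIV] by simp
  then have zero: "measure L (path_event L (\<lambda>g. P g \<and> F g \<and> ?in UNIV g)) \<le> 0"
    using bounds(5)[of UNIV] by simp
  \<comment> \<open>on the other hand, the intersection of \<open>P\<close> and \<open>F\<close> contains a tube of positive probability\<close>
  let ?tube = "{f \<in> space L. \<forall>t\<in>{0..1}. \<bar>f t - target_path b t\<bar> \<le> b / 256}"
  interpret L: prob_space L using L by (simp add: bridge_law_def)
  have "measure L ?tube \<le> measure L (path_event L (\<lambda>g. P g \<and> F g \<and> ?in UNIV g))"
  proof (rule L.finite_measure_mono)
    show "path_event L (\<lambda>g. P g \<and> F g \<and> ?in UNIV g) \<in> sets L" using path_sets(1)[of UNIV P F] by (simp add: sL)
    show "?tube \<subseteq> path_event L (\<lambda>g. P g \<and> F g \<and> ?in UNIV g)"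
      using vervaat_near_target[OF _ b] by (auto simp: path_event_def[OF b L] P_def F_def bridge_law_space[OF L])
  qed
  moreover have "0 < measure L ?tube"
    using tube_not_null(1)[OF L target_path_in_bridge_paths, of "b / 256"] b by simp
  ultimately show False using zero by simp
qed

end
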